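(* Let $k\ge1$ be an integer, let $B$ be the $k$-th order Eddington enhancement operator, let $\psi(\lambda)=\exp(2t_k^{-1}(\sqrt{\lambda}))$ for $\lambda\ge1$, let $g$ be a Gaussian spectrum, let $f\in L_2(\mathbb{R})$ be the solution of $Bf=g$, and let $M\ge0$. Then there exists a constant $C>0$, independent of $\epsilon$, such that for every $0<\epsilon\le 1/e$ and every $f_\alpha\in L_2(\mathbb{R})$ with $\|Bf_\alpha\|_\psi\le M$ and $\|Bf_\alpha-g\|=\epsilon$ one has $$\|f-f_\alpha\|\le C\,\epsilon\,|\log(\epsilon)|^k .$$
   Context: $\|\cdot\|$ and $(\cdot,\cdot)$ denote the norm and inner product of $L_2(\mathbb{R})$. $t_k(\eta)=\sum_{j=0}^k \eta^j/j!$ is the $k$-th order Taylor polynomial of the exponential function, and $t_k^{-1}:[1,\infty)\to[0,\infty)$ is the inverse of its restriction to $[0,\infty)$. The $k$-th order Eddington enhancement operator $B:L_2(\mathbb{R})\to L_2(\mathbb{R})$ is the convolution operator $Bf(x)=\int_{\mathbb{R}}b(x,y)f(y)\,dy$ with kernel $$b(x,y)=\frac1\pi\int_0^\infty\Big(\sum_{j=0}^k\frac{\omega^{2j}}{2^jj!}\Big)^{-1}\cos(\omega(x-y))\,d\omega,$$ i.e. multiplication by $1/t_k(\omega^2/2)$ in the Fourier domain; thus $Bf=g$ corresponds to $f=\sum_{j=0}^k\frac{(-1)^j}{2^jj!}g^{(2j)}$. A Gaussian spectrum is a function of the form $g(x)=\int_{\mathbb{R}}\frac{1}{\sqrt{2\pi}}e^{-(x-y)^2/2}u(y)\,dy$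 for some $u\in L_2(\mathbb{R})$. $H_\psi$ is the space of $g\in L_2(\mathbb{R})$ for which $\|g\|_\psi^2=(g,\psi((BB^* )^{-1})g)$ is finite, with $\psi((BB^* )^{-1})$ defined by the spectral theorem; $\|Bf_\alpha\|_\psi\le M$ includes the requirement $Bf_\alpha\in H_\psi$. A spectrum $f_\alpha$ satisfying $\|Bf_\alpha\|_\psi\le M$ (stability) and $\|Bf_\alpha-g\|=\epsilon$ (consistency) is called stably enhanced with $B$. *)

theory Defs
  imports "HOL-Analysis.Analysis"
begin

text \<open>
  Elements of \<open>L\<^sub>2(\<real>)\<close> are represented by complex-valued functions; two of them denote the same
  element iff they agree almost everywhere. Operators are maps on representatives.
\<close>

definition L2 :: "(real \<Rightarrow> complex) set" where
  "L2 = {f \<in> borel_measurable lborel. integrable lborel (\<lambda>x. (cmod (f x))\<^sup>2)}"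

definition l2_inner :: "(real \<Rightarrow> complex) \<Rightarrow> (real \<Rightarrow> complex) \<Rightarrow> complex" where
  "l2_inner f g = (LINT x|lborel. f x * cnj (g x))"

definition l2_norm :: "(real \<Rightarrow> complex) \<Rightarrow> real" where
  "l2_norm f = sqrt (LINT x|lborel. (cmod (f x))\<^sup>2)"

abbreviation l2_eq :: "(real \<Rightarrow> complex) \<Rightarrow> (real \<Rightarrow> complex) \<Rightarrow> bool" (infix "\<approx>\<^sub>2" 50) where
  "f \<approx>\<^sub>2 g \<equiv> (AE x in lborel. f x = g x)"


text \<open>
  A possibly unbounded operator is represented by its graph. In the next definition, \<open>(f, h)\<close>
  belongs to the graph iff \<open>h = A\<^sup>* f\<close>.
\<close>

definition adjoint_graph ::
    "((real \<Rightarrow> complex) \<Rightarrow> (real \<Rightarrow> complex)) \<Rightarrow> ((real \<Rightarrow> complex) \<times> (real \<Rightarrow> complex)) set" where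
  "adjoint_graph A =
     {(f, h). f \<in> L2 \<and> h \<in> L2 \<and> (\<forall>u\<in>L2. l2_inner (A u) f = l2_inner u h)}"

text \<open>The graph of \<open>(A A\<^sup>*)\<^sup>-\<^sup>1\<close>: pairs \<open>(g, f)\<close> with \<open>A (A\<^sup>* f) = g\<close>.\<close>

definition inverse_AAstar_graph ::
    "((real \<Rightarrow> complex) \<Rightarrow> (real \<Rightarrow> complex)) \<Rightarrow> ((real \<Rightarrow> complex) \<times> (real \<Rightarrow> complex)) set" where
  "inverse_AAstar_graph A =
     {(g, f). g \<in> L2 \<and> f \<in> L2 \<and> (\<exists>h. (f, h) \<in> adjoint_graph A \<and> A h \<approx>\<^sub>2 g)}"


text \<open>
  Linearity of each \<open>E S\<close> and its compatibility with equality almost everywhere follow from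
  symmetry; idempotence is multiplicativity at \<open>S = S'\<close>.
\<close>

definition projection_valued_measure ::
    "(real set \<Rightarrow> (real \<Rightarrow> complex) \<Rightarrow> (real \<Rightarrow> complex)) \<Rightarrow> bool" where
  "projection_valued_measure E \<longleftrightarrow>
     (\<forall>S\<in>sets borel. \<forall>f\<in>L2. E S f \<in> L2) \<and>
     (\<forall>S\<in>sets borel. \<forall>f\<in>L2. \<forall>g\<in>L2. l2_inner (E S f) g = l2_inner f (E S g)) \<and>
     (\<forall>S\<in>sets borel. \<forall>S'\<in>sets borel. \<forall>f\<in>L2. E S (E S' f) \<approx>\<^sub>2 E (S \<inter> S') f) \<and>
     (\<forall>f\<in>L2. E UNIV f \<approx>\<^sub>2 f) \<and>
     (\<forall>A::nat \<Rightarrow> real set. range A \<subseteq> sets borel \<longrightarrow> disjoint_family A \<longrightarrow>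
        (\<forall>f\<in>L2. \<forall>g\<in>L2.
           (\<lambda>n. l2_inner (E (A n) f) g) sums l2_inner (E (\<Union>n. A n) f) g))"

definition vector_measure ::
    "(real set \<Rightarrow> (real \<Rightarrow> complex) \<Rightarrow> (real \<Rightarrow> complex)) \<Rightarrow> (real \<Rightarrow> complex) \<Rightarrow> real measure" where
  "vector_measure E g =
     measure_of UNIV (sets borel) (\<lambda>S. ennreal (Re (l2_inner (E S g) g)))"

text \<open>
  \<open>E\<close> is the resolution of the identity of the self-adjoint operator with graph \<open>T\<close>, that is,
  \<open>T = \<integral> s dE(s)\<close> including equality of domains. The last conjunct is stated for the quadratic
  form; the sesquilinear form is recovered by polarization.
\<close>

definition is_spectral_measure ::
    "((real \<Rightarrow> complex) \<times> (real \<Rightarrow> complex)) set \<Rightarrow>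
     (real set \<Rightarrow> (real \<Rightarrow> complex) \<Rightarrow> (real \<Rightarrow> complex)) \<Rightarrow> bool" where
  "is_spectral_measure T E \<longleftrightarrow>
     projection_valued_measure E \<and>
     (\<forall>g\<in>L2. g \<in> Domain T \<longleftrightarrow> (\<integral>\<^sup>+s. ennreal (s\<^sup>2) \<partial>vector_measure E g) < \<infinity>) \<and>
     (\<forall>(g, h)\<in>T. l2_inner h g = complex_of_real (LINT s|vector_measure E g. s))"

text \<open>
  For self-adjoint \<open>T\<close> the spectral theorem gives existence, and uniqueness on Borel sets up to
  equality almost everywhere, so the vector measures do not depend on the choice.
\<close>

definition spectral_measure ::
    "((real \<Rightarrow> complex) \<times> (real \<Rightarrow> complex)) set \<Rightarrow>
     real set \<Rightarrow> (real \<Rightarrow> complex) \<Rightarrow> (real \<Rightarrow> complex)" where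
  "spectral_measure T = (SOME E. is_spectral_measure T E)"

text \<open>
  The value \<open>(g, \<psi>(T) g) \<in> [0, \<infinity>]\<close> for a self-adjoint \<open>T\<close> whose spectrum is contained in \<open>[1, \<infinity>)\<close>,
  where the nonnegative function \<open>\<psi>\<close> is only specified on \<open>[1, \<infinity>)\<close>.
\<close>

definition spectral_form ::
    "((real \<Rightarrow> complex) \<times> (real \<Rightarrow> complex)) set \<Rightarrow> (real \<Rightarrow> real) \<Rightarrow> (real \<Rightarrow> complex) \<Rightarrow> ennreal" where
  "spectral_form T \<psi> g = (\<integral>\<^sup>+s\<in>{1..}. ennreal (\<psi> s) \<partial>vector_measure (spectral_measure T) g)"


definition taylor_exp :: "nat \<Rightarrow> real \<Rightarrow> real" where
  "taylor_exp k \<eta> = (\<Sum>j\<le>k. \<eta> ^ j / fact j)"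

definition taylor_exp_inv :: "nat \<Rightarrow> real \<Rightarrow> real" where
  "taylor_exp_inv k = the_inv_into {0..} (taylor_exp k)"

definition eddington_kernel :: "nat \<Rightarrow> real \<Rightarrow> real \<Rightarrow> real" where
  "eddington_kernel k x y =
     (1 / pi) * (LINT \<omega>:{0..}|lborel.
        inverse (\<Sum>j\<le>k. \<omega> ^ (2 * j) / (2 ^ j * fact j)) * cos (\<omega> * (x - y)))"

definition eddington :: "nat \<Rightarrow> (real \<Rightarrow> complex) \<Rightarrow> (real \<Rightarrow> complex)" where
  "eddington k f x = (LINT y|lborel. complex_of_real (eddington_kernel k x y) * f y)"

definition psi :: "nat \<Rightarrow> real \<Rightarrow> real" where
  "psi k s = exp (2 * taylor_exp_inv k (sqrt s))"

definition H_psi :: "nat \<Rightarrow> (real \<Rightarrow> complex) set" where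
  "H_psi k = {g \<in> L2. spectral_form (inverse_AAstar_graph (eddington k)) (psi k) g < \<infinity>}"

definition psi_norm :: "nat \<Rightarrow> (real \<Rightarrow> complex) \<Rightarrow> real" where
  "psi_norm k g = sqrt (enn2real (spectral_form (inverse_AAstar_graph (eddington k)) (psi k) g))"

definition gaussian_spectrum :: "(real \<Rightarrow> complex) \<Rightarrow> bool" where
  "gaussian_spectrum g \<longleftrightarrow> g \<in> L2 \<and>
     (\<exists>u\<in>L2. g \<approx>\<^sub>2
        (\<lambda>x. LINT y|lborel. complex_of_real (1 / sqrt (2 * pi) * exp (- ((x - y)\<^sup>2 / 2))) * u y))"

end

theory Submission
  imports Defs "HOL-Probability.Probability"
begin

text \<open>
  In the Fourier domain \<open>B\<close> is multiplication by \<open>1/t\<^sub>k(w\<^sup>2/2)\<close>, so \<open>(B B\<^sup>*)\<^sup>-\<^sup>1\<close> is multiplication by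
  \<open>t\<^sub>k(w\<^sup>2/2)\<^sup>2\<close>, and \<open>\<psi>\<close> is chosen such that \<open>\<parallel>g\<parallel>\<^sub>\<psi>\<^sup>2\<close> is the integral of \<open>e\<^bsup>w\<^sup>2\<^esup> |g\<^sup>\<and>(w)|\<^sup>2\<close>
  (\<open>spectral_form_eddington\<close>). The misfit \<open>d = B f\<^sub>\<alpha> - g\<close> satisfies two bounds: its plain \<open>L\<^sub>2\<close> norm is
  \<open>\<epsilon>\<close>, and its norm with the weight \<open>e\<^bsup>w\<^sup>2\<^esup>\<close> is at most a constant, for \<open>B f\<^sub>\<alpha>\<close> by stability and for \<open>g\<close>
  because \<open>g\<^sup>\<and>(w) = e\<^bsup>-w\<^sup>2/2\<^esup> u\<^sup>\<and>(w)\<close>. The error \<open>\<parallel>f - f\<^sub>\<alpha>\<parallel>\<close> is the norm of \<open>d\<close> with the intermediate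
  weight \<open>t\<^sub>k(w\<^sup>2/2)\<^sup>2\<close>. Splitting the frequencies at \<open>w\<^sup>2/2 = L = |log \<epsilon>|\<close>, the first bound
  controls the low and the second the high frequencies (\<open>taylor_exp_interpolation\<close>); together they
  give \<open>O(t\<^sub>k(L) \<epsilon>)\<close>, and \<open>t\<^sub>k(L) \<le> e L\<^sup>k\<close> for \<open>L \<ge> 1\<close>.

  The Fourier transform on \<open>L\<^sub>2(\<real>)\<close> is constructed from truncations. It contracts on integrable
  functions (\<open>fourier_L1_contraction\<close>), hence extends by completeness (\<open>Riesz_Fischer\<close>), and it is
  unitary because \<open>F\<^sup>* F\<close> fixes the modulated Gaussians (\<open>fourier_adj_fourier\<close>). Convolutions whose
  kernel has an integrable bounded multiplier become multiplications (\<open>convolution_eq_multiplier\<close>);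
  this covers \<open>B\<close> and the convolution that defines Gaussian spectra.

  The norm \<open>\<parallel>g\<parallel>\<^sub>\<psi>\<close> refers to an arbitrarily chosen spectral measure of \<open>(B B\<^sup>*)\<^sup>-\<^sup>1\<close>. One exists, namely
  multiplication by \<open>1\<^sub>S(t\<^sub>k(w\<^sup>2/2)\<^sup>2)\<close> (\<open>is_spectral_measure_multiplier_projection\<close>), and all of them
  have the same vector measures (\<open>vector_measure_unique\<close>). For the latter let \<open>E\<close> be any spectral measure of
  the multiplication operator \<open>T\<close> by \<open>w\<close>, and \<open>S = [c - \<delta>, c + \<delta>]\<close>. The range of \<open>E S\<close> is invariant under \<open>T\<close>, and \<open>T - c\<close>
  has norm at most \<open>\<delta>\<close> there; iterating, every vector in this range is supported where
  \<open>|w - c| \<le> \<delta>\<close>. Hence the vector measures of \<open>E\<close> are bounded on intervals by the explicit ones, and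
  equality of the total masses makes them equal.
\<close>

section \<open>The Hilbert space of square-integrable functions\<close>

lemma L2_measurable: "f \<in> L2 \<Longrightarrow> f \<in> borel_measurable borel"
  by (simp add: L2_def)

lemma L2_integrable: "f \<in> L2 \<Longrightarrow> integrable lborel (\<lambda>x. (cmod (f x))\<^sup>2)"
  by (simp add: L2_def)

lemma L2_iff_nn_integral:
  "f \<in> L2 \<longleftrightarrow> f \<in> borel_measurable borel \<and> (\<integral>\<^sup>+x. ennreal ((cmod (f x))\<^sup>2) \<partial>lborel) < \<infinity>"
  by (auto simp: L2_def integrable_iff_bounded)

lemma L2_dominated:
  assumes "g \<in> L2" and [measurable]: "f \<in> borel_measurable borel"
    and "\<And>x. cmod (f x) \<le> c * cmod (g x)"
  shows "f \<in> L2"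
proof -
  have "integrable lborel (\<lambda>x. c\<^sup>2 * (cmod (g x))\<^sup>2)"
    using L2_integrable[OF assms(1)] by auto
  then have "integrable lborel (\<lambda>x. (cmod (f x))\<^sup>2)"
  proof (rule Bochner_Integration.integrable_bound)
    have "(cmod (f x))\<^sup>2 \<le> c\<^sup>2 * (cmod (g x))\<^sup>2" for x
      using power_mono[OF assms(3)[of x], of 2] by (simp add: power_mult_distrib)
    then show "AE x in lborel. norm ((cmod (f x))\<^sup>2) \<le> norm (c\<^sup>2 * (cmod (g x))\<^sup>2)"
      by auto
  qed simp
  then show ?thesis by (simp add: L2_def)
qed

lemma L2_add: assumes "f \<in> L2" "g \<in> L2" shows "(\<lambda>x. f x + g x) \<in> L2"
proof -
  have [measurable]: "f \<in> borel_measurable borel" "g \<in> borel_measurable borel"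
    using assms by (auto dest: L2_measurable)
  have "integrable lborel (\<lambda>x. 2 * (cmod (f x))\<^sup>2 + 2 * (cmod (g x))\<^sup>2)"
    using L2_integrable[OF assms(1)] L2_integrable[OF assms(2)] by simp
  then have "integrable lborel (\<lambda>x. (cmod (f x + g x))\<^sup>2)"
  proof (rule Bochner_Integration.integrable_bound)
    have "(cmod (f x + g x))\<^sup>2 \<le> 2 * (cmod (f x))\<^sup>2 + 2 * (cmod (g x))\<^sup>2" for x
    proof -
      have "(cmod (f x + g x))\<^sup>2 \<le> (cmod (f x) + cmod (g x))\<^sup>2"
        by (intro power_mono norm_triangle_ineq) auto
      also have "\<dots> \<le> 2 * (cmod (f x))\<^sup>2 + 2 * (cmod (g x))\<^sup>2"
        using sum_squares_bound[of "cmod (f x)" "cmod (g x)"] by (simp add: power2_sum)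
      finally show ?thesis .
    qed
    then show "AE x in lborel. norm ((cmod (f x + g x))\<^sup>2) \<le> norm (2 * (cmod (f x))\<^sup>2 + 2 * (cmod (g x))\<^sup>2)"
      by auto
  qed simp
  then show ?thesis by (simp add: L2_def)
qed

lemma L2_cmult: "f \<in> L2 \<Longrightarrow> (\<lambda>x. c * f x) \<in> L2"
  by (rule L2_dominated[where g = f and c = "cmod c"]) (simp_all add: norm_mult borel_measurable_times L2_measurable)

lemma L2_diff: assumes "f \<in> L2" "g \<in> L2" shows "(\<lambda>x. f x - g x) \<in> L2"
  using L2_add[OF assms(1) L2_cmult[OF assms(2), of "-1"]] by simp

lemma borel_measurable_cnj [measurable (raw)]:
  "f \<in> borel_measurable M \<Longrightarrow> (\<lambda>x. cnj (f x)) \<in> borel_measurable M"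
  by (rule measurable_compose[OF _ borel_measurable_continuous_onI]) (auto intro!: continuous_intros)

lemma L2_cnj: "f \<in> L2 \<Longrightarrow> (\<lambda>x. cnj (f x)) \<in> L2"
  by (simp add: L2_def borel_measurable_cnj)

lemma L2_bounded_mult:
  assumes "f \<in> L2" and [measurable]: "m \<in> borel_measurable borel" and "\<And>x. cmod (m x) \<le> c"
  shows "(\<lambda>x. m x * f x) \<in> L2"
proof (rule L2_dominated[OF assms(1)])
  have [measurable]: "f \<in> borel_measurable borel" by (rule L2_measurable[OF assms(1)])
  show "(\<lambda>x. m x * f x) \<in> borel_measurable borel" by measurable
  show "cmod (m x * f x) \<le> c * cmod (f x)" for x
    unfolding norm_mult by (rule mult_right_mono[OF assms(3)]) simp
qed

lemma L2_indicator_mult: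
  assumes "f \<in> L2" "S \<in> sets borel"
  shows "(\<lambda>x. indicator S x * f x) \<in> L2"
  using assms by (intro L2_bounded_mult[where c = 1]) (simp_all add: indicator_def)

lemma L2_AE_cong:
  assumes "f \<in> L2" "f \<approx>\<^sub>2 g" "g \<in> borel_measurable borel" shows "g \<in> L2"
proof -
  have [measurable]: "f \<in> borel_measurable borel" "g \<in> borel_measurable borel"
    using assms by (auto dest: L2_measurable)
  have "(\<integral>\<^sup>+x. ennreal ((cmod (g x))\<^sup>2) \<partial>lborel) = (\<integral>\<^sup>+x. ennreal ((cmod (f x))\<^sup>2) \<partial>lborel)"
    using assms(2) by (intro nn_integral_cong_AE) auto
  then show ?thesis using assms by (simp add: L2_iff_nn_integral)
qed

lemma L2_mult_integrable:
  assumes "f \<in> L2" "g \<in> L2" shows "integrable lborel (\<lambda>x. f x * g x)"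
proof -
  have [measurable]: "f \<in> borel_measurable borel" "g \<in> borel_measurable borel"
    using assms by (auto dest: L2_measurable)
  have "integrable lborel (\<lambda>x. (cmod (f x))\<^sup>2 + (cmod (g x))\<^sup>2)"
    using L2_integrable[OF assms(1)] L2_integrable[OF assms(2)] by simp
  then show ?thesis
  proof (rule Bochner_Integration.integrable_bound)
    have "cmod (f x * g x) \<le> (cmod (f x))\<^sup>2 + (cmod (g x))\<^sup>2" for x
    proof -
      have "2 * (cmod (f x) * cmod (g x)) \<le> (cmod (f x))\<^sup>2 + (cmod (g x))\<^sup>2"
        using sum_squares_bound[of "cmod (f x)" "cmod (g x)"] by simp
      moreover have "0 \<le> cmod (f x) * cmod (g x)" by simp
      ultimately show ?thesis unfolding norm_mult by linarith
    qed
    then show "AE x in lborel. norm (f x * g x) \<le> norm ((cmod (f x))\<^sup>2 + (cmod (g x))\<^sup>2)"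
      by auto
  qed simp
qed

lemma L2_inner_integrable:
  "f \<in> L2 \<Longrightarrow> g \<in> L2 \<Longrightarrow> integrable lborel (\<lambda>x. f x * cnj (g x))"
  by (intro L2_mult_integrable L2_cnj)

lemma l2_norm_nonneg [simp]: "0 \<le> l2_norm f"
  by (simp add: l2_norm_def)

lemma l2_norm_power2: "(l2_norm f)\<^sup>2 = (LINT x|lborel. (cmod (f x))\<^sup>2)"
  by (simp add: l2_norm_def)

lemma nn_integral_L2:
  "f \<in> L2 \<Longrightarrow> (\<integral>\<^sup>+x. ennreal ((cmod (f x))\<^sup>2) \<partial>lborel) = ennreal ((l2_norm f)\<^sup>2)"
  unfolding l2_norm_power2 by (intro nn_integral_eq_integral L2_integrable) auto

lemma l2_inner_self: "l2_inner f f = of_real ((l2_norm f)\<^sup>2)"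
proof -
  have "l2_inner f f = (LINT x|lborel. complex_of_real ((cmod (f x))\<^sup>2))"
    unfolding l2_inner_def by (simp only: complex_norm_square)
  then show ?thesis unfolding l2_norm_power2 by (simp only: integral_complex_of_real)
qed

lemma l2_inner_commute: "l2_inner g f = cnj (l2_inner f g)"
proof -
  have "cnj (l2_inner f g) = (LINT x|lborel. cnj (f x * cnj (g x)))"
    unfolding l2_inner_def by (rule Bochner_Integration.integral_cnj[symmetric])
  then show ?thesis by (simp add: l2_inner_def mult.commute)
qed

lemma l2_inner_cong:
  assumes "f \<approx>\<^sub>2 f'" "g \<approx>\<^sub>2 g'" "f \<in> L2" "f' \<in> L2" "g \<in> L2" "g' \<in> L2"
  shows "l2_inner f g = l2_inner f' g'"
proof -
  have [measurable]: "f \<in> borel_measurable borel" "g \<in> borel_measurable borel"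
     "f' \<in> borel_measurable borel" "g' \<in> borel_measurable borel"
    using assms by (auto dest: L2_measurable)
  show ?thesis unfolding l2_inner_def
    by (rule integral_cong_AE) (use assms(1,2) in auto)
qed

lemma l2_norm_cong:
  assumes "f \<approx>\<^sub>2 f'" "f \<in> L2" "f' \<in> L2"
  shows "l2_norm f = l2_norm f'"
proof -
  have [measurable]: "f \<in> borel_measurable borel" "f' \<in> borel_measurable borel"
    using assms by (auto dest: L2_measurable)
  show ?thesis unfolding l2_norm_def
    by (subst integral_cong_AE[where g = "\<lambda>x. (cmod (f' x))\<^sup>2"]) (use assms(1) in auto)
qed

lemma l2_inner_add_left:
  assumes "f \<in> L2" "g \<in> L2" "h \<in> L2"
  shows "l2_inner (\<lambda>x. f x + g x) h = l2_inner f h + l2_inner g h"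
  unfolding l2_inner_def using assms by (simp add: distrib_right L2_inner_integrable)

lemma l2_inner_diff_left:
  assumes "f \<in> L2" "g \<in> L2" "h \<in> L2"
  shows "l2_inner (\<lambda>x. f x - g x) h = l2_inner f h - l2_inner g h"
  unfolding l2_inner_def using assms by (simp add: left_diff_distrib L2_inner_integrable)

lemma l2_inner_cmult_left: "l2_inner (\<lambda>x. c * f x) h = c * l2_inner f h"
  unfolding l2_inner_def by (simp add: mult.assoc)

lemma l2_inner_add_right:
  assumes "f \<in> L2" "g \<in> L2" "h \<in> L2"
  shows "l2_inner h (\<lambda>x. f x + g x) = l2_inner h f + l2_inner h g"
  by (simp add: l2_inner_commute[of h] l2_inner_add_left assms)

lemma l2_inner_diff_right:
  assumes "f \<in> L2" "g \<in> L2" "h \<in> L2"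
  shows "l2_inner h (\<lambda>x. f x - g x) = l2_inner h f - l2_inner h g"
  by (simp add: l2_inner_commute[of h] l2_inner_diff_left assms)

lemma l2_inner_cmult_right: "l2_inner h (\<lambda>x. c * f x) = cnj c * l2_inner h f"
  by (simp add: l2_inner_commute[of h] l2_inner_cmult_left)

lemma l2_norm_cnj: "l2_norm (\<lambda>x. cnj (f x)) = l2_norm f"
  by (simp add: l2_norm_def)

lemma l2_norm_minus_commute: "l2_norm (\<lambda>x. f x - g x) = l2_norm (\<lambda>x. g x - f x)"
  by (simp add: l2_norm_def norm_minus_commute)

lemma l2_norm_eq_0_iff:
  assumes "f \<in> L2" shows "l2_norm f = 0 \<longleftrightarrow> f \<approx>\<^sub>2 (\<lambda>x. 0)"
proof -
  have "l2_norm f = 0 \<longleftrightarrow> (LINT x|lborel. (cmod (f x))\<^sup>2) = 0"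
    by (simp add: l2_norm_def)
  also have "\<dots> \<longleftrightarrow> (AE x in lborel. (cmod (f x))\<^sup>2 = 0)"
    by (rule integral_nonneg_eq_0_iff_AE) (auto intro: L2_integrable[OF assms])
  finally show ?thesis by simp
qed

lemma l2_Cauchy_Schwarz:
  assumes "f \<in> L2" "g \<in> L2"
  shows "cmod (l2_inner f g) \<le> l2_norm f * l2_norm g"
proof -
  have [measurable]: "f \<in> borel_measurable borel" "g \<in> borel_measurable borel"
    using assms by (auto dest: L2_measurable)
  have "ennreal (cmod (l2_inner f g)) \<le> (\<integral>\<^sup>+x. ennreal (cmod (f x)) * ennreal (cmod (g x)) \<partial>lborel)"
    unfolding l2_inner_def using integral_norm_bound_ennreal[OF L2_inner_integrable[OF assms]]
    by (simp add: norm_mult ennreal_mult)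
  then have "(ennreal (cmod (l2_inner f g)))\<^sup>2 \<le> (\<integral>\<^sup>+x. ennreal (cmod (f x)) * ennreal (cmod (g x)) \<partial>lborel)\<^sup>2"
    by (intro power_mono) auto
  also have "\<dots> \<le> (\<integral>\<^sup>+x. (ennreal (cmod (f x)))\<^sup>2 \<partial>lborel) * (\<integral>\<^sup>+x. (ennreal (cmod (g x)))\<^sup>2 \<partial>lborel)"
    by (rule Cauchy_Schwarz_nn_integral) auto
  also have "\<dots> = ennreal ((l2_norm f * l2_norm g)\<^sup>2)"
    using assms by (simp add: nn_integral_L2 ennreal_power ennreal_mult power_mult_distrib)
  finally have "(cmod (l2_inner f g))\<^sup>2 \<le> (l2_norm f * l2_norm g)\<^sup>2"
    by (simp add: ennreal_power)
  then show ?thesis by (rule power2_le_imp_le) simp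
qed

lemma l2_norm_triangle:
  assumes "f \<in> L2" "g \<in> L2"
  shows "l2_norm (\<lambda>x. f x + g x) \<le> l2_norm f + l2_norm g"
proof (rule power2_le_imp_le)
  have "complex_of_real ((l2_norm (\<lambda>x. f x + g x))\<^sup>2) =
      of_real ((l2_norm f)\<^sup>2) + of_real ((l2_norm g)\<^sup>2) + (l2_inner f g + cnj (l2_inner f g))"
    using assms l2_inner_commute[of g f]
    by (simp add: l2_inner_self[symmetric] l2_inner_add_left l2_inner_add_right L2_add del: of_real_power)
  also have "l2_inner f g + cnj (l2_inner f g) = of_real (2 * Re (l2_inner f g))"
    by (rule complex_add_cnj)
  finally have "(l2_norm (\<lambda>x. f x + g x))\<^sup>2 = (l2_norm f)\<^sup>2 + (l2_norm g)\<^sup>2 + 2 * Re (l2_inner f g)"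
    by (simp only: of_real_add[symmetric] of_real_eq_iff)
  also have "\<dots> \<le> (l2_norm f)\<^sup>2 + (l2_norm g)\<^sup>2 + 2 * (l2_norm f * l2_norm g)"
    using l2_Cauchy_Schwarz[OF assms] complex_Re_le_cmod[of "l2_inner f g"] by linarith
  finally show "(l2_norm (\<lambda>x. f x + g x))\<^sup>2 \<le> (l2_norm f + l2_norm g)\<^sup>2"
    by (simp add: power2_sum)
qed simp

lemma l2_dist_triangle:
  assumes "f \<in> L2" "g \<in> L2" "h \<in> L2"
  shows "l2_norm (\<lambda>x. f x - h x) \<le> l2_norm (\<lambda>x. f x - g x) + l2_norm (\<lambda>x. g x - h x)"
  using l2_norm_triangle[OF L2_diff[OF assms(1,2)] L2_diff[OF assms(2,3)]] by simp

text \<open>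
  Testing against all of \<open>L\<^sub>2\<close> is the way in which operators on representatives, which are only
  determined up to null sets, are shown to be linear and to respect equality almost everywhere.
\<close>

lemma l2_eq_by_testing:
  assumes "f \<in> L2" "g \<in> L2" "\<And>u. u \<in> L2 \<Longrightarrow> l2_inner f u = l2_inner g u"
  shows "f \<approx>\<^sub>2 g"
proof -
  let ?d = "\<lambda>x. f x - g x"
  have d: "?d \<in> L2" by (intro L2_diff assms)
  have "l2_inner ?d ?d = 0"
    using assms(3)[OF d] assms(1,2) d by (simp add: l2_inner_diff_left)
  then have "l2_norm ?d = 0" by (simp add: l2_inner_self)
  then show ?thesis using d by (auto simp: l2_norm_eq_0_iff)
qed

lemma l2_limit_unique:
  assumes "\<And>n. f n \<in> L2" "g \<in> L2" "h \<in> L2"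
    and "(\<lambda>n. l2_norm (\<lambda>x. f n x - g x)) \<longlonglongrightarrow> 0" "(\<lambda>n. l2_norm (\<lambda>x. f n x - h x)) \<longlonglongrightarrow> 0"
  shows "g \<approx>\<^sub>2 h"
proof -
  have lim: "(\<lambda>n. l2_norm (\<lambda>x. f n x - g x) + l2_norm (\<lambda>x. f n x - h x)) \<longlonglongrightarrow> 0"
    using tendsto_add[OF assms(4,5)] by simp
  have "l2_norm (\<lambda>x. g x - h x) \<le> 0"
  proof (rule LIMSEQ_le_const[OF lim], intro exI allI impI)
    fix n
    show "l2_norm (\<lambda>x. g x - h x) \<le> l2_norm (\<lambda>x. f n x - g x) + l2_norm (\<lambda>x. f n x - h x)"
      using l2_dist_triangle[OF assms(2) assms(1)[of n] assms(3)] l2_norm_minus_commute[of g "f n"] by simp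
  qed
  then have "l2_norm (\<lambda>x. g x - h x) = 0" using l2_norm_nonneg[of "\<lambda>x. g x - h x"] by linarith
  then show ?thesis using L2_diff[OF assms(2,3)] by (auto simp: l2_norm_eq_0_iff)
qed

lemma l2_inner_tendsto:
  assumes "\<And>n. f n \<in> L2" "\<And>n. g n \<in> L2" "a \<in> L2" "b \<in> L2"
    and "(\<lambda>n. l2_norm (\<lambda>x. f n x - a x)) \<longlonglongrightarrow> 0" "(\<lambda>n. l2_norm (\<lambda>x. g n x - b x)) \<longlonglongrightarrow> 0"
  shows "(\<lambda>n. l2_inner (f n) (g n)) \<longlonglongrightarrow> l2_inner a b"
proof -
  have *: "l2_inner (f n) (g n) - l2_inner a b =
      l2_inner (\<lambda>x. f n x - a x) (\<lambda>x. g n x - b x) + l2_inner (\<lambda>x. f n x - a x) b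
      + l2_inner a (\<lambda>x. g n x - b x)" for n
    using assms(1-4) by (simp add: l2_inner_diff_left l2_inner_diff_right L2_diff)
  have bound: "norm (l2_inner (f n) (g n) - l2_inner a b) \<le>
      l2_norm (\<lambda>x. f n x - a x) * l2_norm (\<lambda>x. g n x - b x) + l2_norm (\<lambda>x. f n x - a x) * l2_norm b
      + l2_norm a * l2_norm (\<lambda>x. g n x - b x)" for n
    unfolding * using assms(1-4)
    by (intro order_trans[OF norm_triangle_ineq] add_mono l2_Cauchy_Schwarz L2_diff)
  have "(\<lambda>n. l2_norm (\<lambda>x. f n x - a x) * l2_norm (\<lambda>x. g n x - b x) + l2_norm (\<lambda>x. f n x - a x) * l2_norm b
      + l2_norm a * l2_norm (\<lambda>x. g n x - b x)) \<longlonglongrightarrow> 0 * 0 + 0 * l2_norm b + l2_norm a * 0"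
    by (intro tendsto_intros assms)
  then have "(\<lambda>n. l2_norm (\<lambda>x. f n x - a x) * l2_norm (\<lambda>x. g n x - b x) + l2_norm (\<lambda>x. f n x - a x) * l2_norm b
      + l2_norm a * l2_norm (\<lambda>x. g n x - b x)) \<longlonglongrightarrow> 0" by simp
  then have "(\<lambda>n. l2_inner (f n) (g n) - l2_inner a b) \<longlonglongrightarrow> 0"
    by (rule Lim_null_comparison[rotated]) (intro always_eventually allI bound)
  then show ?thesis by (simp add: LIM_zero_iff)
qed

text \<open>
  Along a subsequence with squared increments at most \<open>8\<^sup>-\<^sup>k\<close>, the weighted sum of
  the squared increments with weights \<open>4\<^sup>k\<close> is integrable, hence finite almost everywhere;
  this makes the increments geometrically small pointwise. Fatou's lemma identifies the pointwise
  limit as the limit in the norm.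
\<close>

theorem Riesz_Fischer:
  assumes f: "\<And>n. f n \<in> L2"
    and Cauchy: "\<And>e. e > 0 \<Longrightarrow> \<exists>N. \<forall>m\<ge>N. \<forall>n\<ge>N. l2_norm (\<lambda>x. f m x - f n x) < e"
  shows "\<exists>h\<in>L2. (\<lambda>n. l2_norm (\<lambda>x. f n x - h x)) \<longlonglongrightarrow> 0"
proof -
  have "\<exists>N. \<forall>m\<ge>N. \<forall>n\<ge>N. (l2_norm (\<lambda>x. f m x - f n x))\<^sup>2 \<le> (1/8)^k" for k :: nat
  proof -
    obtain N where N: "\<forall>m\<ge>N. \<forall>n\<ge>N. l2_norm (\<lambda>x. f m x - f n x) < sqrt ((1/8)^k)"
      using Cauchy[of "sqrt ((1/8)^k)"] by auto
    have "(l2_norm (\<lambda>x. f m x - f n x))\<^sup>2 \<le> (1/8)^k" if "m \<ge> N" "n \<ge> N" for m n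
      using N that by (intro sqrt_ge_absD) (simp add: less_imp_le)
    then show ?thesis by blast
  qed
  then obtain N where N: "\<And>k m n. m \<ge> N k \<Longrightarrow> n \<ge> N k \<Longrightarrow> (l2_norm (\<lambda>x. f m x - f n x))\<^sup>2 \<le> (1/8)^k"
    by metis
  define R where "R k = (\<Sum>j\<le>k. N j)" for k
  have R: "R k \<ge> N j" if "j \<le> k" for j k
    unfolding R_def using that by (intro member_le_sum) auto
  define g where "g k = f (R k)" for k
  have [measurable]: "f k \<in> borel_measurable borel" "g k \<in> borel_measurable borel" for k
    using f unfolding g_def by (auto dest: L2_measurable)
  have nn_diff: "(\<integral>\<^sup>+x. ennreal ((cmod (f m x - f n x))\<^sup>2) \<partial>lborel) \<le> ennreal ((1/8)^k)"
    if "m \<ge> N k" "n \<ge> N k" for m n k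
    using N[OF that] nn_integral_L2[OF L2_diff[OF f f], of m n] by (simp add: ennreal_leI)
  let ?W = "\<lambda>x. \<Sum>k. ennreal (4^k * (cmod (g (Suc k) x - g k x))\<^sup>2)"
  have "(\<integral>\<^sup>+x. ?W x \<partial>lborel) = (\<Sum>k. \<integral>\<^sup>+x. ennreal (4^k * (cmod (g (Suc k) x - g k x))\<^sup>2) \<partial>lborel)"
    by (rule nn_integral_suminf) simp
  also have "\<dots> \<le> (\<Sum>k. ennreal ((1/2)^k))"
  proof (intro suminf_le allI)
    fix k
    have "(\<integral>\<^sup>+x. ennreal (4^k * (cmod (g (Suc k) x - g k x))\<^sup>2) \<partial>lborel)
        = ennreal (4^k) * (\<integral>\<^sup>+x. ennreal ((cmod (g (Suc k) x - g k x))\<^sup>2) \<partial>lborel)"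
      by (subst nn_integral_cmult[symmetric]) (auto simp: ennreal_mult)
    also have "\<dots> \<le> ennreal (4^k) * ennreal ((1/8)^k)"
      unfolding g_def by (intro mult_left_mono nn_diff R) auto
    also have "\<dots> = ennreal ((1/2)^k)"
      by (subst ennreal_mult[symmetric]) (auto simp: power_mult_distrib[symmetric])
    finally show "(\<integral>\<^sup>+x. ennreal (4^k * (cmod (g (Suc k) x - g k x))\<^sup>2) \<partial>lborel) \<le> ennreal ((1/2)^k)" .
  qed auto
  also have "\<dots> < \<infinity>"
    by (subst suminf_ennreal2) (auto intro: summable_geometric)
  finally have finite_W: "AE x in lborel. ?W x \<noteq> \<infinity>"
    by (intro nn_integral_PInf_AE) auto
  have finite_ennreal: "\<exists>C\<ge>0. w = ennreal C" if "w \<noteq> \<infinity>" for w :: ennreal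
    using that by (cases w) auto
  from finite_W have conv: "AE x in lborel. (\<lambda>k. g k x) \<longlonglongrightarrow> lim (\<lambda>k. g k x)"
  proof eventually_elim
    case (elim x)
    from finite_ennreal[OF this] obtain C where C: "?W x = ennreal C" "C \<ge> 0" by blast
    have le: "cmod (g (Suc k) x - g k x) \<le> sqrt C * (1/2)^k" for k
    proof -
      have "ennreal (4^k * (cmod (g (Suc k) x - g k x))\<^sup>2) \<le> ?W x"
        using sum_le_suminf[of "\<lambda>k. ennreal (4^k * (cmod (g (Suc k) x - g k x))\<^sup>2)" "{k}",
            OF summableI] by (metis (no_types, lifting) finite.emptyI finite.insertI sum.empty sum.insert
              empty_iff add.right_neutral zero_le)
      then have "4^k * (cmod (g (Suc k) x - g k x))\<^sup>2 \<le> C"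
        unfolding C(1) using C(2) by (simp add: ennreal_le_iff)
      then have "(2^k * cmod (g (Suc k) x - g k x))\<^sup>2 \<le> C"
        using power_mult_distrib[of "2::real" 2 k] by (simp add: power2_eq_square mult_ac)
      then have "2^k * cmod (g (Suc k) x - g k x) \<le> sqrt C"
        by (rule real_le_rsqrt)
      then show ?thesis by (simp add: field_simps power_one_over)
    qed
    have "summable (\<lambda>k. g (Suc k) x - g k x)"
      by (rule summable_comparison_test'[where g = "\<lambda>k. sqrt C * (1/2)^k" and N = 0])
        (use le in \<open>auto intro!: summable_mult summable_geometric\<close>)
    then have "convergent (\<lambda>n. \<Sum>k<n. g (Suc k) x - g k x)" by (simp add: summable_iff_convergent)
    moreover have "(\<Sum>k<n. g (Suc k) x - g k x) = g n x - g 0 x" for n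
      by (induction n) auto
    ultimately have "convergent (\<lambda>n. g n x - g 0 x)" by simp
    then have "convergent (\<lambda>n. g n x)" using convergent_add_const_iff[of "- g 0 x" "\<lambda>n. g n x"] by simp
    then show ?case by (simp add: convergent_LIMSEQ_iff)
  qed
  define h where "h x = lim (\<lambda>k. g k x)" for x
  have [measurable]: "h \<in> borel_measurable borel"
    unfolding h_def by (rule borel_measurable_lim_metric) auto
  have nn_lim: "(\<integral>\<^sup>+x. ennreal ((cmod (f m x - h x))\<^sup>2) \<partial>lborel) \<le> ennreal ((1/8)^k)"
    if m: "m \<ge> N k" for m k
  proof -
    have "(\<integral>\<^sup>+x. ennreal ((cmod (f m x - h x))\<^sup>2) \<partial>lborel)
        = (\<integral>\<^sup>+x. liminf (\<lambda>n. ennreal ((cmod (f m x - g n x))\<^sup>2)) \<partial>lborel)"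
    proof (rule nn_integral_cong_AE, use conv in eventually_elim)
      case (elim x)
      have "(\<lambda>n. ennreal ((cmod (f m x - g n x))\<^sup>2)) \<longlonglongrightarrow> ennreal ((cmod (f m x - h x))\<^sup>2)"
        unfolding h_def by (intro tendsto_intros tendsto_ennrealI elim)
      then show ?case by (rule lim_imp_Liminf[OF sequentially_bot, symmetric])
    qed
    also have "\<dots> \<le> liminf (\<lambda>n. \<integral>\<^sup>+x. ennreal ((cmod (f m x - g n x))\<^sup>2) \<partial>lborel)"
      by (rule nn_integral_liminf) simp
    also have "\<dots> \<le> ennreal ((1/8)^k)"
    proof (rule Liminf_le)
      show "\<forall>\<^sub>F n in sequentially. (\<integral>\<^sup>+x. ennreal ((cmod (f m x - g n x))\<^sup>2) \<partial>lborel) \<le> ennreal ((1/8)^k)"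
        unfolding g_def eventually_sequentially by (intro exI[of _ k] allI impI nn_diff m R)
    qed simp
    finally show ?thesis .
  qed
  have fh: "(\<lambda>x. f m x - h x) \<in> L2" if "m \<ge> N k" for m k
    using nn_lim[OF that] by (auto simp: L2_iff_nn_integral le_less_trans)
  have h: "h \<in> L2"
    using L2_diff[OF f[of "N 0"] fh[of 0 "N 0"]] by simp
  have norm_le: "(l2_norm (\<lambda>x. f m x - h x))\<^sup>2 \<le> (1/8)^k" if "m \<ge> N k" for m k
    using nn_lim[OF that] fh[OF that] by (simp add: nn_integral_L2)
  have "(\<lambda>n. l2_norm (\<lambda>x. f n x - h x)) \<longlonglongrightarrow> 0"
  proof (rule LIMSEQ_I)
    fix e :: real assume "e > 0"
    then obtain k where "(1/8)^k < e\<^sup>2" using real_arch_pow_inv[of "e\<^sup>2" "1/8"] by auto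
    then have "l2_norm (\<lambda>x. f m x - h x) < e" if "m \<ge> N k" for m
      using norm_le[OF that] \<open>e > 0\<close> by (intro power2_less_imp_less[of _ e]) auto
    then show "\<exists>no. \<forall>n\<ge>no. norm (l2_norm (\<lambda>x. f n x - h x) - 0) < e" by auto
  qed
  with h show ?thesis by blast
qed


section \<open>The Fourier transform of integrable functions\<close>

lemma borel_measurable_cis [measurable (raw)]:
  "f \<in> borel_measurable M \<Longrightarrow> (\<lambda>x. cis (f x)) \<in> borel_measurable M"
  by (rule measurable_compose[OF _ borel_measurable_continuous_onI]) (auto intro!: continuous_intros)

lemma iexp_eq_cis: "iexp x = cis x"
  by (simp add: cis_conv_exp)

lemma norm_integral_le_nn_integral:
  fixes f :: "'a \<Rightarrow> 'b::{banach, second_countable_topology}"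
  shows "ennreal (norm (integral\<^sup>L M f)) \<le> (\<integral>\<^sup>+x. ennreal (norm (f x)) \<partial>M)"
  by (cases "integrable M f") (auto intro: integral_norm_bound_ennreal simp: not_integrable_integral_eq)

lemma integrable_bounded_mult:
  fixes f m :: "real \<Rightarrow> complex"
  assumes "integrable lborel f" and [measurable]: "m \<in> borel_measurable borel" and "\<And>x. cmod (m x) \<le> c"
  shows "integrable lborel (\<lambda>x. m x * f x)"
proof -
  have "integrable lborel (\<lambda>x. c * norm (f x))" using assms(1) by simp
  then show ?thesis
  proof (rule Bochner_Integration.integrable_bound)
    show "(\<lambda>x. m x * f x) \<in> borel_measurable lborel"
      using borel_measurable_integrable[OF assms(1)] by simp
    have "norm (m x * f x) \<le> c * norm (f x)" for x
      unfolding norm_mult by (rule mult_right_mono[OF assms(3)]) simp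
    then show "AE x in lborel. norm (m x * f x) \<le> norm (c * norm (f x))"
      by (intro AE_I2) (metis abs_ge_self order_trans real_norm_def)
  qed
qed

lemma integrable_cis_mult:
  "integrable lborel f \<Longrightarrow> integrable lborel (\<lambda>x. cis (t * x) * f x)"
  by (rule integrable_bounded_mult[where c = 1]) auto

lemma Fubini_bounded_kernel:
  fixes f g :: "real \<Rightarrow> complex" and K :: "real \<Rightarrow> real \<Rightarrow> complex"
  assumes f: "integrable lborel f" and g: "integrable lborel g"
    and K [measurable]: "(\<lambda>(x, y). K x y) \<in> borel_measurable (borel \<Otimes>\<^sub>M borel)"
    and bound: "\<And>x y. cmod (K x y) \<le> c"
  shows "(LINT x|lborel. LINT y|lborel. K x y * f x * g y) = (LINT y|lborel. LINT x|lborel. K x y * f x * g y)"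
proof -
  have [measurable]: "f \<in> borel_measurable borel" "g \<in> borel_measurable borel"
    using borel_measurable_integrable[OF f] borel_measurable_integrable[OF g] by simp_all
  have "integrable (lborel \<Otimes>\<^sub>M lborel) (\<lambda>(x, y). f x * g y)"
  proof (rule lborel_pair.Fubini_integrable)
    show "integrable lborel (\<lambda>x. LINT y|lborel. norm (case (x, y) of (x, y) \<Rightarrow> f x * g y))"
      using f by (simp add: norm_mult)
    show "AE x in lborel. integrable lborel (\<lambda>y. case (x, y) of (x, y) \<Rightarrow> f x * g y)"
      using g by simp
  qed measurable
  then have "integrable (lborel \<Otimes>\<^sub>M lborel) (\<lambda>z. c * norm (case z of (x, y) \<Rightarrow> f x * g y))"
    by simp
  then have "integrable (lborel \<Otimes>\<^sub>M lborel) (\<lambda>(x, y). K x y * f x * g y)"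
  proof (rule Bochner_Integration.integrable_bound)
    have "norm (K x y * f x * g y) \<le> c * norm (f x * g y)" for x y
      using mult_right_mono[OF bound, of "norm (f x * g y)" x y] by (simp add: norm_mult mult.assoc)
    then have "norm (K x y * f x * g y) \<le> norm (c * norm (f x * g y))" for x y
      by (metis abs_ge_self order_trans real_norm_def)
    then show "AE z in lborel \<Otimes>\<^sub>M lborel. norm (case z of (x, y) \<Rightarrow> K x y * f x * g y)
        \<le> norm (c * norm (case z of (x, y) \<Rightarrow> f x * g y))"
      by (intro AE_I2) (auto simp del: norm_mult)
  qed measurable
  from lborel_pair.Fubini_integral[OF this] show ?thesis by simp
qed

definition fourier_L1 :: "(real \<Rightarrow> complex) \<Rightarrow> real \<Rightarrow> complex" where
  "fourier_L1 f w = (LINT x|lborel. cis (- (w * x)) * f x) / sqrt (2 * pi)"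

lemma fourier_L1_measurable [measurable (raw)]:
  assumes [measurable]: "f \<in> borel_measurable borel"
  shows "fourier_L1 f \<in> borel_measurable borel"
  unfolding fourier_L1_def[abs_def] by measurable

lemma fourier_L1_integrable:
  "integrable lborel f \<Longrightarrow> integrable lborel (\<lambda>x. cis (- (w * x)) * f x)"
  using integrable_cis_mult[of f "- w"] by simp

lemma fourier_L1_bound:
  "cmod (fourier_L1 f w) \<le> (LINT x|lborel. cmod (f x)) / sqrt (2 * pi)"
proof -
  have "cmod (LINT x|lborel. cis (- (w * x)) * f x) \<le> (LINT x|lborel. cmod (cis (- (w * x)) * f x))"
    by (rule integral_norm_bound)
  then show ?thesis
    by (simp add: fourier_L1_def norm_divide norm_mult divide_right_mono)
qed

lemma fourier_L1_diff:
  assumes "integrable lborel f" "integrable lborel g"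
  shows "fourier_L1 (\<lambda>x. f x - g x) w = fourier_L1 f w - fourier_L1 g w"
  using fourier_L1_integrable[OF assms(1)] fourier_L1_integrable[OF assms(2)]
  by (simp add: fourier_L1_def right_diff_distrib diff_divide_distrib)

lemma cnj_fourier_L1:
  "cnj (fourier_L1 f w) = (LINT x|lborel. cis (w * x) * cnj (f x)) / sqrt (2 * pi)"
proof -
  have "cnj (LINT x|lborel. cis (- (w * x)) * f x) = (LINT x|lborel. cnj (cis (- (w * x)) * f x))"
    by (rule Bochner_Integration.integral_cnj[symmetric])
  then show ?thesis by (simp add: fourier_L1_def cis_cnj)
qed

lemma fourier_L1_multiplication:
  assumes f: "integrable lborel f" and g: "integrable lborel g"
  shows "(LINT w|lborel. fourier_L1 f w * g w) = (LINT x|lborel. f x * fourier_L1 g x)"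
proof -
  have 1: "fourier_L1 f w * g w = (LINT x|lborel. cis (- (w * x)) * g w * f x) / sqrt (2 * pi)" for w
  proof -
    have "(LINT x|lborel. cis (- (w * x)) * g w * f x) = (LINT x|lborel. (cis (- (w * x)) * f x) * g w)"
      by (simp add: mult_ac)
    then show ?thesis by (simp add: fourier_L1_def)
  qed
  have 2: "f x * fourier_L1 g x = (LINT w|lborel. cis (- (w * x)) * g w * f x) / sqrt (2 * pi)" for x
    by (simp add: fourier_L1_def mult.commute)
  have "(LINT w|lborel. LINT x|lborel. cis (- (w * x)) * g w * f x) = (LINT x|lborel. LINT w|lborel. cis (- (w * x)) * g w * f x)"
    by (rule Fubini_bounded_kernel[OF g f, where c = 1]) simp_all
  then show ?thesis unfolding 1 2 by simp
qed


subsection \<open>Gaussians\<close>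

lemma integrable_gaussian: "integrable lborel (\<lambda>x::real. exp (- (x\<^sup>2) / 2))"
proof -
  have "integrable lborel (\<lambda>x. sqrt (2 * pi) * std_normal_density x)" by simp
  then show ?thesis by (simp add: std_normal_density_def)
qed

lemma integral_cis_gaussian:
  "(LINT x|lborel. cis (t * x) * complex_of_real (exp (- (x\<^sup>2) / 2))) = of_real (sqrt (2 * pi) * exp (- (t\<^sup>2) / 2))"
proof -
  have "complex_of_real (exp (- (t\<^sup>2) / 2)) = char std_normal_distribution t"
    by (simp add: char_std_normal_distribution)
  also have "\<dots> = (LINT x|lborel. std_normal_density x *\<^sub>R cis (t * x))"
    unfolding char_def iexp_eq_cis by (rule integral_density) auto
  also have "\<dots> = (LINT x|lborel. (1 / sqrt (2 * pi)) *\<^sub>R (cis (t * x) * complex_of_real (exp (- (x\<^sup>2) / 2))))"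
    by (rule Bochner_Integration.integral_cong) (auto simp: std_normal_density_def scaleR_conv_of_real)
  also have "\<dots> = (1 / sqrt (2 * pi)) *\<^sub>R (LINT x|lborel. cis (t * x) * complex_of_real (exp (- (x\<^sup>2) / 2)))"
    by (rule integral_scaleR_right)
  finally show ?thesis by (simp add: scaleR_conv_of_real)
qed

lemma integrable_scaled_gaussian:
  assumes "d > 0" shows "integrable lborel (\<lambda>x::real. exp (- ((d * x)\<^sup>2) / 2))"
  using lborel_integrable_real_affine[OF integrable_gaussian, of d 0] assms by simp

lemma integral_cis_scaled_gaussian:
  assumes "d > 0"
  shows "(LINT x|lborel. cis (t * x) * complex_of_real (exp (- ((d * x)\<^sup>2) / 2))) = of_real (2 * pi * normal_density 0 d t)"
proof -
  have "of_real (sqrt (2 * pi) * exp (- ((t / d)\<^sup>2) / 2))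
      = (LINT x|lborel. cis (t / d * x) * complex_of_real (exp (- (x\<^sup>2) / 2)))"
    by (rule integral_cis_gaussian[symmetric])
  also have "\<dots> = \<bar>d\<bar> *\<^sub>R (LINT x|lborel. cis (t / d * (0 + d * x)) * complex_of_real (exp (- ((0 + d * x)\<^sup>2) / 2)))"
    by (rule lborel_integral_real_affine) (use assms in simp)
  also have "\<dots> = of_real d * (LINT x|lborel. cis (t * x) * complex_of_real (exp (- ((d * x)\<^sup>2) / 2)))"
    using assms by (simp add: scaleR_conv_of_real)
  finally have "(LINT x|lborel. cis (t * x) * complex_of_real (exp (- ((d * x)\<^sup>2) / 2)))
      = of_real (sqrt (2 * pi) * exp (- ((t / d)\<^sup>2) / 2) / d)"
    using assms by (simp add: field_simps)
  moreover have "sqrt (2 * pi) * exp (- ((t / d)\<^sup>2) / 2) / d = 2 * pi * normal_density 0 d t"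
  proof -
    have "2 * pi = sqrt (2 * pi) * sqrt (2 * pi)" by simp
    then have "2 * pi * normal_density 0 d t = sqrt (2 * pi) * (sqrt (2 * pi) / sqrt (2 * pi * d\<^sup>2)) * exp (- ((t / d)\<^sup>2) / 2)"
      by (simp add: normal_density_def power_divide mult_ac)
    also have "sqrt (2 * pi) / sqrt (2 * pi * d\<^sup>2) = 1 / d"
      using assms by (simp add: real_sqrt_mult)
    finally show ?thesis by simp
  qed
  ultimately show ?thesis by (simp only:)
qed


subsection \<open>Contraction\<close>

text \<open>
  Damping \<open>|f\<^sup>\<and>|\<^sup>2\<close> by a Gaussian of width \<open>1/d\<close> makes Fubini applicable; the
  frequency integral becomes a Gaussian approximate identity, for which the arithmetic-geometric
  mean inequality \<open>|f x| |f y| \<le> (|f x|\<^sup>2 + |f y|\<^sup>2) / 2\<close> gives the bound \<open>\<parallel>f\<parallel>\<^sup>2\<close>.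
\<close>

lemma fourier_L1_damped_bound:
  assumes f: "integrable lborel f" "f \<in> L2" and d: "d > 0"
  shows "(\<integral>\<^sup>+w. ennreal ((cmod (fourier_L1 f w))\<^sup>2 * exp (- ((d * w)\<^sup>2) / 2)) \<partial>lborel) \<le> ennreal ((l2_norm f)\<^sup>2)"
proof -
  have [measurable]: "f \<in> borel_measurable borel" using f by (simp add: L2_measurable)
  let ?F = "fourier_L1 f"
  define \<phi> where "\<phi> w = complex_of_real (exp (- ((d * w)\<^sup>2) / 2))" for w
  have \<phi>: "integrable lborel \<phi>"
    unfolding \<phi>_def[abs_def] using integrable_scaled_gaussian[OF d] by (rule integrable_of_real)
  have [measurable]: "\<phi> \<in> borel_measurable borel" using borel_measurable_integrable[OF \<phi>] by simp
  define q where "q w = cnj (?F w) * \<phi> w" for w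
  have q: "integrable lborel q"
    unfolding q_def[abs_def]
    by (rule integrable_bounded_mult[OF \<phi>, where c = "(LINT x|lborel. cmod (f x)) / sqrt (2 * pi)"])
      (simp_all add: fourier_L1_bound)
  have Fq: "fourier_L1 q x = (LINT y|lborel. cnj (f y) * of_real (normal_density x d y))" for x
  proof -
    have "fourier_L1 q x = (LINT w|lborel. LINT y|lborel. cis (w * (y - x)) * \<phi> w * cnj (f y)) / (2 * pi)"
    proof -
      have "cis (- (x * w)) * q w = (LINT y|lborel. cis (w * (y - x)) * \<phi> w * cnj (f y)) / sqrt (2 * pi)" for w
      proof -
        have "cis (w * (y - x)) * \<phi> w * cnj (f y) = (cis (- (x * w)) * \<phi> w) * (cis (w * y) * cnj (f y))" for y
          by (simp add: cis_mult algebra_simps)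
        then have "(LINT y|lborel. cis (w * (y - x)) * \<phi> w * cnj (f y))
            = (cis (- (x * w)) * \<phi> w) * (LINT y|lborel. cis (w * y) * cnj (f y))"
          by (simp only: integral_mult_right_zero)
        then show ?thesis by (simp add: q_def cnj_fourier_L1)
      qed
      then have "fourier_L1 q x = (LINT w|lborel. (LINT y|lborel. cis (w * (y - x)) * \<phi> w * cnj (f y)) / sqrt (2 * pi)) / sqrt (2 * pi)"
        by (simp only: fourier_L1_def)
      also have "\<dots> = (LINT w|lborel. LINT y|lborel. cis (w * (y - x)) * \<phi> w * cnj (f y)) / (sqrt (2 * pi) * sqrt (2 * pi))"
        by (simp only: integral_divide_zero divide_divide_eq_left of_real_mult)
      finally show ?thesis by simp
    qed
    also have "(LINT w|lborel. LINT y|lborel. cis (w * (y - x)) * \<phi> w * cnj (f y))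
        = (LINT y|lborel. LINT w|lborel. cis (w * (y - x)) * \<phi> w * cnj (f y))"
      by (rule Fubini_bounded_kernel[OF \<phi>, where c = 1]) (use f in \<open>simp_all\<close>)
    also have "(\<lambda>y. LINT w|lborel. cis (w * (y - x)) * \<phi> w * cnj (f y)) = (\<lambda>y. of_real (2 * pi) * (cnj (f y) * of_real (normal_density x d y)))"
    proof
      fix y
      have "(LINT w|lborel. cis (w * (y - x)) * \<phi> w * cnj (f y)) = (LINT w|lborel. cis ((y - x) * w) * \<phi> w) * cnj (f y)"
        by (simp add: mult.commute)
      also have "\<dots> = of_real (2 * pi * normal_density 0 d (y - x)) * cnj (f y)"
        unfolding \<phi>_def integral_cis_scaled_gaussian[OF d] ..
      also have "\<dots> = of_real (2 * pi) * (cnj (f y) * of_real (normal_density x d y))"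
        by (simp add: normal_density_def)
      finally show "(LINT w|lborel. cis (w * (y - x)) * \<phi> w * cnj (f y)) = of_real (2 * pi) * (cnj (f y) * of_real (normal_density x d y))" .
    qed
    finally show ?thesis by (simp only: integral_mult_right_zero) simp
  qed
  have int: "integrable lborel (\<lambda>w. ?F w * q w)"
    by (rule integrable_bounded_mult[OF q, where c = "(LINT x|lborel. cmod (f x)) / sqrt (2 * pi)"])
      (simp_all add: fourier_L1_bound)
  have Fq_eq: "?F w * q w = of_real ((cmod (?F w))\<^sup>2 * exp (- ((d * w)\<^sup>2) / 2))" for w
    by (simp only: q_def \<phi>_def of_real_mult complex_norm_square mult.assoc)
  have int': "integrable lborel (\<lambda>w. (cmod (?F w))\<^sup>2 * exp (- ((d * w)\<^sup>2) / 2))"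
    using int unfolding Fq_eq by (simp only: complex_of_real_integrable_eq)
  have "(\<integral>\<^sup>+w. ennreal ((cmod (?F w))\<^sup>2 * exp (- ((d * w)\<^sup>2) / 2)) \<partial>lborel)
      = ennreal (LINT w|lborel. (cmod (?F w))\<^sup>2 * exp (- ((d * w)\<^sup>2) / 2))"
    using int' by (rule nn_integral_eq_integral) simp
  also have "\<dots> = ennreal (cmod (LINT w|lborel. ?F w * q w))"
    unfolding Fq_eq integral_complex_of_real norm_of_real
    by (simp add: integral_nonneg_AE)
  also have "(LINT w|lborel. ?F w * q w) = (LINT x|lborel. f x * fourier_L1 q x)"
    by (rule fourier_L1_multiplication[OF f(1) q])
  also have "ennreal (cmod \<dots>) \<le> (\<integral>\<^sup>+x. ennreal (cmod (f x * fourier_L1 q x)) \<partial>lborel)"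
    by (rule norm_integral_le_nn_integral)
  also have "\<dots> \<le> (\<integral>\<^sup>+x. \<integral>\<^sup>+y. ennreal (cmod (f x) * cmod (f y) * normal_density x d y) \<partial>lborel \<partial>lborel)"
  proof (rule nn_integral_mono)
    fix x
    have "ennreal (cmod (f x * fourier_L1 q x)) = ennreal (cmod (f x)) * ennreal (cmod (fourier_L1 q x))"
      by (simp add: norm_mult ennreal_mult)
    also have "\<dots> \<le> ennreal (cmod (f x)) * (\<integral>\<^sup>+y. ennreal (cmod (cnj (f y) * of_real (normal_density x d y))) \<partial>lborel)"
      unfolding Fq by (intro mult_left_mono norm_integral_le_nn_integral) simp
    also have "\<dots> = (\<integral>\<^sup>+y. ennreal (cmod (f x)) * ennreal (cmod (cnj (f y) * of_real (normal_density x d y))) \<partial>lborel)"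
      by (rule nn_integral_cmult[symmetric]) simp
    also have "\<dots> = (\<integral>\<^sup>+y. ennreal (cmod (f x) * cmod (f y) * normal_density x d y) \<partial>lborel)"
      by (simp add: norm_mult mult.assoc flip: ennreal_mult)
    finally show "ennreal (cmod (f x * fourier_L1 q x)) \<le> (\<integral>\<^sup>+y. ennreal (cmod (f x) * cmod (f y) * normal_density x d y) \<partial>lborel)" .
  qed
  also have "\<dots> \<le> (\<integral>\<^sup>+x. \<integral>\<^sup>+y. (ennreal ((cmod (f x))\<^sup>2 / 2) * ennreal (normal_density x d y)
      + ennreal ((cmod (f y))\<^sup>2 / 2) * ennreal (normal_density y d x)) \<partial>lborel \<partial>lborel)"
  proof (intro nn_integral_mono)
    fix x y
    have sym: "normal_density y d x = normal_density x d y"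
      by (simp add: normal_density_def power2_commute)
    have "cmod (f x) * cmod (f y) \<le> (cmod (f x))\<^sup>2 / 2 + (cmod (f y))\<^sup>2 / 2"
      using sum_squares_bound[of "cmod (f x)" "cmod (f y)"] by simp
    then have "cmod (f x) * cmod (f y) * normal_density x d y \<le>
        ((cmod (f x))\<^sup>2 / 2 + (cmod (f y))\<^sup>2 / 2) * normal_density x d y"
      by (rule mult_right_mono) simp
    then have "ennreal (cmod (f x) * cmod (f y) * normal_density x d y) \<le>
        ennreal ((cmod (f x))\<^sup>2 / 2 * normal_density x d y + (cmod (f y))\<^sup>2 / 2 * normal_density x d y)"
      by (intro ennreal_leI) (simp add: distrib_right)
    then show "ennreal (cmod (f x) * cmod (f y) * normal_density x d y) \<le>
        ennreal ((cmod (f x))\<^sup>2 / 2) * ennreal (normal_density x d y)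
      + ennreal ((cmod (f y))\<^sup>2 / 2) * ennreal (normal_density y d x)"
      unfolding sym by (subst (asm) ennreal_plus, simp, simp, subst (asm) (2 3) ennreal_mult) simp_all
  qed
  also have "\<dots> = (\<integral>\<^sup>+x. \<integral>\<^sup>+y. ennreal ((cmod (f x))\<^sup>2 / 2) * ennreal (normal_density x d y) \<partial>lborel \<partial>lborel)
      + (\<integral>\<^sup>+x. \<integral>\<^sup>+y. ennreal ((cmod (f y))\<^sup>2 / 2) * ennreal (normal_density y d x) \<partial>lborel \<partial>lborel)"
    unfolding normal_density_def by (simp add: nn_integral_add)
  also have "(\<integral>\<^sup>+x. \<integral>\<^sup>+y. ennreal ((cmod (f y))\<^sup>2 / 2) * ennreal (normal_density y d x) \<partial>lborel \<partial>lborel)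
      = (\<integral>\<^sup>+x. \<integral>\<^sup>+y. ennreal ((cmod (f x))\<^sup>2 / 2) * ennreal (normal_density x d y) \<partial>lborel \<partial>lborel)"
    unfolding normal_density_def by (rule lborel_pair.Fubini') measurable
  also have "(\<integral>\<^sup>+x. \<integral>\<^sup>+y. ennreal ((cmod (f x))\<^sup>2 / 2) * ennreal (normal_density x d y) \<partial>lborel \<partial>lborel)
      = (\<integral>\<^sup>+x. ennreal ((cmod (f x))\<^sup>2 / 2) \<partial>lborel)"
  proof (rule nn_integral_cong)
    fix x
    have "(\<integral>\<^sup>+y. ennreal (normal_density x d y) \<partial>lborel) = 1"
      using nn_integral_eq_integral[OF integrable_normal_density[OF d]] integral_normal_density[OF d]
      by simp
    then show "(\<integral>\<^sup>+y. ennreal ((cmod (f x))\<^sup>2 / 2) * ennreal (normal_density x d y) \<partial>lborel) = ennreal ((cmod (f x))\<^sup>2 / 2)"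
      by (simp add: nn_integral_cmult)
  qed
  also have "(\<integral>\<^sup>+x. ennreal ((cmod (f x))\<^sup>2 / 2) \<partial>lborel) = ennreal ((l2_norm f)\<^sup>2 / 2)"
    unfolding l2_norm_power2 using L2_integrable[OF f(2)]
    by (subst nn_integral_eq_integral) auto
  finally show ?thesis by (simp flip: ennreal_plus)
qed

text \<open>As \<open>d \<rightarrow> 0\<close> the damping disappears, and Fatou's lemma keeps the bound.\<close>

lemma fourier_L1_contraction:
  assumes f: "integrable lborel f" "f \<in> L2"
  shows "fourier_L1 f \<in> L2" and "l2_norm (fourier_L1 f) \<le> l2_norm f"
proof -
  have [measurable]: "f \<in> borel_measurable borel" using f by (simp add: L2_measurable)
  let ?\<phi> = "\<lambda>n w. ennreal ((cmod (fourier_L1 f w))\<^sup>2 * exp (- ((1 / real (Suc n) * w)\<^sup>2) / 2))"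
  have "(\<integral>\<^sup>+w. ennreal ((cmod (fourier_L1 f w))\<^sup>2) \<partial>lborel) = (\<integral>\<^sup>+w. liminf (\<lambda>n. ?\<phi> n w) \<partial>lborel)"
  proof (rule nn_integral_cong)
    fix w :: real
    have "(\<lambda>n. 1 / real (Suc n)) \<longlonglongrightarrow> 0"
      using LIMSEQ_inverse_real_of_nat by (simp add: inverse_eq_divide)
    then have "(\<lambda>n. 1 / real (Suc n) * w) \<longlonglongrightarrow> 0 * w"
      by (intro tendsto_mult tendsto_const)
    moreover have "(\<lambda>n. K * exp (- ((v n)\<^sup>2) / 2)) \<longlonglongrightarrow> K * exp (- (a\<^sup>2) / 2)"
      if "v \<longlonglongrightarrow> a" for v :: "nat \<Rightarrow> real" and a K :: real
      using that by (intro tendsto_intros) auto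
    ultimately have "(\<lambda>n. (cmod (fourier_L1 f w))\<^sup>2 * exp (- ((1 / real (Suc n) * w)\<^sup>2) / 2))
        \<longlonglongrightarrow> (cmod (fourier_L1 f w))\<^sup>2 * exp (- ((0 * w)\<^sup>2) / 2)"
      by blast
    then have "(\<lambda>n. ?\<phi> n w) \<longlonglongrightarrow> ennreal ((cmod (fourier_L1 f w))\<^sup>2)"
      by (intro tendsto_ennrealI) simp
    then show "ennreal ((cmod (fourier_L1 f w))\<^sup>2) = liminf (\<lambda>n. ?\<phi> n w)"
      by (rule lim_imp_Liminf[OF sequentially_bot, symmetric])
  qed
  also have "\<dots> \<le> liminf (\<lambda>n. \<integral>\<^sup>+w. ?\<phi> n w \<partial>lborel)"
    by (rule nn_integral_liminf) simp
  also have "\<dots> \<le> ennreal ((l2_norm f)\<^sup>2)"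
    by (intro Liminf_le always_eventually allI fourier_L1_damped_bound f sequentially_bot) simp
  finally have le: "(\<integral>\<^sup>+w. ennreal ((cmod (fourier_L1 f w))\<^sup>2) \<partial>lborel) \<le> ennreal ((l2_norm f)\<^sup>2)" .
  then show L2: "fourier_L1 f \<in> L2"
    by (auto simp: L2_iff_nn_integral le_less_trans)
  from le have "(l2_norm (fourier_L1 f))\<^sup>2 \<le> (l2_norm f)\<^sup>2"
    by (simp add: nn_integral_L2[OF L2])
  then show "l2_norm (fourier_L1 f) \<le> l2_norm f"
    by (rule power2_le_imp_le) simp
qed


subsection \<open>Injectivity\<close>

text \<open>
  The positive and the negative part have equal integrals by the hypothesis at \<open>t = 0\<close>; normalised,
  they are densities of probability measures with the same characteristic function.
\<close>

lemma fourier_uniqueness_real: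
  fixes r :: "real \<Rightarrow> real"
  assumes r: "integrable lborel r"
    and zero: "\<And>t. (LINT x|lborel. cis (t * x) * complex_of_real (r x)) = 0"
  shows "AE x in lborel. r x = 0"
proof -
  have [measurable]: "r \<in> borel_measurable borel" using borel_measurable_integrable[OF r] by simp
  define p where "p x = max (r x) 0" for x
  define n where "n x = max (- r x) 0" for x
  have [measurable]: "p \<in> borel_measurable borel" "n \<in> borel_measurable borel"
    unfolding p_def[abs_def] n_def[abs_def] by measurable
  have p: "integrable lborel p" and n: "integrable lborel n"
    unfolding p_def[abs_def] n_def[abs_def] using r by (auto intro!: integrable_max)
  have nonneg: "0 \<le> p x" "0 \<le> n x" for x by (auto simp: p_def n_def)
  have r_eq: "r x = p x - n x" for x by (simp add: p_def n_def)
  have eq: "(LINT x|lborel. cis (t * x) * complex_of_real (p x)) = (LINT x|lborel. cis (t * x) * complex_of_real (n x))" for t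
  proof -
    have "integrable lborel (\<lambda>x. cis (t * x) * complex_of_real (p x))"
      "integrable lborel (\<lambda>x. cis (t * x) * complex_of_real (n x))"
      using p n by (auto intro!: integrable_cis_mult integrable_of_real)
    then show ?thesis using zero[of t] unfolding r_eq by (simp add: right_diff_distrib)
  qed
  define c where "c = (LINT x|lborel. p x)"
  have "complex_of_real (LINT x|lborel. p x) = complex_of_real (LINT x|lborel. n x)"
    using eq[of 0] by simp
  then have c': "c = (LINT x|lborel. n x)" by (simp add: c_def)
  have "c \<ge> 0" unfolding c_def by (intro integral_nonneg_AE) (simp add: nonneg)
  show ?thesis
  proof (cases "c = 0")
    case True
    then have "AE x in lborel. p x = 0" "AE x in lborel. n x = 0"
      using integral_nonneg_eq_0_iff_AE[OF p] integral_nonneg_eq_0_iff_AE[OF n] nonneg c_def c' by auto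
    then show ?thesis by eventually_elim (simp add: r_eq)
  next
    case False
    with \<open>c \<ge> 0\<close> have "c > 0" by simp
    have distr: "real_distribution (density lborel (\<lambda>x. ennreal (h x / c)))"
      if h: "integrable lborel h" "\<And>x. 0 \<le> h x" "c = (LINT x|lborel. h x)" for h
    proof -
      have [measurable]: "h \<in> borel_measurable borel" using borel_measurable_integrable[OF h(1)] by simp
      have "(\<integral>\<^sup>+x. ennreal (h x / c) \<partial>lborel) = ennreal (LINT x|lborel. h x / c)"
        using h \<open>c > 0\<close> by (intro nn_integral_eq_integral) auto
      also have "(LINT x|lborel. h x / c) = 1"
        using h(3) \<open>c > 0\<close> by simp
      finally have "prob_space (density lborel (\<lambda>x. ennreal (h x / c)))"
        by (intro prob_spaceI) (simp add: emeasure_density)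
      then show ?thesis by (simp add: real_distribution_def real_distribution_axioms_def)
    qed
    have char: "char (density lborel (\<lambda>x. ennreal (h x / c))) t = (LINT x|lborel. cis (t * x) * complex_of_real (h x)) / c"
      if [measurable]: "h \<in> borel_measurable borel" and h: "\<And>x. 0 \<le> h x" for h t
    proof -
      have "char (density lborel (\<lambda>x. ennreal (h x / c))) t = (LINT x|lborel. (h x / c) *\<^sub>R cis (t * x))"
        unfolding char_def iexp_eq_cis using h \<open>c > 0\<close> by (intro integral_density) auto
      also have "\<dots> = (LINT x|lborel. (cis (t * x) * complex_of_real (h x)) / c)"
        by (simp add: scaleR_conv_of_real mult.commute)
      finally show ?thesis by simp
    qed
    have "density lborel (\<lambda>x. ennreal (p x / c)) = density lborel (\<lambda>x. ennreal (n x / c))"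
    proof (rule Levy_uniqueness)
      show "real_distribution (density lborel (\<lambda>x. ennreal (p x / c)))"
        by (rule distr[OF p nonneg(1) c_def])
      show "real_distribution (density lborel (\<lambda>x. ennreal (n x / c)))"
        by (rule distr[OF n nonneg(2) c'])
      show "char (density lborel (\<lambda>x. ennreal (p x / c))) = char (density lborel (\<lambda>x. ennreal (n x / c)))"
        by (rule ext) (simp add: char nonneg eq)
    qed
    then have "AE x in lborel. ennreal (p x / c) = ennreal (n x / c)"
      by (intro sigma_finite_measure.density_unique[OF sigma_finite_lborel]) auto
    then show ?thesis
      by eventually_elim (use nonneg \<open>c > 0\<close> in \<open>auto simp: r_eq\<close>)
  qed
qed

lemma fourier_uniqueness:
  assumes k: "integrable lborel k"
    and zero: "\<And>t. (LINT x|lborel. cis (t * x) * k x) = 0"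
  shows "AE x in lborel. k x = (0 :: complex)"
proof -
  have int: "integrable lborel (\<lambda>x. cis (t * x) * k x)" for t using k by (rule integrable_cis_mult)
  have zero': "(LINT x|lborel. cis (t * x) * cnj (k x)) = 0" for t
  proof -
    have "cnj (LINT x|lborel. cis (- t * x) * k x) = (LINT x|lborel. cnj (cis (- t * x) * k x))"
      by (rule Bochner_Integration.integral_cnj[symmetric])
    then show ?thesis using zero[of "- t"] by (simp add: cis_cnj)
  qed
  have int': "integrable lborel (\<lambda>x. cis (t * x) * cnj (k x))" for t
    using k by (intro integrable_cis_mult) simp
  have "AE x in lborel. Re (k x) = 0"
  proof (rule fourier_uniqueness_real)
    show "integrable lborel (\<lambda>x. Re (k x))" using k by simp
    fix t
    have *: "complex_of_real (Re z) = z / 2 + cnj z / 2" for z by (simp add: complex_eq_iff)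
    have "(LINT x|lborel. cis (t * x) * complex_of_real (Re (k x)))
        = (LINT x|lborel. cis (t * x) * k x / 2 + cis (t * x) * cnj (k x) / 2)"
      unfolding * by (simp add: distrib_left)
    also have "\<dots> = 0" using int int' by (simp add: zero zero')
    finally show "(LINT x|lborel. cis (t * x) * complex_of_real (Re (k x))) = 0" .
  qed
  moreover have "AE x in lborel. Im (k x) = 0"
  proof (rule fourier_uniqueness_real)
    show "integrable lborel (\<lambda>x. Im (k x))" using k by simp
    fix t
    have *: "complex_of_real (Im z) = z / (2 * \<i>) - cnj z / (2 * \<i>)" for z
    proof -
      have "z - cnj z = (2 * \<i>) * of_real (Im z)" by (simp add: complex_eq_iff)
      then have "of_real (Im z) = (z - cnj z) / (2 * \<i>)" by simp
      then show ?thesis by (simp only: diff_divide_distrib)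
    qed
    have "(LINT x|lborel. cis (t * x) * complex_of_real (Im (k x)))
        = (LINT x|lborel. cis (t * x) * k x / (2 * \<i>) - cis (t * x) * cnj (k x) / (2 * \<i>))"
      unfolding * by (simp only: right_diff_distrib times_divide_eq_right)
    also have "\<dots> = 0" using int int' by (simp add: zero zero')
    finally show "(LINT x|lborel. cis (t * x) * complex_of_real (Im (k x))) = 0" .
  qed
  ultimately show ?thesis by eventually_elim (simp add: complex_eq_iff)
qed


section \<open>The Fourier transform on the Hilbert space\<close>

definition truncation :: "nat \<Rightarrow> (real \<Rightarrow> complex) \<Rightarrow> real \<Rightarrow> complex" where
  "truncation n f x = indicator {- real n..real n} x * f x"

lemma truncation_L2: "f \<in> L2 \<Longrightarrow> truncation n f \<in> L2"
  unfolding truncation_def[abs_def] by (rule L2_indicator_mult) auto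

lemma truncation_integrable:
  assumes "f \<in> L2" shows "integrable lborel (truncation n f)"
proof -
  have "(\<lambda>x. indicator {- real n..real n} x) \<in> L2"
    unfolding L2_iff_nn_integral
  proof
    have "(\<integral>\<^sup>+x. ennreal ((cmod (indicator {- real n..real n} x))\<^sup>2) \<partial>lborel) = (\<integral>\<^sup>+x. indicator {- real n..real n} x \<partial>lborel)"
      by (rule nn_integral_cong) (simp add: indicator_def)
    also have "\<dots> < \<infinity>" by simp
    finally show "(\<integral>\<^sup>+x. ennreal ((cmod (indicator {- real n..real n} x))\<^sup>2) \<partial>lborel) < \<infinity>" .
  qed simp
  from L2_mult_integrable[OF this assms] show ?thesis
    unfolding truncation_def[abs_def] .
qed

lemma truncation_tendsto:
  assumes "f \<in> L2" shows "(\<lambda>n. l2_norm (\<lambda>x. truncation n f x - f x)) \<longlonglongrightarrow> 0"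
proof -
  have [measurable]: "f \<in> borel_measurable borel" using assms by (rule L2_measurable)
  have [measurable]: "truncation n f \<in> borel_measurable borel" for n
    unfolding truncation_def[abs_def] by measurable
  have "(\<lambda>n. LINT x|lborel. (cmod (truncation n f x - f x))\<^sup>2) \<longlonglongrightarrow> (LINT x::real|lborel. 0)"
  proof (rule integral_dominated_convergence[where w = "\<lambda>x. (cmod (f x))\<^sup>2"])
    show "integrable lborel (\<lambda>x. (cmod (f x))\<^sup>2)" by (rule L2_integrable[OF assms])
    show "AE x in lborel. (\<lambda>n. (cmod (truncation n f x - f x))\<^sup>2) \<longlonglongrightarrow> 0"
    proof (rule AE_I2)
      fix x :: real
      obtain N where N: "\<bar>x\<bar> \<le> real N" using real_arch_simple by blast
      have "\<forall>\<^sub>F n in sequentially. (cmod (truncation n f x - f x))\<^sup>2 = 0"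
        unfolding eventually_sequentially
      proof (intro exI allI impI)
        fix n assume "N \<le> n"
        with N have "\<bar>x\<bar> \<le> real n" by (meson of_nat_le_iff order_trans)
        then have "x \<in> {- real n..real n}" by auto
        then show "(cmod (truncation n f x - f x))\<^sup>2 = 0" by (simp add: truncation_def)
      qed
      then show "(\<lambda>n. (cmod (truncation n f x - f x))\<^sup>2) \<longlonglongrightarrow> 0" by (rule tendsto_eventually)
    qed
    show "AE x in lborel. norm ((cmod (truncation n f x - f x))\<^sup>2) \<le> (cmod (f x))\<^sup>2" for n
      by (rule AE_I2) (simp add: truncation_def indicator_def)
  qed simp_all
  then have "(\<lambda>n. sqrt (LINT x|lborel. (cmod (truncation n f x - f x))\<^sup>2)) \<longlonglongrightarrow> sqrt 0"
    by (intro tendsto_real_sqrt) simp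
  then show ?thesis by (simp add: l2_norm_def)
qed

text \<open>
  A square-integrable function need not be integrable, but its truncations are; their transforms form
  a Cauchy sequence because the Fourier transform contracts. The limit is only determined up to a
  null set, so a representative is chosen.
\<close>

definition fourier :: "(real \<Rightarrow> complex) \<Rightarrow> real \<Rightarrow> complex" where
  "fourier f = (SOME h. h \<in> L2 \<and>
     (\<lambda>n. l2_norm (\<lambda>w. fourier_L1 (truncation n f) w - h w)) \<longlonglongrightarrow> 0)"

lemma fourier_L1_dist:
  assumes "integrable lborel f" "f \<in> L2" "integrable lborel g" "g \<in> L2"
  shows "l2_norm (\<lambda>w. fourier_L1 f w - fourier_L1 g w) \<le> l2_norm (\<lambda>x. f x - g x)"
proof -
  have "(\<lambda>w. fourier_L1 f w - fourier_L1 g w) = fourier_L1 (\<lambda>x. f x - g x)"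
    using fourier_L1_diff[OF assms(1,3)] by (simp add: fun_eq_iff)
  then show ?thesis
    using fourier_L1_contraction(2)[of "\<lambda>x. f x - g x"] assms by (simp add: L2_diff)
qed

lemma fourier_limit:
  assumes f: "f \<in> L2"
  shows "fourier f \<in> L2"
    and "(\<lambda>n. l2_norm (\<lambda>w. fourier_L1 (truncation n f) w - fourier f w)) \<longlonglongrightarrow> 0"
proof -
  have "\<exists>h\<in>L2. (\<lambda>n. l2_norm (\<lambda>w. fourier_L1 (truncation n f) w - h w)) \<longlonglongrightarrow> 0"
  proof (rule Riesz_Fischer)
    show "fourier_L1 (truncation n f) \<in> L2" for n
      by (intro fourier_L1_contraction truncation_integrable truncation_L2 f)
    fix e :: real assume "e > 0"
    then obtain N where N: "\<forall>n\<ge>N. norm (l2_norm (\<lambda>x. truncation n f x - f x) - 0) < e / 2"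
      using LIMSEQ_D[OF truncation_tendsto[OF f], of "e / 2"] by auto
    have "l2_norm (\<lambda>x. fourier_L1 (truncation m f) x - fourier_L1 (truncation n f) x) < e" if "m \<ge> N" "n \<ge> N" for m n
    proof -
      have "l2_norm (\<lambda>x. fourier_L1 (truncation m f) x - fourier_L1 (truncation n f) x)
          \<le> l2_norm (\<lambda>x. truncation m f x - truncation n f x)"
        by (intro fourier_L1_dist truncation_integrable truncation_L2 f)
      also have "\<dots> \<le> l2_norm (\<lambda>x. truncation m f x - f x) + l2_norm (\<lambda>x. f x - truncation n f x)"
        by (intro l2_dist_triangle truncation_L2 f)
      also have "\<dots> < e / 2 + e / 2"
        using N that l2_norm_minus_commute[of f "truncation n f"] by (intro add_strict_mono) auto
      finally show ?thesis by simp
    qed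
    then show "\<exists>N. \<forall>m\<ge>N. \<forall>n\<ge>N. l2_norm (\<lambda>x. fourier_L1 (truncation m f) x - fourier_L1 (truncation n f) x) < e"
      by blast
  qed
  then have "\<exists>h. h \<in> L2 \<and> (\<lambda>n. l2_norm (\<lambda>w. fourier_L1 (truncation n f) w - h w)) \<longlonglongrightarrow> 0"
    by blast
  from someI_ex[OF this] show "fourier f \<in> L2"
    "(\<lambda>n. l2_norm (\<lambda>w. fourier_L1 (truncation n f) w - fourier f w)) \<longlonglongrightarrow> 0"
    unfolding fourier_def by simp_all
qed

lemma fourier_eq_fourier_L1:
  assumes "integrable lborel f" "f \<in> L2" shows "fourier f \<approx>\<^sub>2 fourier_L1 f"
proof (rule l2_limit_unique)
  show "fourier_L1 (truncation n f) \<in> L2" for n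
    by (intro fourier_L1_contraction truncation_integrable truncation_L2 assms)
  show "(\<lambda>n. l2_norm (\<lambda>x. fourier_L1 (truncation n f) x - fourier_L1 f x)) \<longlonglongrightarrow> 0"
  proof (rule tendsto_sandwich[OF _ _ tendsto_const truncation_tendsto[OF assms(2)]])
    show "\<forall>\<^sub>F n in sequentially. l2_norm (\<lambda>x. fourier_L1 (truncation n f) x - fourier_L1 f x)
        \<le> l2_norm (\<lambda>x. truncation n f x - f x)"
      by (intro always_eventually allI fourier_L1_dist truncation_integrable truncation_L2 assms)
  qed simp
qed (intro fourier_limit fourier_L1_contraction assms)+

text \<open>
  The kernel \<open>e\<^bsup>-iwx\<^esup>\<close> is symmetric in \<open>w\<close> and \<open>x\<close>, so the adjoint differs from the transform only by
  complex conjugation of argument and value.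
\<close>

definition fourier_adj :: "(real \<Rightarrow> complex) \<Rightarrow> real \<Rightarrow> complex" where
  "fourier_adj f = (\<lambda>x. cnj (fourier (\<lambda>w. cnj (f w)) x))"

lemma fourier_adj_L2: "f \<in> L2 \<Longrightarrow> fourier_adj f \<in> L2"
  unfolding fourier_adj_def by (intro L2_cnj fourier_limit)

text \<open>The multiplication formula for integrable functions passes to the limit of the truncations.\<close>

lemma fourier_adjoint:
  assumes f: "f \<in> L2" and g: "g \<in> L2"
  shows "l2_inner (fourier f) g = l2_inner f (fourier_adj g)"
proof -
  let ?g = "\<lambda>x. cnj (g x)"
  have g': "?g \<in> L2" using g by (rule L2_cnj)
  have norm_cnj: "l2_norm (\<lambda>x. cnj (a x) - cnj (b x)) = l2_norm (\<lambda>x. a x - b x)" for a b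
    using l2_norm_cnj[of "\<lambda>x. a x - b x"] by simp
  have "(\<lambda>n. l2_inner (fourier_L1 (truncation n f)) (\<lambda>x. cnj (truncation n ?g x))) \<longlonglongrightarrow> l2_inner (fourier f) g"
  proof (rule l2_inner_tendsto)
    show "(\<lambda>n. l2_norm (\<lambda>x. cnj (truncation n ?g x) - g x)) \<longlonglongrightarrow> 0"
      using truncation_tendsto[OF g'] norm_cnj[of "truncation n ?g" ?g for n] by simp
  qed (intro fourier_limit L2_cnj truncation_L2 g g' f fourier_L1_contraction truncation_integrable)+
  moreover have "(\<lambda>n. l2_inner (truncation n f) (\<lambda>x. cnj (fourier_L1 (truncation n ?g) x))) \<longlonglongrightarrow> l2_inner f (fourier_adj g)"
  proof (rule l2_inner_tendsto)
    show "(\<lambda>n. l2_norm (\<lambda>x. cnj (fourier_L1 (truncation n ?g) x) - fourier_adj g x)) \<longlonglongrightarrow> 0"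
      unfolding fourier_adj_def using fourier_limit(2)[OF g'] norm_cnj[of "fourier_L1 (truncation n ?g)" "fourier ?g" for n] by simp
  qed (intro fourier_adj_L2 truncation_tendsto L2_cnj truncation_L2 g g' f fourier_L1_contraction truncation_integrable)+
  moreover have "l2_inner (fourier_L1 (truncation n f)) (\<lambda>x. cnj (truncation n ?g x))
      = l2_inner (truncation n f) (\<lambda>x. cnj (fourier_L1 (truncation n ?g) x))" for n
    unfolding l2_inner_def using fourier_L1_multiplication[OF truncation_integrable[OF f] truncation_integrable[OF g'], of n n]
    by simp
  ultimately show ?thesis by (simp add: LIMSEQ_unique)
qed

lemma fourier_adj_adjoint:
  assumes "f \<in> L2" "g \<in> L2"
  shows "l2_inner (fourier_adj f) g = l2_inner f (fourier g)"
  using fourier_adjoint[OF assms(2,1)] by (metis l2_inner_commute)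

lemma fourier_cong:
  assumes "f \<in> L2" "g \<in> L2" "f \<approx>\<^sub>2 g" shows "fourier f \<approx>\<^sub>2 fourier g"
proof (rule l2_eq_by_testing)
  fix u assume u: "u \<in> L2"
  then show "l2_inner (fourier f) u = l2_inner (fourier g) u"
    using assms by (simp add: fourier_adjoint l2_inner_cong[OF assms(3) _ assms(1,2)] fourier_adj_L2)
qed (intro fourier_limit assms)+


subsection \<open>Unitarity\<close>

text \<open>
  Modulated Gaussians serve as test functions: their transforms are shifted Gaussians, whose inverse
  transforms are again explicit, and orthogonality to all of them means that the Fourier transform of
  \<open>f(x) e\<^bsup>-x\<^sup>2/2\<^esup>\<close> vanishes identically.
\<close>

definition wave_packet :: "real \<Rightarrow> real \<Rightarrow> complex" where
  "wave_packet \<xi> x = cis (\<xi> * x) * complex_of_real (exp (- (x\<^sup>2) / 2))"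

lemma gaussian_L2: "(\<lambda>x. complex_of_real (exp (- ((x - a)\<^sup>2) / 2))) \<in> L2"
  and gaussian_integrable: "integrable lborel (\<lambda>x. complex_of_real (exp (- ((x - a)\<^sup>2) / 2)))"
proof -
  have "integrable lborel (\<lambda>x. exp (- ((x - a)\<^sup>2) / 2))"
    using lborel_integrable_real_affine[OF integrable_gaussian, of 1 "- a"] by simp
  then show int: "integrable lborel (\<lambda>x. complex_of_real (exp (- ((x - a)\<^sup>2) / 2)))"
    by (rule integrable_of_real)
  have "integrable lborel (\<lambda>x. exp (- ((x - a)\<^sup>2)))"
    using lborel_integrable_real_affine[OF integrable_scaled_gaussian[of "sqrt 2"], of 1 "- a"]
    by (simp add: power_mult_distrib)
  moreover have "(exp (- ((x - a)\<^sup>2) / 2))\<^sup>2 = exp (- ((x - a)\<^sup>2))" for x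
    by (simp flip: exp_double)
  ultimately show "(\<lambda>x. complex_of_real (exp (- ((x - a)\<^sup>2) / 2))) \<in> L2"
    by (simp add: L2_def)
qed

lemma wave_packet_L2: "wave_packet \<xi> \<in> L2"
  unfolding wave_packet_def[abs_def] using gaussian_L2[of 0]
  by (intro L2_bounded_mult[where c = 1]) simp_all

lemma wave_packet_integrable: "integrable lborel (wave_packet \<xi>)"
  unfolding wave_packet_def[abs_def] using gaussian_integrable[of 0]
  by (intro integrable_cis_mult) simp

lemma fourier_wave_packet:
  "fourier (wave_packet \<xi>) \<approx>\<^sub>2 (\<lambda>w. complex_of_real (exp (- ((w - \<xi>)\<^sup>2) / 2)))"
proof -
  have "fourier_L1 (wave_packet \<xi>) w = complex_of_real (exp (- ((w - \<xi>)\<^sup>2) / 2))" for w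
  proof -
    have "cis (- (w * x)) * wave_packet \<xi> x = cis ((\<xi> - w) * x) * complex_of_real (exp (- (x\<^sup>2) / 2))" for x
      by (simp add: wave_packet_def cis_mult algebra_simps flip: mult.assoc)
    then show ?thesis
      unfolding fourier_L1_def using integral_cis_gaussian[of "\<xi> - w"]
      by (simp add: power2_commute)
  qed
  then show ?thesis
    using fourier_eq_fourier_L1[OF wave_packet_integrable wave_packet_L2, of \<xi>] by simp
qed

lemma fourier_adj_gaussian:
  "fourier_adj (\<lambda>w. complex_of_real (exp (- ((w - \<xi>)\<^sup>2) / 2))) \<approx>\<^sub>2 wave_packet \<xi>"
proof -
  let ?h = "\<lambda>w. complex_of_real (exp (- ((w - \<xi>)\<^sup>2) / 2))"
  have "fourier_L1 ?h x = cnj (wave_packet \<xi> x)" for x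
  proof -
    have "(LINT w|lborel. cis (- (x * w)) * ?h w) = \<bar>1\<bar> *\<^sub>R (LINT w|lborel. cis (- (x * (\<xi> + 1 * w))) * ?h (\<xi> + 1 * w))"
      by (rule lborel_integral_real_affine) simp
    also have "\<dots> = (LINT w|lborel. cis (- (x * \<xi>)) * (cis (- x * w) * complex_of_real (exp (- (w\<^sup>2) / 2))))"
      by (simp add: cis_mult algebra_simps flip: mult.assoc)
    also have "\<dots> = cis (- (x * \<xi>)) * of_real (sqrt (2 * pi) * exp (- ((- x)\<^sup>2) / 2))"
      by (simp only: integral_mult_right_zero integral_cis_gaussian)
    finally show ?thesis by (simp add: fourier_L1_def wave_packet_def cis_cnj mult.commute)
  qed
  then have "fourier ?h \<approx>\<^sub>2 (\<lambda>x. cnj (wave_packet \<xi> x))"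
    using fourier_eq_fourier_L1[OF gaussian_integrable gaussian_L2, of \<xi>] by simp
  then have "AE x in lborel. cnj (fourier ?h x) = wave_packet \<xi> x"
    by eventually_elim simp
  then show ?thesis by (simp add: fourier_adj_def)
qed

text \<open>
  By adjointness it suffices that \<open>F\<^sup>* F\<close> fixes every wave packet, as the wave packets are total.
\<close>

lemma fourier_adj_fourier:
  assumes f: "f \<in> L2" shows "fourier_adj (fourier f) \<approx>\<^sub>2 f"
proof -
  define d where "d x = fourier_adj (fourier f) x - f x" for x
  have Ff: "fourier f \<in> L2" and FFf: "fourier_adj (fourier f) \<in> L2"
    by (intro fourier_limit fourier_adj_L2 f)+
  have d: "d \<in> L2" unfolding d_def[abs_def] by (intro L2_diff FFf f)
  have "l2_inner (fourier_adj (fourier f)) (wave_packet \<xi>) = l2_inner f (wave_packet \<xi>)" for \<xi>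
  proof -
    let ?h = "\<lambda>w. complex_of_real (exp (- ((w - \<xi>)\<^sup>2) / 2))"
    have "l2_inner (fourier_adj (fourier f)) (wave_packet \<xi>) = l2_inner (fourier f) (fourier (wave_packet \<xi>))"
      by (rule fourier_adj_adjoint[OF Ff wave_packet_L2])
    also have "\<dots> = l2_inner (fourier f) ?h"
      by (rule l2_inner_cong[OF _ fourier_wave_packet]) (intro AE_I2 refl Ff fourier_limit wave_packet_L2 gaussian_L2)+
    also have "\<dots> = l2_inner f (fourier_adj ?h)"
      by (rule fourier_adjoint[OF f gaussian_L2])
    also have "\<dots> = l2_inner f (wave_packet \<xi>)"
      by (rule l2_inner_cong[OF _ fourier_adj_gaussian]) (intro AE_I2 refl f fourier_adj_L2 wave_packet_L2 gaussian_L2)+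
    finally show ?thesis .
  qed
  then have orth: "l2_inner d (wave_packet \<xi>) = 0" for \<xi>
    unfolding d_def using FFf f wave_packet_L2 by (simp add: l2_inner_diff_left)
  have "AE x in lborel. d x * complex_of_real (exp (- (x\<^sup>2) / 2)) = 0"
  proof (rule fourier_uniqueness)
    show "integrable lborel (\<lambda>x. d x * complex_of_real (exp (- (x\<^sup>2) / 2)))"
      using L2_mult_integrable[OF d gaussian_L2[of 0]] by simp
    fix t
    show "(LINT x|lborel. cis (t * x) * (d x * complex_of_real (exp (- (x\<^sup>2) / 2)))) = 0"
      using orth[of "- t"] by (simp add: l2_inner_def wave_packet_def cis_cnj mult_ac)
  qed
  then show ?thesis by eventually_elim (simp add: d_def)
qed

lemma fourier_fourier_adj:
  assumes f: "f \<in> L2" shows "fourier (fourier_adj f) \<approx>\<^sub>2 f"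
proof -
  have "AE x in lborel. cnj (fourier (fourier_adj f) x) = cnj (f x)"
    using fourier_adj_fourier[OF L2_cnj[OF f]] by (simp add: fourier_adj_def)
  then show ?thesis by simp
qed

text \<open>
  The kernel of a convolution with Fourier multiplier \<open>m\<close> is, as a function of its second argument, the
  Fourier transform of \<open>w \<mapsto> m w e\<^bsup>iwx\<^esup>\<close>. Integrating it against \<open>f\<close> is therefore, by Parseval, the
  integral of \<open>m w e\<^bsup>iwx\<^esup>\<close> against the Fourier transform of \<open>f\<close>; integrability of the kernel is not an issue.
\<close>

theorem convolution_eq_multiplier:
  fixes m :: "real \<Rightarrow> real" and \<kappa> :: "real \<Rightarrow> real \<Rightarrow> complex"
  assumes [measurable]: "m \<in> borel_measurable borel" and int: "integrable lborel m"
    and bound: "\<And>w. \<bar>m w\<bar> \<le> c"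
    and \<kappa>: "\<And>x y. \<kappa> x y = (LINT w|lborel. cis (w * (x - y)) * complex_of_real (m w)) / (2 * pi)"
    and f: "f \<in> L2"
  shows "(\<lambda>x. LINT y|lborel. \<kappa> x y * f y) \<in> L2"
    and "(\<lambda>x. LINT y|lborel. \<kappa> x y * f y) \<approx>\<^sub>2 fourier_adj (\<lambda>w. complex_of_real (m w) * fourier f w)"
proof -
  have "c \<ge> 0" using bound[of 0] by linarith
  have m_int: "integrable lborel (\<lambda>w. complex_of_real (m w))" using int by (rule integrable_of_real)
  have "integrable lborel (\<lambda>w. c * \<bar>m w\<bar>)" using int by simp
  then have "integrable lborel (\<lambda>w. (m w)\<^sup>2)"
  proof (rule Bochner_Integration.integrable_bound)
    have "(m w)\<^sup>2 \<le> c * \<bar>m w\<bar>" for w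
      using mult_right_mono[OF bound[of w], of "\<bar>m w\<bar>"] by (simp add: power2_eq_square)
    then show "AE w in lborel. norm ((m w)\<^sup>2) \<le> norm (c * \<bar>m w\<bar>)"
      by (intro AE_I2) (metis abs_ge_self abs_of_nonneg order_trans real_norm_def zero_le_power2)
  qed simp
  then have m_L2: "(\<lambda>w. complex_of_real (m w)) \<in> L2" by (simp add: L2_def)
  have Ff: "fourier f \<in> L2" by (rule fourier_limit[OF f])
  let ?q = "\<lambda>w. complex_of_real (m w) * fourier f w"
  have q_L2: "?q \<in> L2"
    by (rule L2_bounded_mult[OF Ff, where c = c]) (simp_all add: bound)
  have q_int: "integrable lborel ?q" by (rule L2_mult_integrable[OF m_L2 Ff])
  have pointwise: "(LINT y|lborel. \<kappa> x y * f y) = cnj (fourier_L1 (\<lambda>w. cnj (?q w)) x)" for x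
  proof -
    let ?p = "\<lambda>w. cis (x * w) * complex_of_real (m w)"
    have p_L2: "?p \<in> L2" by (rule L2_bounded_mult[OF m_L2, where c = 1]) simp_all
    have p_int: "integrable lborel ?p" by (rule integrable_cis_mult[OF m_int])
    have Fp: "fourier_L1 ?p y = of_real (sqrt (2 * pi)) * \<kappa> x y" for y
    proof -
      have "cis (- (y * w)) * ?p w = cis (w * (x - y)) * complex_of_real (m w)" for w
        by (simp add: cis_mult algebra_simps flip: mult.assoc)
      then have "fourier_L1 ?p y = (LINT w|lborel. cis (w * (x - y)) * complex_of_real (m w)) / sqrt (2 * pi)"
        by (simp only: fourier_L1_def)
      also have "\<dots> = (2 * pi) * \<kappa> x y / sqrt (2 * pi)"
        by (simp add: \<kappa>)
      also have "\<dots> = (of_real (sqrt (2 * pi)) * of_real (sqrt (2 * pi))) * \<kappa> x y / of_real (sqrt (2 * pi))"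
        by (simp flip: of_real_mult)
      finally show ?thesis by simp
    qed
    have "(LINT y|lborel. \<kappa> x y * f y) = l2_inner f (\<lambda>y. cnj (fourier_L1 ?p y)) / sqrt (2 * pi)"
      unfolding l2_inner_def complex_cnj_cnj Fp mult.left_commute[of "f _"] by (simp add: mult.commute)
    also have "l2_inner f (\<lambda>y. cnj (fourier_L1 ?p y)) = l2_inner f (fourier_adj (\<lambda>w. cnj (?p w)))"
    proof (rule l2_inner_cong)
      show "(\<lambda>y. cnj (fourier_L1 ?p y)) \<approx>\<^sub>2 fourier_adj (\<lambda>w. cnj (?p w))"
        unfolding fourier_adj_def complex_cnj_cnj using fourier_eq_fourier_L1[OF p_int p_L2]
        by eventually_elim simp
    qed (intro AE_I2 refl f L2_cnj fourier_L1_contraction p_int p_L2 fourier_adj_L2)+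
    also have "\<dots> = l2_inner (fourier f) (\<lambda>w. cnj (?p w))"
      by (rule fourier_adjoint[symmetric, OF f L2_cnj[OF p_L2]])
    also have "l2_inner (fourier f) (\<lambda>w. cnj (?p w)) / sqrt (2 * pi) = cnj (fourier_L1 (\<lambda>w. cnj (?q w)) x)"
      unfolding cnj_fourier_L1 by (simp add: l2_inner_def mult_ac)
    finally show ?thesis .
  qed
  have q_int': "integrable lborel (\<lambda>w. cnj (?q w))" using q_int by (simp only: integrable_cnj)
  show "(\<lambda>x. LINT y|lborel. \<kappa> x y * f y) \<in> L2"
    unfolding pointwise by (intro L2_cnj fourier_L1_contraction q_int' q_L2)
  have "fourier (\<lambda>w. cnj (?q w)) \<approx>\<^sub>2 fourier_L1 (\<lambda>w. cnj (?q w))"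
    by (rule fourier_eq_fourier_L1[OF q_int' L2_cnj[OF q_L2]])
  then show "(\<lambda>x. LINT y|lborel. \<kappa> x y * f y) \<approx>\<^sub>2 fourier_adj (\<lambda>w. complex_of_real (m w) * fourier f w)"
    unfolding pointwise fourier_adj_def by eventually_elim simp
qed


section \<open>Operators that are unitarily equivalent to multiplications\<close>

locale unitary_pair =
  fixes U V :: "(real \<Rightarrow> complex) \<Rightarrow> real \<Rightarrow> complex"
  assumes U_L2: "f \<in> L2 \<Longrightarrow> U f \<in> L2"
    and V_L2: "f \<in> L2 \<Longrightarrow> V f \<in> L2"
    and U_adjoint: "f \<in> L2 \<Longrightarrow> g \<in> L2 \<Longrightarrow> l2_inner (U f) g = l2_inner f (V g)"
    and UV: "f \<in> L2 \<Longrightarrow> U (V f) \<approx>\<^sub>2 f"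
    and VU: "f \<in> L2 \<Longrightarrow> V (U f) \<approx>\<^sub>2 f"
begin

lemma V_adjoint: "f \<in> L2 \<Longrightarrow> g \<in> L2 \<Longrightarrow> l2_inner (V f) g = l2_inner f (U g)"
  using U_adjoint[of g f] by (metis l2_inner_commute)

lemma V_cong:
  assumes "f \<in> L2" "g \<in> L2" "f \<approx>\<^sub>2 g" shows "V f \<approx>\<^sub>2 V g"
proof (rule l2_eq_by_testing)
  fix u assume "u \<in> L2"
  then show "l2_inner (V f) u = l2_inner (V g) u"
    using assms by (simp add: V_adjoint U_L2 l2_inner_cong[OF assms(3) _ assms(1,2)])
qed (intro V_L2 assms)+

lemma V_inner: "f \<in> L2 \<Longrightarrow> g \<in> L2 \<Longrightarrow> l2_inner (V f) (V g) = l2_inner f g"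
  using l2_inner_cong[OF _ UV[of g], of f f] by (simp add: V_adjoint V_L2 U_L2)

lemma V_norm: assumes "f \<in> L2" shows "l2_norm (V f) = l2_norm f"
proof -
  have "(l2_norm (V f))\<^sup>2 = (l2_norm f)\<^sup>2"
    using V_inner[OF assms assms] unfolding l2_inner_self of_real_eq_iff .
  then show ?thesis by (simp add: power2_eq_iff_nonneg)
qed

lemma V_linear:
  assumes f: "f \<in> L2" and g: "g \<in> L2"
  shows "V (\<lambda>x. f x + c * g x) \<approx>\<^sub>2 (\<lambda>x. V f x + c * V g x)"
proof (rule l2_eq_by_testing)
  have fg: "(\<lambda>x. f x + c * g x) \<in> L2" by (intro L2_add L2_cmult f g)
  then show "V (\<lambda>x. f x + c * g x) \<in> L2" by (rule V_L2)
  show "(\<lambda>x. V f x + c * V g x) \<in> L2" by (intro L2_add L2_cmult V_L2 f g)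
  fix u assume u: "u \<in> L2"
  have "l2_inner (V (\<lambda>x. f x + c * g x)) u = l2_inner f (U u) + c * l2_inner g (U u)"
    using f g u fg by (simp add: V_adjoint l2_inner_add_left L2_cmult U_L2 l2_inner_cmult_left)
  also have "\<dots> = l2_inner (\<lambda>x. V f x + c * V g x) u"
    using f g u by (simp add: V_adjoint V_L2 l2_inner_add_left L2_cmult l2_inner_cmult_left)
  finally show "l2_inner (V (\<lambda>x. f x + c * g x)) u = l2_inner (\<lambda>x. V f x + c * V g x) u" .
qed

lemma V_injective:
  assumes f: "f \<in> L2" and 0: "V f \<approx>\<^sub>2 (\<lambda>x. 0)" shows "f \<approx>\<^sub>2 (\<lambda>x. 0)"
  using V_norm[OF f] 0 f V_L2[OF f] by (simp flip: l2_norm_eq_0_iff)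

lemma V_injective':
  assumes f: "f \<in> L2" and g: "g \<in> L2" and eq: "V f \<approx>\<^sub>2 V g" shows "f \<approx>\<^sub>2 g"
proof -
  have "V (\<lambda>x. f x + (-1) * g x) \<approx>\<^sub>2 (\<lambda>x. 0)"
    using V_linear[OF f g, of "-1"] eq by eventually_elim simp
  moreover have "(\<lambda>x. f x + (-1) * g x) \<in> L2" by (intro L2_add L2_cmult f g)
  ultimately have "(\<lambda>x. f x + (-1) * g x) \<approx>\<^sub>2 (\<lambda>x. 0)" by (rule V_injective[rotated])
  then show ?thesis by eventually_elim simp
qed

end

locale multiplication_operator = unitary_pair +
  fixes w :: "real \<Rightarrow> real"
  assumes w_measurable [measurable]: "w \<in> borel_measurable borel"
begin

definition graph :: "((real \<Rightarrow> complex) \<times> (real \<Rightarrow> complex)) set" where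
  "graph = {(g, h). g \<in> L2 \<and> h \<in> L2 \<and> V h \<approx>\<^sub>2 (\<lambda>x. complex_of_real (w x) * V g x)}"

lemma graphD:
  assumes "(g, h) \<in> graph"
  shows "g \<in> L2" "h \<in> L2" "V h \<approx>\<^sub>2 (\<lambda>x. complex_of_real (w x) * V g x)"
  using assms by (auto simp: graph_def)

lemma graph_mult_L2:
  assumes "(g, h) \<in> graph" shows "(\<lambda>x. complex_of_real (w x) * V g x) \<in> L2"
proof (rule L2_AE_cong[OF V_L2 graphD(3)[OF assms]])
  show "h \<in> L2" using assms by (rule graphD)
  have [measurable]: "V g \<in> borel_measurable borel"
    by (intro L2_measurable V_L2 graphD(1)[OF assms])
  show "(\<lambda>x. complex_of_real (w x) * V g x) \<in> borel_measurable borel" by measurable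
qed

lemma graphI:
  assumes "g \<in> L2" "(\<lambda>x. complex_of_real (w x) * V g x) \<in> L2"
  shows "(g, U (\<lambda>x. complex_of_real (w x) * V g x)) \<in> graph"
  using assms by (simp add: graph_def U_L2 VU)

lemma Domain_graph_iff:
  assumes "g \<in> L2"
  shows "g \<in> Domain graph \<longleftrightarrow> (\<lambda>x. complex_of_real (w x) * V g x) \<in> L2"
  using graphI[OF assms] graph_mult_L2 by blast

lemma graph_linear:
  assumes "(f, h) \<in> graph" "(g, k) \<in> graph"
  shows "((\<lambda>x. f x + c * g x), (\<lambda>x. h x + c * k x)) \<in> graph"
proof -
  note f = graphD[OF assms(1)] and g = graphD[OF assms(2)]
  have "V (\<lambda>x. h x + c * k x) \<approx>\<^sub>2 (\<lambda>x. complex_of_real (w x) * V (\<lambda>x. f x + c * g x) x)"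
    using V_linear[OF f(1) g(1), of c] V_linear[OF f(2) g(2), of c] f(3) g(3)
    by eventually_elim (simp add: algebra_simps)
  then show ?thesis using f g by (simp add: graph_def L2_add L2_cmult)
qed

lemma graph_symmetric:
  assumes "(f, h) \<in> graph" "(g, k) \<in> graph"
  shows "l2_inner h g = l2_inner f k"
proof -
  note f = graphD[OF assms(1)] and g = graphD[OF assms(2)]
  have "l2_inner h g = l2_inner (\<lambda>x. complex_of_real (w x) * V f x) (V g)"
    using l2_inner_cong[OF f(3), of "V g" "V g"] f g graph_mult_L2[OF assms(1)]
    by (simp add: V_L2 V_inner)
  also have "\<dots> = l2_inner (V f) (\<lambda>x. complex_of_real (w x) * V g x)"
    by (simp add: l2_inner_def mult_ac)
  also have "\<dots> = l2_inner f k"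
    using l2_inner_cong[OF _ g(3), of "V f" "V f"] f g graph_mult_L2[OF assms(2)]
    by (simp add: V_L2 V_inner)
  finally show ?thesis .
qed

lemma graph_quadratic:
  assumes "(g, h) \<in> graph"
  shows "integrable lborel (\<lambda>x. w x * (cmod (V g x))\<^sup>2)"
    and "l2_inner h g = of_real (LINT x|lborel. w x * (cmod (V g x))\<^sup>2)"
proof -
  note g = graphD[OF assms] and wg = graph_mult_L2[OF assms]
  have eq: "complex_of_real (w x) * V g x * cnj (V g x) = of_real (w x * (cmod (V g x))\<^sup>2)" for x
    by (simp only: of_real_mult complex_norm_square mult.assoc)
  have "integrable lborel (\<lambda>x. complex_of_real (w x * (cmod (V g x))\<^sup>2))"
    using L2_inner_integrable[OF wg V_L2[OF g(1)]] unfolding eq .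
  then show "integrable lborel (\<lambda>x. w x * (cmod (V g x))\<^sup>2)"
    by (simp only: complex_of_real_integrable_eq)
  have "l2_inner h g = l2_inner (\<lambda>x. complex_of_real (w x) * V g x) (V g)"
    using l2_inner_cong[OF g(3), of "V g" "V g"] g wg by (simp add: V_L2 V_inner)
  then show "l2_inner h g = of_real (LINT x|lborel. w x * (cmod (V g x))\<^sup>2)"
    unfolding l2_inner_def eq by (simp only: integral_complex_of_real)
qed

text \<open>
  The domain is dense: it contains the image of the bounded positive operator \<open>(1 + w\<^sup>2)\<^sup>-\<^sup>1\<close>, which is
  injective.
\<close>

lemma orthogonal_Domain_eq_0:
  assumes x: "x \<in> L2" and orth: "\<And>g. g \<in> Domain graph \<Longrightarrow> l2_inner x g = 0"
  shows "x \<approx>\<^sub>2 (\<lambda>y. 0)"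
proof -
  let ?r = "\<lambda>y. complex_of_real (1 / (1 + (w y)\<^sup>2))"
  have r_pos: "0 < 1 + (w y)\<^sup>2" for y using zero_le_power2[of "w y"] by linarith
  have rx: "(\<lambda>y. ?r y * V x y) \<in> L2"
    using r_pos by (intro L2_bounded_mult[where c = 1] V_L2 x)
      (simp_all add: norm_divide field_simps del: of_real_divide of_real_add)
  let ?g = "U (\<lambda>y. ?r y * V x y)"
  have Vg: "V ?g \<approx>\<^sub>2 (\<lambda>y. ?r y * V x y)" by (rule VU[OF rx])
  have "(\<lambda>y. complex_of_real (w y / (1 + (w y)\<^sup>2)) * V x y) \<in> L2"
  proof (rule L2_bounded_mult[where c = 1])
    fix y
    have "\<bar>w y\<bar> \<le> 1 + (w y)\<^sup>2"
      using zero_le_power2[of "\<bar>w y\<bar> - 1"] zero_le_power2[of "w y"] by (simp add: power2_diff)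
    then show "cmod (complex_of_real (w y / (1 + (w y)\<^sup>2))) \<le> 1"
      unfolding norm_of_real using r_pos[of y] by (simp add: abs_divide)
  qed (use x in \<open>simp_all add: V_L2\<close>)
  moreover have "(\<lambda>y. complex_of_real (w y / (1 + (w y)\<^sup>2)) * V x y) \<approx>\<^sub>2 (\<lambda>y. complex_of_real (w y) * V ?g y)"
    using Vg by eventually_elim (simp add: field_simps)
  moreover have "(\<lambda>y. complex_of_real (w y) * V ?g y) \<in> borel_measurable borel"
    using L2_measurable[OF V_L2[OF U_L2[OF rx]]] by measurable
  ultimately have "(\<lambda>y. complex_of_real (w y) * V ?g y) \<in> L2" by (rule L2_AE_cong)
  then have "?g \<in> Domain graph" by (subst Domain_graph_iff[OF U_L2[OF rx]])
  then have "l2_inner x ?g = 0" by (rule orth)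
  also have "l2_inner x ?g = l2_inner (V x) (\<lambda>y. ?r y * V x y)"
    by (rule V_adjoint[symmetric]) (intro x rx)+
  finally have "(LINT y|lborel. V x y * cnj (?r y * V x y)) = 0" by (simp only: l2_inner_def)
  moreover have eq: "V x y * cnj (?r y * V x y) = of_real (1 / (1 + (w y)\<^sup>2) * (cmod (V x y))\<^sup>2)" for y
    unfolding of_real_mult complex_norm_square by simp
  ultimately have "(LINT y|lborel. 1 / (1 + (w y)\<^sup>2) * (cmod (V x y))\<^sup>2) = 0"
    by (simp only: integral_complex_of_real of_real_eq_0_iff)
  moreover have "integrable lborel (\<lambda>y. 1 / (1 + (w y)\<^sup>2) * (cmod (V x y))\<^sup>2)"
    using L2_inner_integrable[OF V_L2[OF x] rx] unfolding eq by (simp only: complex_of_real_integrable_eq)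
  ultimately have "AE y in lborel. 1 / (1 + (w y)\<^sup>2) * (cmod (V x y))\<^sup>2 = 0"
    using r_pos by (subst (asm) integral_nonneg_eq_0_iff_AE) (simp_all add: less_imp_le)
  then have "V x \<approx>\<^sub>2 (\<lambda>y. 0)"
  proof eventually_elim
    case (elim y)
    then show ?case using r_pos[of y] by simp
  qed
  then show ?thesis by (rule V_injective[OF x])
qed


subsection \<open>The spectral measure of a multiplication operator\<close>

definition multiplier_projection :: "real set \<Rightarrow> (real \<Rightarrow> complex) \<Rightarrow> real \<Rightarrow> complex" where
  "multiplier_projection S f = U (\<lambda>x. indicator (w -` S) x * V f x)"

definition spectral_density :: "(real \<Rightarrow> complex) \<Rightarrow> real measure" where
  "spectral_density g = distr (density lborel (\<lambda>x. ennreal ((cmod (V g x))\<^sup>2))) borel w"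

lemma vimage_w [measurable]: "S \<in> sets borel \<Longrightarrow> w -` S \<in> sets borel"
  using measurable_sets[OF w_measurable] by simp

lemma restriction_L2:
  "f \<in> L2 \<Longrightarrow> S \<in> sets borel \<Longrightarrow> (\<lambda>x. indicator (w -` S) x * V f x) \<in> L2"
  by (intro L2_indicator_mult V_L2 vimage_w)

lemma multiplier_projection_inner:
  assumes "f \<in> L2" "g \<in> L2" "S \<in> sets borel"
  shows "l2_inner (multiplier_projection S f) g = (LINT x|lborel. indicator (w -` S) x * (V f x * cnj (V g x)))"
  unfolding multiplier_projection_def U_adjoint[OF restriction_L2[OF assms(1,3)] assms(2)]
  by (simp add: l2_inner_def mult.assoc)

lemma multiplier_projection_inner_right:
  assumes "f \<in> L2" "g \<in> L2" "S \<in> sets borel"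
  shows "l2_inner f (multiplier_projection S g) = (LINT x|lborel. indicator (w -` S) x * (V f x * cnj (V g x)))"
  unfolding multiplier_projection_def V_adjoint[OF assms(1) restriction_L2[OF assms(2,3)], symmetric]
  unfolding l2_inner_def by (rule Bochner_Integration.integral_cong) (auto simp: indicator_def)

lemma multiplier_projection_sums:
  assumes A: "range A \<subseteq> sets borel" "disjoint_family A" and f: "f \<in> L2" and g: "g \<in> L2"
  shows "(\<lambda>n::nat. l2_inner (multiplier_projection (A n) f) g) sums l2_inner (multiplier_projection (\<Union>n. A n) f) g"
proof -
  let ?\<phi> = "\<lambda>x. V f x * cnj (V g x)"
  have A' [measurable]: "A n \<in> sets borel" for n using A by auto
  have \<phi>: "integrable lborel ?\<phi>" by (intro L2_inner_integrable V_L2 f g)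
  have [measurable]: "?\<phi> \<in> borel_measurable borel" using borel_measurable_integrable[OF \<phi>] by simp
  have ind_sums: "(\<lambda>n. indicator (w -` A n) x :: real) sums indicator (w -` (\<Union>n. A n)) x" for x
    unfolding vimage_UN using A(2)
    by (intro indicator_sums) (auto simp: disjoint_family_on_def)
  have le: "(\<Sum>i<n. indicator (w -` A i) x :: real) \<le> 1" for n x
  proof -
    have "(\<Sum>i<n. indicator (w -` A i) x :: real) \<le> (\<Sum>i. indicator (w -` A i) x)"
      by (intro sum_le_suminf sums_summable[OF ind_sums]) auto
    also have "\<dots> = indicator (w -` (\<Union>n. A n)) x" by (rule sums_unique[OF ind_sums, symmetric])
    also have "\<dots> \<le> 1" by (simp add: indicator_def)
    finally show ?thesis .
  qed
  have "(\<lambda>n. LINT x|lborel. (\<Sum>i<n. indicator (w -` A i) x) *\<^sub>R ?\<phi> x) \<longlonglongrightarrow> (LINT x|lborel. indicator (w -` (\<Union>n. A n)) x *\<^sub>R ?\<phi> x)"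
  proof (rule integral_dominated_convergence[where w = "\<lambda>x. cmod (?\<phi> x)"])
    show "integrable lborel (\<lambda>x. cmod (?\<phi> x))" using \<phi> by (rule integrable_norm)
    show "AE x in lborel. (\<lambda>n. (\<Sum>i<n. indicator (w -` A i) x) *\<^sub>R ?\<phi> x) \<longlonglongrightarrow> indicator (w -` (\<Union>n. A n)) x *\<^sub>R ?\<phi> x"
      using ind_sums unfolding sums_def by (intro AE_I2 tendsto_scaleR tendsto_const) auto
    show "AE x in lborel. norm ((\<Sum>i<n. indicator (w -` A i) x) *\<^sub>R ?\<phi> x) \<le> cmod (?\<phi> x)" for n
    proof (rule AE_I2)
      fix x
      have "norm ((\<Sum>i<n. indicator (w -` A i) x) *\<^sub>R ?\<phi> x) = (\<Sum>i<n. indicator (w -` A i) x) * cmod (?\<phi> x)"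
        unfolding norm_scaleR by (simp add: sum_nonneg)
      also have "\<dots> \<le> 1 * cmod (?\<phi> x)" by (intro mult_right_mono le) simp
      finally show "norm ((\<Sum>i<n. indicator (w -` A i) x) *\<^sub>R ?\<phi> x) \<le> cmod (?\<phi> x)" by simp
    qed
  qed measurable
  moreover have "(LINT x|lborel. (\<Sum>i<n. indicator (w -` A i) x) *\<^sub>R ?\<phi> x)
      = (\<Sum>i<n. l2_inner (multiplier_projection (A i) f) g)" for n
  proof -
    have "(LINT x|lborel. (\<Sum>i<n. indicator (w -` A i) x) *\<^sub>R ?\<phi> x)
        = (\<Sum>i<n. LINT x|lborel. indicator (w -` A i) x *\<^sub>R ?\<phi> x)"
      unfolding scaleR_sum_left
      by (rule Bochner_Integration.integral_sum) (intro integrable_mult_indicator \<phi>, simp)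
    also have "\<dots> = (\<Sum>i<n. l2_inner (multiplier_projection (A i) f) g)"
      using f g by (intro sum.cong refl) (simp add: multiplier_projection_inner scaleR_conv_of_real of_real_indicator)
    finally show ?thesis .
  qed
  moreover have "(LINT x|lborel. indicator (w -` (\<Union>n. A n)) x *\<^sub>R ?\<phi> x) = l2_inner (multiplier_projection (\<Union>n. A n) f) g"
    using f g by (simp add: multiplier_projection_inner scaleR_conv_of_real of_real_indicator)
  ultimately show ?thesis by (simp add: sums_def)
qed

lemma projection_valued_multiplier_projection: "projection_valued_measure multiplier_projection"
  unfolding projection_valued_measure_def
proof (intro conjI ballI allI impI)
  fix S f assume "S \<in> sets (borel :: real measure)" "f \<in> L2"
  then show "multiplier_projection S f \<in> L2"
    by (simp add: multiplier_projection_def U_L2 restriction_L2)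
next
  fix S f g assume "S \<in> sets (borel :: real measure)" "f \<in> L2" "g \<in> L2"
  then show "l2_inner (multiplier_projection S f) g = l2_inner f (multiplier_projection S g)"
    by (simp add: multiplier_projection_inner multiplier_projection_inner_right)
next
  fix S S' f assume S: "S \<in> sets (borel :: real measure)" "S' \<in> sets (borel :: real measure)" and f: "f \<in> L2"
  have Pf: "multiplier_projection S' f \<in> L2"
    using S f by (simp add: multiplier_projection_def U_L2 restriction_L2)
  show "multiplier_projection S (multiplier_projection S' f) \<approx>\<^sub>2 multiplier_projection (S \<inter> S') f"
  proof (rule V_injective')
    have "V (multiplier_projection S (multiplier_projection S' f))
        \<approx>\<^sub>2 (\<lambda>x. indicator (w -` S) x * V (multiplier_projection S' f) x)"
      unfolding multiplier_projection_def[of S] by (intro VU restriction_L2 Pf S)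
    moreover have "V (multiplier_projection S' f) \<approx>\<^sub>2 (\<lambda>x. indicator (w -` S') x * V f x)"
      unfolding multiplier_projection_def by (intro VU restriction_L2 f S)
    moreover have "V (multiplier_projection (S \<inter> S') f) \<approx>\<^sub>2 (\<lambda>x. indicator (w -` (S \<inter> S')) x * V f x)"
      unfolding multiplier_projection_def by (intro VU restriction_L2 f sets.Int S)
    ultimately show "V (multiplier_projection S (multiplier_projection S' f)) \<approx>\<^sub>2 V (multiplier_projection (S \<inter> S') f)"
      by eventually_elim (simp add: indicator_def)
    show "multiplier_projection S (multiplier_projection S' f) \<in> L2" "multiplier_projection (S \<inter> S') f \<in> L2"
      unfolding multiplier_projection_def[of S "multiplier_projection S' f"] multiplier_projection_def[of "S \<inter> S'"]
      by (intro U_L2 restriction_L2 Pf f sets.Int S)+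
  qed
next
  fix f assume "f \<in> L2"
  then show "multiplier_projection UNIV f \<approx>\<^sub>2 f"
    using UV by (simp add: multiplier_projection_def)
next
  fix A :: "nat \<Rightarrow> real set" and f g assume "range A \<subseteq> sets borel" "disjoint_family A" "f \<in> L2" "g \<in> L2"
  then show "(\<lambda>n. l2_inner (multiplier_projection (A n) f) g) sums l2_inner (multiplier_projection (\<Union>n. A n) f) g"
    by (rule multiplier_projection_sums)
qed

lemma emeasure_spectral_density:
  assumes g: "g \<in> L2" and S: "S \<in> sets borel"
  shows "emeasure (spectral_density g) S = (\<integral>\<^sup>+x. ennreal (indicator (w -` S) x * (cmod (V g x))\<^sup>2) \<partial>lborel)"
proof -
  have [measurable]: "V g \<in> borel_measurable borel" by (intro L2_measurable V_L2 g)
  have "emeasure (spectral_density g) S = (\<integral>\<^sup>+x. ennreal ((cmod (V g x))\<^sup>2) * indicator (w -` S) x \<partial>lborel)"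
    unfolding spectral_density_def using S by (simp add: emeasure_distr emeasure_density)
  also have "\<dots> = (\<integral>\<^sup>+x. ennreal (indicator (w -` S) x * (cmod (V g x))\<^sup>2) \<partial>lborel)"
    by (rule nn_integral_cong) (simp add: indicator_def)
  finally show ?thesis .
qed

lemma nn_integral_spectral_density:
  assumes g: "g \<in> L2" and [measurable]: "\<phi> \<in> borel_measurable borel"
  shows "(\<integral>\<^sup>+s. \<phi> s \<partial>spectral_density g) = (\<integral>\<^sup>+x. ennreal ((cmod (V g x))\<^sup>2) * \<phi> (w x) \<partial>lborel)"
proof -
  have [measurable]: "V g \<in> borel_measurable borel" by (intro L2_measurable V_L2 g)
  show ?thesis unfolding spectral_density_def by (simp add: nn_integral_distr nn_integral_density)
qed

lemma vector_measure_multiplier_projection: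
  assumes g: "g \<in> L2"
  shows "vector_measure multiplier_projection g = spectral_density g"
proof -
  have eq: "ennreal (Re (l2_inner (multiplier_projection S g) g)) = emeasure (spectral_density g) S"
    if S: "S \<in> sets borel" for S
  proof -
    have Vg: "V g \<in> L2" by (rule V_L2[OF g])
    have L2: "(\<lambda>x. indicator (w -` S) x * V g x) \<in> L2" by (rule restriction_L2[OF g S])
    note multiplier_projection_inner[OF g g S]
    also have "(LINT x|lborel. indicator (w -` S) x * (V g x * cnj (V g x)))
        = l2_inner (\<lambda>x. indicator (w -` S) x * V g x) (\<lambda>x. indicator (w -` S) x * V g x)"
      unfolding l2_inner_def by (rule Bochner_Integration.integral_cong) (auto simp: indicator_def)
    finally have "ennreal (Re (l2_inner (multiplier_projection S g) g)) = ennreal ((l2_norm (\<lambda>x. indicator (w -` S) x * V g x))\<^sup>2)"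
      by (simp only: l2_inner_self Re_complex_of_real)
    also have "\<dots> = (\<integral>\<^sup>+x. ennreal ((cmod (indicator (w -` S) x * V g x))\<^sup>2) \<partial>lborel)"
      by (rule nn_integral_L2[OF L2, symmetric])
    also have "\<dots> = emeasure (spectral_density g) S"
      unfolding emeasure_spectral_density[OF g S] by (rule nn_integral_cong) (simp add: indicator_def)
    finally show ?thesis .
  qed
  have "vector_measure multiplier_projection g = measure_of UNIV (sets borel) (emeasure (spectral_density g))"
    unfolding vector_measure_def
    by (rule measure_of_eq) (auto simp: eq sets.sigma_sets_eq[of borel, simplified])
  also have "\<dots> = spectral_density g"
    using measure_of_of_measure[of "spectral_density g"] by (simp add: spectral_density_def)
  finally show ?thesis .
qed

theorem is_spectral_measure_multiplier_projection: "is_spectral_measure graph multiplier_projection"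
  unfolding is_spectral_measure_def
proof (intro conjI ballI projection_valued_multiplier_projection)
  fix g assume g: "g \<in> L2"
  have [measurable]: "V g \<in> borel_measurable borel" by (intro L2_measurable V_L2 g)
  have "(\<integral>\<^sup>+s. ennreal (s\<^sup>2) \<partial>vector_measure multiplier_projection g)
      = (\<integral>\<^sup>+x. ennreal ((cmod (complex_of_real (w x) * V g x))\<^sup>2) \<partial>lborel)"
    unfolding vector_measure_multiplier_projection[OF g]
    by (subst nn_integral_spectral_density[OF g])
      (auto intro!: nn_integral_cong simp: norm_mult power_mult_distrib mult.commute simp flip: ennreal_mult)
  then show "g \<in> Domain graph \<longleftrightarrow> (\<integral>\<^sup>+s. ennreal (s\<^sup>2) \<partial>vector_measure multiplier_projection g) < \<infinity>"
    by (simp add: Domain_graph_iff[OF g] L2_iff_nn_integral)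
next
  fix p assume "p \<in> graph"
  then obtain g h where p: "p = (g, h)" and gh: "(g, h) \<in> graph" by (cases p) auto
  have g: "g \<in> L2" by (rule graphD[OF gh])
  have [measurable]: "V g \<in> borel_measurable borel" by (intro L2_measurable V_L2 g)
  have "(LINT s|spectral_density g. s) = (LINT x|density lborel (\<lambda>x. ennreal ((cmod (V g x))\<^sup>2)). w x)"
    unfolding spectral_density_def by (rule integral_distr) measurable
  also have "\<dots> = (LINT x|lborel. (cmod (V g x))\<^sup>2 * w x)"
    by (subst integral_real_density) auto
  finally show "case p of (g, h) \<Rightarrow> l2_inner h g = complex_of_real (LINT s|vector_measure multiplier_projection g. s)"
    unfolding p using graph_quadratic(2)[OF gh] by (simp add: vector_measure_multiplier_projection[OF g] mult.commute)
qed

end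


section \<open>Uniqueness of the spectral measure\<close>

locale pvm =
  fixes E :: "real set \<Rightarrow> (real \<Rightarrow> complex) \<Rightarrow> real \<Rightarrow> complex"
  assumes E: "projection_valued_measure E"
begin

lemma E_L2: "S \<in> sets borel \<Longrightarrow> f \<in> L2 \<Longrightarrow> E S f \<in> L2"
  and E_symmetric: "S \<in> sets borel \<Longrightarrow> f \<in> L2 \<Longrightarrow> g \<in> L2 \<Longrightarrow> l2_inner (E S f) g = l2_inner f (E S g)"
  and E_mult: "S \<in> sets borel \<Longrightarrow> S' \<in> sets borel \<Longrightarrow> f \<in> L2 \<Longrightarrow> E S (E S' f) \<approx>\<^sub>2 E (S \<inter> S') f"
  and E_UNIV: "f \<in> L2 \<Longrightarrow> E UNIV f \<approx>\<^sub>2 f"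
  and E_sums: "range A \<subseteq> sets borel \<Longrightarrow> disjoint_family A \<Longrightarrow> f \<in> L2 \<Longrightarrow> g \<in> L2 \<Longrightarrow>
      (\<lambda>n::nat. l2_inner (E (A n) f) g) sums l2_inner (E (\<Union>n. A n) f) g"
  using E by (auto simp: projection_valued_measure_def)

lemma E_empty: assumes "f \<in> L2" "g \<in> L2" shows "l2_inner (E {} f) g = 0"
proof -
  have "(\<lambda>n::nat. l2_inner (E {} f) g) sums l2_inner (E (\<Union>n::nat. {}) f) g"
    using assms by (intro E_sums) (auto simp: disjoint_family_on_def)
  then have "(\<lambda>n::nat. l2_inner (E {} f) g) \<longlonglongrightarrow> 0"
    by (intro summable_LIMSEQ_zero sums_summable)
  then show ?thesis by (simp add: LIMSEQ_const_iff)
qed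

lemma E_inner_Int:
  assumes "S \<in> sets borel" "S' \<in> sets borel" "f \<in> L2" "g \<in> L2"
  shows "l2_inner (E S f) (E S' g) = l2_inner (E (S \<inter> S') f) g"
proof -
  have "l2_inner (E S f) (E S' g) = l2_inner (E S' (E S f)) g"
    using assms by (simp add: E_symmetric E_L2)
  also have "\<dots> = l2_inner (E (S' \<inter> S) f) g"
    by (rule l2_inner_cong) (use assms in \<open>auto intro: E_mult E_L2\<close>)
  finally show ?thesis by (simp add: Int_commute)
qed

lemma E_inner_self:
  assumes "S \<in> sets borel" "f \<in> L2"
  shows "l2_inner (E S f) f = of_real ((l2_norm (E S f))\<^sup>2)"
  using E_inner_Int[OF assms(1,1) assms(2,2)] by (simp add: l2_inner_self)

lemma sets_vector_measure [simp, measurable_cong]: "sets (vector_measure E g) = sets borel"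
  and space_vector_measure [simp]: "space (vector_measure E g) = UNIV"
  by (simp_all add: vector_measure_def sets_measure_of_conv space_measure_of_conv
      sets.sigma_sets_eq[of borel, simplified])

lemma emeasure_vector_measure:
  assumes g: "g \<in> L2" and S: "S \<in> sets borel"
  shows "emeasure (vector_measure E g) S = ennreal ((l2_norm (E S g))\<^sup>2)"
proof -
  have sa: "sigma_algebra UNIV (sets (borel :: real measure))"
    using sets.sigma_algebra_axioms[of "borel :: real measure"] by simp
  have pos: "positive (sets borel) (\<lambda>S. ennreal (Re (l2_inner (E S g) g)))"
    using E_empty[OF g g] by (simp add: positive_def)
  have add: "countably_additive (sets borel) (\<lambda>S. ennreal (Re (l2_inner (E S g) g)))"
  proof (rule countably_additiveI)
    fix A :: "nat \<Rightarrow> real set"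
    assume A: "range A \<subseteq> sets borel" "disjoint_family A" "\<Union> (range A) \<in> sets borel"
    have sums: "(\<lambda>n. Re (l2_inner (E (A n) g) g)) sums Re (l2_inner (E (\<Union>n. A n) g) g)"
      by (intro sums_Re E_sums A g)
    have nonneg: "0 \<le> Re (l2_inner (E (A n) g) g)" for n
      using E_inner_self[of "A n" g] A g by auto
    show "(\<Sum>n. ennreal (Re (l2_inner (E (A n) g) g))) = ennreal (Re (l2_inner (E (\<Union> (range A)) g) g))"
      by (rule suminf_ennreal_eq[OF nonneg sums])
  qed
  have "emeasure (vector_measure E g) S = ennreal (Re (l2_inner (E S g) g))"
    unfolding vector_measure_def by (rule emeasure_measure_of_sigma[OF sa pos add S])
  then show ?thesis using E_inner_self[OF S g] by simp
qed

lemma vector_measure_UNIV: "g \<in> L2 \<Longrightarrow> emeasure (vector_measure E g) UNIV = ennreal ((l2_norm g)\<^sup>2)"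
  using l2_norm_cong[OF E_UNIV] by (simp add: emeasure_vector_measure E_L2)

lemma finite_vector_measure: "g \<in> L2 \<Longrightarrow> finite_measure (vector_measure E g)"
  by (rule finite_measureI) (simp add: vector_measure_UNIV)

text \<open>The range of the projection \<open>E S\<close>, described by testing so that it is visibly a subspace.\<close>

definition range_of :: "real set \<Rightarrow> (real \<Rightarrow> complex) set" where
  "range_of S = {f \<in> L2. \<forall>u\<in>L2. l2_inner f (E S u) = l2_inner f u}"

lemma range_of_L2: "f \<in> range_of S \<Longrightarrow> f \<in> L2"
  by (simp add: range_of_def)

lemma range_of_inner: "f \<in> range_of S \<Longrightarrow> u \<in> L2 \<Longrightarrow> l2_inner f (E S u) = l2_inner f u"
  by (simp add: range_of_def)

lemma range_of_linear:
  assumes "f \<in> range_of S" "g \<in> range_of S" "S \<in> sets borel"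
  shows "(\<lambda>x. f x + c * g x) \<in> range_of S"
  using assms unfolding range_of_def
  by (simp add: L2_add L2_cmult l2_inner_add_left l2_inner_cmult_left E_L2)

lemma range_of_cong:
  assumes "f \<in> range_of S" "f \<approx>\<^sub>2 g" "g \<in> L2" "S \<in> sets borel"
  shows "g \<in> range_of S"
  using assms l2_inner_cong[OF assms(2) _ range_of_L2[OF assms(1)] assms(3), of u u for u]
  unfolding range_of_def by (simp add: E_L2)

lemma E_in_range_of: "S \<in> sets borel \<Longrightarrow> f \<in> L2 \<Longrightarrow> E S f \<in> range_of S"
  unfolding range_of_def by (simp add: E_L2 E_inner_Int)

lemma AE_vector_measure_range_of:
  assumes f: "f \<in> range_of S" and S: "S \<in> sets borel"
  shows "AE s in vector_measure E f. s \<in> S"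
proof (rule AE_I')
  have L2: "f \<in> L2" by (rule range_of_L2[OF f])
  have compl: "- S \<in> sets borel" using S by auto
  have "l2_inner f (E (- S) f) = l2_inner f (E S (E (- S) f))"
    using range_of_inner[OF f] L2 compl by (simp add: E_L2)
  also have "\<dots> = l2_inner (E S f) (E (- S) f)"
    by (rule E_symmetric[symmetric, OF S L2 E_L2[OF compl L2]])
  also have "\<dots> = l2_inner (E {} f) f"
    using E_inner_Int[OF S compl L2 L2] by simp
  finally have "l2_inner (E (- S) f) f = 0"
    using E_symmetric[OF compl L2 L2] E_empty[OF L2 L2] by simp
  then have "l2_norm (E (- S) f) = 0" using E_inner_self[OF compl L2] by simp
  then have "emeasure (vector_measure E f) (- S) = 0" by (simp add: emeasure_vector_measure[OF L2 compl])
  then show "- S \<in> null_sets (vector_measure E f)" using compl by (simp add: null_sets_def)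
qed auto

text \<open>
  If \<open>E S f = f\<close> and \<open>E S g = 0\<close>, the cross terms of \<open>(E A (f + c g), f + c g)\<close> vanish, so changing the
  sign of \<open>c\<close> does not change the measure.
\<close>

lemma vector_measure_sign:
  assumes f: "f \<in> range_of S" and g: "g \<in> L2" and 0: "E S g \<approx>\<^sub>2 (\<lambda>x. 0)" and S: "S \<in> sets borel"
  shows "vector_measure E (\<lambda>x. f x + c * g x) = vector_measure E (\<lambda>x. f x + (- c) * g x)"
proof -
  have f2: "f \<in> L2" by (rule range_of_L2[OF f])
  have cross: "l2_inner (E A f) g = 0" if A: "A \<in> sets borel" for A
  proof -
    have zero: "(\<lambda>x. 0) \<in> L2" by (simp add: L2_def)
    have "l2_inner (E A f) g = l2_inner f (E S (E A g))"
      using A f f2 g by (simp add: E_symmetric range_of_inner E_L2)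
    also have "\<dots> = l2_inner (E S f) (E A g)"
      using A S f2 g by (simp add: E_symmetric E_L2)
    also have "\<dots> = l2_inner (E A f) (E S g)"
      using A S f2 g by (simp add: E_inner_Int Int_commute)
    also have "\<dots> = l2_inner (E A f) (\<lambda>x. 0)"
      by (rule l2_inner_cong[OF _ 0]) (use A S f2 g zero in \<open>auto intro: E_L2\<close>)
    finally show ?thesis by (simp add: l2_inner_def)
  qed
  have expand: "l2_inner (E A (\<lambda>x. f x + c * g x)) (\<lambda>x. f x + c * g x)
      = l2_inner (E A f) f + c * cnj c * l2_inner (E A g) g" if A: "A \<in> sets borel" for A c
  proof -
    let ?y = "\<lambda>x. f x + c * g x"
    have y: "?y \<in> L2" by (intro L2_add L2_cmult f2 g)
    have EAy: "E A ?y \<in> L2" and EAf: "E A f \<in> L2" and EAg: "E A g \<in> L2"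
      by (intro E_L2 A y f2 g)+
    have gf: "l2_inner (E A g) f = 0"
      using cross[OF A] E_symmetric[OF A g f2] l2_inner_commute[of g "E A f"] by simp
    have "l2_inner (E A ?y) ?y = l2_inner (E A ?y) f + cnj c * l2_inner (E A ?y) g"
      using EAy f2 g by (simp add: l2_inner_add_right L2_cmult l2_inner_cmult_right)
    also have "l2_inner (E A ?y) f = l2_inner f (E A f) + c * l2_inner g (E A f)"
      using E_symmetric[OF A y f2] f2 g EAf by (simp add: l2_inner_add_left L2_cmult l2_inner_cmult_left)
    also have "l2_inner (E A ?y) g = l2_inner f (E A g) + c * l2_inner g (E A g)"
      using E_symmetric[OF A y g] f2 g EAg by (simp add: l2_inner_add_left L2_cmult l2_inner_cmult_left)
    finally show ?thesis
      using cross[OF A] gf A f2 g by (simp add: E_symmetric[symmetric] algebra_simps)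
  qed
  show ?thesis unfolding vector_measure_def
  proof (rule measure_of_eq)
    fix A :: "real set" assume "A \<in> sigma_sets UNIV (sets borel)"
    then have "A \<in> sets borel" by (simp add: sets.sigma_sets_eq[of borel, simplified])
    from expand[OF this, of c] expand[OF this, of "- c"]
    show "ennreal (Re (l2_inner (E A (\<lambda>x. f x + c * g x)) (\<lambda>x. f x + c * g x)))
        = ennreal (Re (l2_inner (E A (\<lambda>x. f x + - c * g x)) (\<lambda>x. f x + - c * g x)))"
      by simp
  qed simp
qed

end

locale spectral_multiplication = multiplication_operator + pvm +
  assumes spectral: "is_spectral_measure graph E"
begin

lemma Domain_iff: "g \<in> L2 \<Longrightarrow> g \<in> Domain graph \<longleftrightarrow> (\<integral>\<^sup>+s. ennreal (s\<^sup>2) \<partial>vector_measure E g) < \<infinity>"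
  using spectral by (simp add: is_spectral_measure_def)

lemma quadratic: "(g, h) \<in> graph \<Longrightarrow> l2_inner h g = complex_of_real (LINT s|vector_measure E g. s)"
  using spectral by (auto simp: is_spectral_measure_def)

lemma range_of_Domain:
  assumes f: "f \<in> range_of S" and S: "S \<in> sets borel" and bounded: "S \<subseteq> {a..b}"
  shows "f \<in> Domain graph"
proof -
  have L2: "f \<in> L2" by (rule range_of_L2[OF f])
  let ?B = "(max \<bar>a\<bar> \<bar>b\<bar>)\<^sup>2"
  have "(\<integral>\<^sup>+s. ennreal (s\<^sup>2) \<partial>vector_measure E f) \<le> (\<integral>\<^sup>+s. ennreal ?B \<partial>vector_measure E f)"
  proof (rule nn_integral_mono_AE, use AE_vector_measure_range_of[OF f S] in eventually_elim)
    case (elim s)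
    then have "s \<in> {a..b}" using bounded by auto
    then have "\<bar>s\<bar> \<le> max \<bar>a\<bar> \<bar>b\<bar>" by auto
    then have "\<bar>s\<bar>\<^sup>2 \<le> ?B" by (intro power_mono) auto
    then show ?case by (intro ennreal_leI) simp
  qed
  also have "\<dots> < \<infinity>" using vector_measure_UNIV[OF L2] by (simp add: ennreal_mult_less_top)
  finally show ?thesis by (simp add: Domain_iff[OF L2])
qed

lemma cross_term_eq_0:
  assumes f: "f \<in> range_of S" and fh: "(f, h) \<in> graph" and gk: "(g, k) \<in> graph"
    and 0: "E S g \<approx>\<^sub>2 (\<lambda>x. 0)" and S: "S \<in> sets borel"
  shows "l2_inner h g = 0"
proof -
  note f2 = graphD(1)[OF fh] and h2 = graphD(2)[OF fh] and g2 = graphD(1)[OF gk] and k2 = graphD(2)[OF gk]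
  have expand: "l2_inner (\<lambda>x. h x + c * k x) (\<lambda>x. f x + c * g x)
      = l2_inner h f + cnj c * l2_inner h g + c * l2_inner k f + c * cnj c * l2_inner k g" for c
    using f2 h2 g2 k2
    by (simp add: l2_inner_add_left l2_inner_add_right L2_add L2_cmult l2_inner_cmult_left
        l2_inner_cmult_right algebra_simps)
  have kf: "l2_inner k f = cnj (l2_inner h g)"
    using graph_symmetric[OF gk fh] by (simp add: l2_inner_commute[of g h])
  have eq: "l2_inner (\<lambda>x. h x + c * k x) (\<lambda>x. f x + c * g x)
      = l2_inner (\<lambda>x. h x + (- c) * k x) (\<lambda>x. f x + (- c) * g x)" for c
    unfolding quadratic[OF graph_linear[OF fh gk]] vector_measure_sign[OF f g2 0 S, of c] ..
  have "cnj c * l2_inner h g + c * cnj (l2_inner h g) = 0" for c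
  proof -
    have "2 * (cnj c * l2_inner h g + c * cnj (l2_inner h g)) = 0"
      using eq[of c] unfolding expand kf by (simp add: algebra_simps)
    then show ?thesis by (metis mult_eq_0_iff zero_neq_numeral)
  qed
  from this[of 1] this[of \<i>] show ?thesis by (simp add: complex_eq_iff)
qed

text \<open>The range of \<open>E S\<close> is invariant: the operator maps it to the orthogonal complement of the range of \<open>1 - E S\<close>.\<close>

lemma range_of_invariant:
  assumes f: "f \<in> range_of S" and fh: "(f, h) \<in> graph" and S: "S \<in> sets borel" and bounded: "S \<subseteq> {a..b}"
  shows "h \<in> range_of S"
proof -
  have h2: "h \<in> L2" by (rule graphD[OF fh])
  have Eh: "E S h \<in> L2" by (rule E_L2[OF S h2])
  have "(\<lambda>x. h x + (-1) * E S h x) \<approx>\<^sub>2 (\<lambda>x. 0)"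
  proof (rule orthogonal_Domain_eq_0)
    show "(\<lambda>x. h x + (-1) * E S h x) \<in> L2" by (intro L2_add L2_cmult h2 Eh)
    fix g assume "g \<in> Domain graph"
    then obtain k where gk: "(g, k) \<in> graph" by blast
    have g2: "g \<in> L2" by (rule graphD[OF gk])
    have Eg: "E S g \<in> L2" by (rule E_L2[OF S g2])
    have "E S g \<in> Domain graph"
      by (rule range_of_Domain[OF E_in_range_of[OF S g2] S bounded])
    then obtain k' where gk': "(E S g, k') \<in> graph" by blast
    have E0: "E S (\<lambda>x. g x + (-1) * E S g x) \<approx>\<^sub>2 (\<lambda>x. 0)"
    proof (rule l2_eq_by_testing)
      have y: "(\<lambda>x. g x + (-1) * E S g x) \<in> L2" by (intro L2_add L2_cmult g2 Eg)
      then show "E S (\<lambda>x. g x + (-1) * E S g x) \<in> L2" by (rule E_L2[OF S])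
      fix u assume u: "u \<in> L2"
      have "l2_inner (E S (\<lambda>x. g x + (-1) * E S g x)) u = l2_inner g (E S u) - l2_inner (E S g) (E S u)"
        unfolding E_symmetric[OF S y u] using g2 Eg E_L2[OF S u]
        by (simp add: l2_inner_diff_left)
      also have "\<dots> = 0" using S g2 u by (simp add: E_inner_Int E_symmetric[symmetric])
      finally show "l2_inner (E S (\<lambda>x. g x + (-1) * E S g x)) u = l2_inner (\<lambda>x. 0) u"
        by (simp add: l2_inner_def)
    qed (simp add: L2_def)
    have "l2_inner h (\<lambda>x. g x + (-1) * E S g x) = 0"
      by (rule cross_term_eq_0[OF f fh graph_linear[OF gk gk'] E0 S])
    then have "l2_inner h g = l2_inner h (E S g)"
      using h2 g2 Eg by (simp add: l2_inner_diff_right)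
    also have "\<dots> = l2_inner (E S h) g" using S h2 g2 by (simp add: E_symmetric)
    finally show "l2_inner (\<lambda>x. h x + (-1) * E S h x) g = 0"
      using h2 g2 Eh by (simp add: l2_inner_diff_left)
  qed
  then have "E S h \<approx>\<^sub>2 h" by eventually_elim simp
  then show ?thesis by (rule range_of_cong[OF E_in_range_of[OF S h2] _ h2 S])
qed

lemma range_of_form_bounds:
  assumes f: "f \<in> range_of {a..b}" and fh: "(f, h) \<in> graph"
  shows "a * (l2_norm f)\<^sup>2 \<le> Re (l2_inner h f)" "Re (l2_inner h f) \<le> b * (l2_norm f)\<^sup>2"
proof -
  have f2: "f \<in> L2" by (rule graphD[OF fh])
  let ?\<mu> = "vector_measure E f"
  interpret finite_measure ?\<mu> by (rule finite_vector_measure[OF f2])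
  have AE: "AE s in ?\<mu>. s \<in> {a..b}" by (rule AE_vector_measure_range_of[OF f]) simp
  have int: "integrable ?\<mu> (\<lambda>s. s)"
    by (rule integrable_const_bound[where B = "max \<bar>a\<bar> \<bar>b\<bar>"]) (use AE in \<open>eventually_elim, auto\<close>)
  have mass: "measure ?\<mu> UNIV = (l2_norm f)\<^sup>2"
    using vector_measure_UNIV[OF f2] by (simp add: measure_def)
  have Re: "Re (l2_inner h f) = (LINT s|?\<mu>. s)" using quadratic[OF fh] by simp
  have "(LINT s|?\<mu>. a) \<le> (LINT s|?\<mu>. s)"
    by (rule integral_mono_AE[OF _ int]) (use AE in \<open>simp, eventually_elim, simp\<close>)
  then show "a * (l2_norm f)\<^sup>2 \<le> Re (l2_inner h f)" unfolding Re by (simp add: mass mult.commute)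
  have "(LINT s|?\<mu>. s) \<le> (LINT s|?\<mu>. b)"
    by (rule integral_mono_AE[OF int]) (use AE in \<open>simp, eventually_elim, simp\<close>)
  then show "Re (l2_inner h f) \<le> b * (l2_norm f)\<^sup>2" unfolding Re by (simp add: mass mult.commute)
qed

text \<open>
  Write \<open>v = w - c\<close>. The form bound gives \<open>\<plusminus>(D y, y) \<le> \<delta> \<parallel>y\<parallel>\<^sup>2\<close> for the operator \<open>D\<close> of multiplication by \<open>v\<close>
  on the range. Applied to \<open>y = (\<delta> \<plusminus> D) f\<close> it yields \<open>\<parallel>D f\<parallel> \<le> \<delta> \<parallel>f\<parallel>\<close>, because
  \<open>(\<delta> - v)(\<delta> + v)\<^sup>2 + (\<delta> + v)(\<delta> - v)\<^sup>2 = 2 \<delta> (\<delta>\<^sup>2 - v\<^sup>2)\<close>.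
\<close>

lemma range_of_step:
  assumes f: "f \<in> range_of {c - \<delta>..c + \<delta>}" and \<delta>: "\<delta> > 0"
  defines "p \<equiv> \<lambda>x. complex_of_real (w x - c) * V f x"
  shows "p \<in> L2" "U p \<in> range_of {c - \<delta>..c + \<delta>}" "l2_norm p \<le> \<delta> * l2_norm f"
proof -
  let ?S = "{c - \<delta>..c + \<delta>}"
  have S: "?S \<in> sets borel" by simp
  have *: "\<exists>h. (g, h) \<in> graph \<and> h \<in> range_of ?S" if g: "g \<in> range_of ?S" for g
    using range_of_Domain[OF g S order_refl] range_of_invariant[OF g _ S order_refl] by blast
  define D where "D g = U (\<lambda>x. complex_of_real (w x - c) * V g x)" for g
  have D: "(\<lambda>x. complex_of_real (w x - c) * V g x) \<in> L2" "D g \<in> range_of ?S"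
    "V (D g) \<approx>\<^sub>2 (\<lambda>x. complex_of_real (w x - c) * V g x)" if g: "g \<in> range_of ?S" for g
  proof -
    obtain h where gh: "(g, h) \<in> graph" and h: "h \<in> range_of ?S" using *[OF g] by blast
    note g2 = graphD(1)[OF gh] and h2 = graphD(2)[OF gh]
    have "(\<lambda>x. complex_of_real (w x) * V g x + of_real (- c) * V g x) \<in> L2"
      by (intro L2_add L2_cmult graph_mult_L2[OF gh] V_L2 g2)
    then show L2: "(\<lambda>x. complex_of_real (w x - c) * V g x) \<in> L2"
      by (simp add: left_diff_distrib)
    show VD: "V (D g) \<approx>\<^sub>2 (\<lambda>x. complex_of_real (w x - c) * V g x)"
      unfolding D_def by (rule VU[OF L2])
    have Dg2: "D g \<in> L2" unfolding D_def by (rule U_L2[OF L2])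
    have hg: "(\<lambda>x. h x + of_real (- c) * g x) \<in> range_of ?S" by (rule range_of_linear[OF h g S])
    have "V (\<lambda>x. h x + of_real (- c) * g x) \<approx>\<^sub>2 V (D g)"
      using V_linear[OF h2 g2, of "of_real (- c)"] graphD(3)[OF gh] VD
      by eventually_elim (simp add: left_diff_distrib)
    then have "(\<lambda>x. h x + of_real (- c) * g x) \<approx>\<^sub>2 D g"
      by (rule V_injective'[OF range_of_L2[OF hg] Dg2])
    then show "D g \<in> range_of ?S"
      by (rule range_of_cong[OF hg _ Dg2 S])
  qed
  have form: "integrable lborel (\<lambda>x. (\<delta> + s * (w x - c)) * (cmod (V y x))\<^sup>2)"
    "0 \<le> (LINT x|lborel. (\<delta> + s * (w x - c)) * (cmod (V y x))\<^sup>2)"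
    if y: "y \<in> range_of ?S" and s: "s = 1 \<or> s = -1" for y s
  proof -
    obtain h where yh: "(y, h) \<in> graph" using *[OF y] by blast
    have y2: "y \<in> L2" by (rule graphD[OF yh])
    have i: "integrable lborel (\<lambda>x. (cmod (V y x))\<^sup>2)" by (intro L2_integrable V_L2 y2)
    note q = graph_quadratic[OF yh]
    have eq: "(\<delta> + s * (w x - c)) * (cmod (V y x))\<^sup>2 = (\<delta> - s * c) * (cmod (V y x))\<^sup>2 + s * (w x * (cmod (V y x))\<^sup>2)" for x
      by (simp add: algebra_simps)
    show "integrable lborel (\<lambda>x. (\<delta> + s * (w x - c)) * (cmod (V y x))\<^sup>2)"
      unfolding eq using i q(1) by (intro Bochner_Integration.integrable_add) auto
    have "(LINT x|lborel. (cmod (V y x))\<^sup>2) = (l2_norm y)\<^sup>2"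
      using V_norm[OF y2] by (simp add: l2_norm_power2[symmetric])
    then have "(LINT x|lborel. (\<delta> + s * (w x - c)) * (cmod (V y x))\<^sup>2) = (\<delta> - s * c) * (l2_norm y)\<^sup>2 + s * Re (l2_inner h y)"
      unfolding eq using i q by simp
    then show "0 \<le> (LINT x|lborel. (\<delta> + s * (w x - c)) * (cmod (V y x))\<^sup>2)"
      using s range_of_form_bounds[OF y yh] by (auto simp: algebra_simps)
  qed
  have f2: "f \<in> L2" by (rule range_of_L2[OF f])
  have Df2: "D f \<in> L2" by (rule range_of_L2[OF D(2)[OF f]])
  show p: "p \<in> L2" unfolding p_def by (rule D(1)[OF f])
  show "U p \<in> range_of ?S" using D(2)[OF f] by (simp add: D_def p_def)
  \<comment> \<open>\<open>y 1\<close> and \<open>y (-1)\<close> are the vectors \<open>(\<delta> \<plusminus> D) f\<close> divided by \<open>\<delta>\<close>\<close>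
  define y where "y s x = f x + complex_of_real (s / \<delta>) * D f x" for s x
  have y: "y s \<in> range_of ?S" for s
    unfolding y_def[abs_def] by (rule range_of_linear[OF f D(2)[OF f] S])
  have Vy: "AE x in lborel. (cmod (V (y s) x))\<^sup>2 = (1 + s / \<delta> * (w x - c))\<^sup>2 * (cmod (V f x))\<^sup>2" for s
    using V_linear[OF f2 Df2, of "complex_of_real (s / \<delta>)"] D(3)[OF f]
  proof eventually_elim
    case (elim x)
    have "V (y s) x = of_real (1 + s / \<delta> * (w x - c)) * V f x"
      unfolding y_def[abs_def] elim
      by (simp only: of_real_add of_real_1 of_real_mult distrib_right mult_1_left mult.assoc)
    then show ?case by (simp only: norm_mult norm_of_real power_mult_distrib power2_abs)
  qed
  have i1: "integrable lborel (\<lambda>x. (cmod (V f x))\<^sup>2)" by (intro L2_integrable V_L2 f2)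
  have i2: "integrable lborel (\<lambda>x. (cmod (p x))\<^sup>2)" by (rule L2_integrable[OF p])
  have meas [measurable]: "V f \<in> borel_measurable borel" "V (y s) \<in> borel_measurable borel" for s
    by (intro L2_measurable V_L2 f2 range_of_L2[OF y])+
  have "0 \<le> (LINT x|lborel. (\<delta> + 1 * (w x - c)) * (cmod (V (y (-1)) x))\<^sup>2)
      + (LINT x|lborel. (\<delta> + (-1) * (w x - c)) * (cmod (V (y 1) x))\<^sup>2)"
    by (intro add_nonneg_nonneg form y) auto
  also have "\<dots> = (LINT x|lborel. (\<delta> + 1 * (w x - c)) * (cmod (V (y (-1)) x))\<^sup>2
      + (\<delta> + (-1) * (w x - c)) * (cmod (V (y 1) x))\<^sup>2)"
    by (rule Bochner_Integration.integral_add[symmetric]) (intro form y, simp)+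
  also have "\<dots> = (LINT x|lborel. 2 * \<delta> * (cmod (V f x))\<^sup>2 - 2 / \<delta> * (cmod (p x))\<^sup>2)"
  proof (rule integral_cong_AE)
    show "AE x in lborel. (\<delta> + 1 * (w x - c)) * (cmod (V (y (-1)) x))\<^sup>2
      + (\<delta> + (-1) * (w x - c)) * (cmod (V (y 1) x))\<^sup>2 = 2 * \<delta> * (cmod (V f x))\<^sup>2 - 2 / \<delta> * (cmod (p x))\<^sup>2"
      using Vy[of 1] Vy[of "-1"]
    proof eventually_elim
      case (elim x)
      have p2: "(cmod (p x))\<^sup>2 = (w x - c)\<^sup>2 * (cmod (V f x))\<^sup>2"
        unfolding p_def by (simp only: norm_mult norm_of_real power_mult_distrib power2_abs)
      show ?case unfolding elim p2 using \<delta> by (simp add: field_simps power2_eq_square)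
    qed
  qed (use L2_measurable[OF p] in simp_all)
  also have "\<dots> = 2 * \<delta> * (l2_norm f)\<^sup>2 - 2 / \<delta> * (l2_norm p)\<^sup>2"
    using i1 i2 V_norm[OF f2] by (simp add: l2_norm_power2[symmetric])
  finally have "(l2_norm p)\<^sup>2 \<le> (\<delta> * l2_norm f)\<^sup>2"
    using \<delta> by (simp add: field_simps power2_eq_square)
  then show "l2_norm p \<le> \<delta> * l2_norm f" by (rule power2_le_imp_le) (use \<delta> in simp)
qed

text \<open>
  The range is invariant under \<open>D\<close>, so the bound \<open>\<parallel>D f\<parallel> \<le> \<delta> \<parallel>f\<parallel>\<close> can be iterated.
\<close>

lemma range_of_iterate:
  assumes f: "f \<in> range_of {c - \<delta>..c + \<delta>}" and \<delta>: "\<delta> > 0"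
  shows "(\<lambda>x. complex_of_real ((w x - c) ^ n) * V f x) \<in> L2 \<and>
    U (\<lambda>x. complex_of_real ((w x - c) ^ n) * V f x) \<in> range_of {c - \<delta>..c + \<delta>} \<and>
    l2_norm (\<lambda>x. complex_of_real ((w x - c) ^ n) * V f x) \<le> \<delta> ^ n * l2_norm f"
proof (induction n)
  case 0
  have f2: "f \<in> L2" by (rule range_of_L2[OF f])
  have "f \<approx>\<^sub>2 U (V f)" using UV[OF f2] by eventually_elim simp
  then have "U (V f) \<in> range_of {c - \<delta>..c + \<delta>}"
    by (rule range_of_cong[OF f]) (simp_all add: U_L2 V_L2 f2)
  then show ?case using f2 by (simp add: V_L2 V_norm)
next
  case (Suc n)
  let ?p = "\<lambda>x. complex_of_real ((w x - c) ^ n) * V f x"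
  let ?q = "\<lambda>x. complex_of_real ((w x - c) ^ Suc n) * V f x"
  let ?r = "\<lambda>x. complex_of_real (w x - c) * V (U ?p) x"
  have p: "?p \<in> L2" and Up: "U ?p \<in> range_of {c - \<delta>..c + \<delta>}" and norm_p: "l2_norm ?p \<le> \<delta> ^ n * l2_norm f"
    using Suc.IH by auto
  note step = range_of_step[OF Up \<delta>]
  have [measurable]: "V f \<in> borel_measurable borel" by (intro L2_measurable V_L2 range_of_L2[OF f])
  have rq: "?r \<approx>\<^sub>2 ?q" using VU[OF p] by eventually_elim simp
  have q: "?q \<in> L2" by (rule L2_AE_cong[OF step(1) rq]) measurable
  have "V (U ?r) \<approx>\<^sub>2 V (U ?q)"
    using VU[OF step(1)] VU[OF q] rq by eventually_elim simp
  then have "U ?r \<approx>\<^sub>2 U ?q" by (rule V_injective'[OF U_L2[OF step(1)] U_L2[OF q]])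
  then have Uq: "U ?q \<in> range_of {c - \<delta>..c + \<delta>}"
    by (rule range_of_cong[OF step(2) _ U_L2[OF q]]) simp
  have norm_q: "l2_norm ?q \<le> \<delta> ^ Suc n * l2_norm f"
  proof -
    have "l2_norm ?q = l2_norm ?r" by (rule l2_norm_cong[OF rq step(1) q, symmetric])
    also have "\<dots> \<le> \<delta> * l2_norm (U ?p)" by (rule step(3))
    also have "l2_norm (U ?p) = l2_norm ?p"
      using V_norm[OF U_L2[OF p]] l2_norm_cong[OF VU[OF p] _ p] p by (simp add: U_L2 V_L2)
    also have "\<delta> * l2_norm ?p \<le> \<delta> * (\<delta> ^ n * l2_norm f)"
      using norm_p \<delta> by (intro mult_left_mono) auto
    finally show ?thesis by (simp add: mult.assoc)
  qed
  show ?case by (intro conjI q Uq norm_q)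
qed

text \<open>
  Mass of \<open>V f\<close> where \<open>|w - c| \<ge> t > \<delta>\<close> would make \<open>\<parallel>D\<^sup>n f\<parallel>\<close> grow at least like \<open>t\<^sup>n\<close>, against the bound \<open>\<delta>\<^sup>n \<parallel>f\<parallel>\<close>.
\<close>

lemma range_of_support:
  assumes f: "f \<in> range_of {c - \<delta>..c + \<delta>}" and \<delta>: "\<delta> > 0"
  shows "AE x in lborel. w x \<in> {c - \<delta>..c + \<delta>} \<or> V f x = 0"
proof -
  have f2: "f \<in> L2" by (rule range_of_L2[OF f])
  have [measurable]: "V f \<in> borel_measurable borel" by (intro L2_measurable V_L2 f2)
  have away: "AE x in lborel. \<bar>w x - c\<bar> < t \<or> V f x = 0" if t: "t > \<delta>" for t
  proof -
    let ?A = "{x. \<bar>w x - c\<bar> \<ge> t}"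
    have [measurable]: "?A \<in> sets borel" by measurable
    have "(\<integral>\<^sup>+x. ennreal (indicator ?A x * (cmod (V f x))\<^sup>2) \<partial>lborel) \<le> ennreal (((\<delta> / t)\<^sup>2) ^ n * (l2_norm f)\<^sup>2)" for n
    proof -
      let ?p = "\<lambda>x. complex_of_real ((w x - c) ^ n) * V f x"
      have p: "?p \<in> L2" and norm_p: "l2_norm ?p \<le> \<delta> ^ n * l2_norm f"
        using range_of_iterate[OF f \<delta>, of n] by auto
      have "(\<integral>\<^sup>+x. ennreal (indicator ?A x * (cmod (V f x))\<^sup>2) \<partial>lborel)
          \<le> (\<integral>\<^sup>+x. ennreal (1 / (t ^ n)\<^sup>2) * ennreal ((cmod (?p x))\<^sup>2) \<partial>lborel)"
      proof (rule nn_integral_mono)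
        fix x
        have "indicator ?A x * (cmod (V f x))\<^sup>2 \<le> 1 / (t ^ n)\<^sup>2 * (cmod (?p x))\<^sup>2"
        proof (cases "x \<in> ?A")
          case True
          then have "(t ^ n)\<^sup>2 \<le> (\<bar>w x - c\<bar> ^ n)\<^sup>2" using t \<delta> by (intro power_mono) auto
          then have "(t ^ n)\<^sup>2 * (cmod (V f x))\<^sup>2 \<le> (\<bar>w x - c\<bar> ^ n)\<^sup>2 * (cmod (V f x))\<^sup>2"
            by (rule mult_right_mono) simp
          also have "\<dots> = (cmod (?p x))\<^sup>2"
            unfolding norm_mult norm_of_real power_abs power_mult_distrib ..
          finally show ?thesis using True t \<delta> by (simp add: field_simps)
        qed simp
        then show "ennreal (indicator ?A x * (cmod (V f x))\<^sup>2) \<le> ennreal (1 / (t ^ n)\<^sup>2) * ennreal ((cmod (?p x))\<^sup>2)"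
          by (subst ennreal_mult[symmetric]) (simp_all del: norm_mult ennreal_mult' add: ennreal_leI)
      qed
      also have "\<dots> = ennreal (1 / (t ^ n)\<^sup>2) * ennreal ((l2_norm ?p)\<^sup>2)"
        using nn_integral_L2[OF p] L2_measurable[OF p] by (subst nn_integral_cmult) (simp_all del: norm_mult)
      also have "\<dots> = ennreal (1 / (t ^ n)\<^sup>2 * (l2_norm ?p)\<^sup>2)"
        by (rule ennreal_mult[symmetric]) simp_all
      also have "\<dots> \<le> ennreal (1 / (t ^ n)\<^sup>2 * (\<delta> ^ n * l2_norm f)\<^sup>2)"
        by (intro ennreal_leI mult_left_mono power_mono norm_p) simp_all
      also have "1 / (t ^ n)\<^sup>2 * (\<delta> ^ n * l2_norm f)\<^sup>2 = ((\<delta> / t)\<^sup>2) ^ n * (l2_norm f)\<^sup>2"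
        by (simp add: power_divide power_mult_distrib power_commutes flip: power_mult)
          (simp add: mult.commute)
      finally show ?thesis .
    qed
    moreover have "(\<lambda>n. ennreal (((\<delta> / t)\<^sup>2) ^ n * (l2_norm f)\<^sup>2)) \<longlonglongrightarrow> ennreal (0 * (l2_norm f)\<^sup>2)"
    proof (intro tendsto_ennrealI tendsto_mult tendsto_const LIMSEQ_power_zero)
      have "\<delta> / t < 1" "0 \<le> \<delta> / t" using t \<delta> by auto
      then have "(\<delta> / t)\<^sup>2 < 1" by (simp add: power_less_one_iff)
      then show "norm ((\<delta> / t)\<^sup>2) < 1" by simp
    qed
    ultimately have "(\<integral>\<^sup>+x. ennreal (indicator ?A x * (cmod (V f x))\<^sup>2) \<partial>lborel) \<le> ennreal (0 * (l2_norm f)\<^sup>2)"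
      by (intro LIMSEQ_le_const) auto
    then have "(\<integral>\<^sup>+x. ennreal (indicator ?A x * (cmod (V f x))\<^sup>2) \<partial>lborel) = 0" by simp
    then have "AE x in lborel. ennreal (indicator ?A x * (cmod (V f x))\<^sup>2) = 0"
      by (subst (asm) nn_integral_0_iff_AE) auto
    then show ?thesis
    proof eventually_elim
      case (elim x)
      then show ?case by (cases "x \<in> ?A") auto
    qed
  qed
  have "AE x in lborel. \<forall>n. \<bar>w x - c\<bar> < \<delta> + 1 / real (Suc n) \<or> V f x = 0"
    unfolding AE_all_countable by (intro allI away) simp
  then show ?thesis
  proof eventually_elim
    case (elim x)
    show ?case
    proof (rule disjCI)
      assume "V f x \<noteq> 0"
      with elim have lt: "\<bar>w x - c\<bar> < \<delta> + 1 / real (Suc n)" for n by blast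
      have "\<bar>w x - c\<bar> \<le> \<delta>"
      proof (rule field_le_epsilon)
        fix e :: real assume "e > 0"
        then obtain n where "1 / real (Suc n) < e" using nat_approx_posE by blast
        then show "\<bar>w x - c\<bar> \<le> \<delta> + e" using lt[of n] by linarith
      qed
      then show "w x \<in> {c - \<delta>..c + \<delta>}" by auto
    qed
  qed
qed

text \<open>
  The vector \<open>E S g\<close> lives where \<open>w \<in> S\<close>, so pairing it with \<open>g\<close> sees only the part of \<open>V g\<close> there, and
  Cauchy-Schwarz bounds \<open>\<parallel>E S g\<parallel>\<^sup>2 = (E S g, g)\<close>.
\<close>

lemma vector_measure_interval_le:
  assumes g: "g \<in> L2" and ab: "a < b"
  shows "emeasure (vector_measure E g) {a..b} \<le> emeasure (spectral_density g) {a..b}"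
proof -
  let ?S = "{a..b}"
  define c \<delta> where "c = (a + b) / 2" and "\<delta> = (b - a) / 2"
  have cd: "c - \<delta> = a" "c + \<delta> = b" "\<delta> > 0" using ab by (auto simp: c_def \<delta>_def field_simps)
  have S: "?S \<in> sets borel" by simp
  let ?f = "E ?S g"
  have f2: "?f \<in> L2" by (rule E_L2[OF S g])
  have supp: "AE x in lborel. w x \<in> ?S \<or> V ?f x = 0"
    using range_of_support[of ?f c \<delta>] E_in_range_of[OF S g] cd by simp
  let ?r = "\<lambda>x. indicator (w -` ?S) x * V g x"
  have r: "?r \<in> L2" by (rule restriction_L2[OF g S])
  have "(l2_norm ?f)\<^sup>2 = cmod (l2_inner ?f g)" using E_inner_self[OF S g] by (simp del: of_real_power)
  also have "l2_inner ?f g = l2_inner (V ?f) (V g)" by (rule V_inner[OF f2 g, symmetric])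
  also have "\<dots> = l2_inner (V ?f) ?r"
    unfolding l2_inner_def
  proof (rule integral_cong_AE)
    show "AE x in lborel. V ?f x * cnj (V g x) = V ?f x * cnj (?r x)"
      using supp by eventually_elim (auto simp: indicator_def)
  qed (use L2_measurable[OF V_L2[OF f2]] L2_measurable[OF V_L2[OF g]] L2_measurable[OF r] in simp_all)
  also have "cmod \<dots> \<le> l2_norm (V ?f) * l2_norm ?r" by (rule l2_Cauchy_Schwarz[OF V_L2[OF f2] r])
  also have "l2_norm (V ?f) = l2_norm ?f" by (rule V_norm[OF f2])
  finally have "l2_norm ?f * l2_norm ?f \<le> l2_norm ?f * l2_norm ?r" by (simp add: power2_eq_square)
  then have "l2_norm ?f \<le> l2_norm ?r"
    using l2_norm_nonneg[of ?f] l2_norm_nonneg[of ?r] by (cases "l2_norm ?f = 0") auto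
  then have "ennreal ((l2_norm ?f)\<^sup>2) \<le> ennreal ((l2_norm ?r)\<^sup>2)"
    by (intro ennreal_leI power_mono) auto
  also have "ennreal ((l2_norm ?r)\<^sup>2) = emeasure (spectral_density g) ?S"
    unfolding emeasure_spectral_density[OF g S] nn_integral_L2[OF r, symmetric]
    by (rule nn_integral_cong) (simp add: indicator_def)
  finally show ?thesis by (simp add: emeasure_vector_measure[OF g S])
qed

text \<open>
  Both measures have total mass \<open>\<parallel>g\<parallel>\<^sup>2\<close>, so a one-sided comparison on intervals, extended to half-lines by
  continuity, already forces equality.
\<close>

theorem vector_measure_unique:
  assumes g: "g \<in> L2" shows "vector_measure E g = spectral_density g"
proof -
  let ?M = "vector_measure E g" and ?N = "spectral_density g"
  have sets_N: "sets ?N = sets borel" by (simp add: spectral_density_def)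
  have N_UNIV: "emeasure ?N UNIV = ennreal ((l2_norm g)\<^sup>2)"
    using emeasure_spectral_density[OF g, of UNIV] nn_integral_L2[OF V_L2[OF g]] V_norm[OF g] by simp
  have le_UN: "emeasure ?M (\<Union>n. {A n..B n}) \<le> emeasure ?N (\<Union>n. {A n..B n})"
    if "incseq (\<lambda>n::nat. {A n..B n})" "\<And>n. A n < B n" for A B :: "nat \<Rightarrow> real"
  proof (rule LIMSEQ_le)
    show "(\<lambda>n. emeasure ?M {A n..B n}) \<longlonglongrightarrow> emeasure ?M (\<Union>n. {A n..B n})"
      by (rule Lim_emeasure_incseq) (use that in auto)
    show "(\<lambda>n. emeasure ?N {A n..B n}) \<longlonglongrightarrow> emeasure ?N (\<Union>n. {A n..B n})"
      by (rule Lim_emeasure_incseq) (use that sets_N in auto)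
  qed (use vector_measure_interval_le[OF g that(2)] in auto)
  have le_Ioi: "emeasure ?M {t<..} \<le> emeasure ?N {t<..}" for t
  proof -
    have "{t<..} = (\<Union>n. {t + 1 / real (Suc n)..t + 2 + real n})"
    proof (intro equalityI subsetI)
      fix x assume "x \<in> {t<..}"
      then have "x - t > 0" by simp
      then obtain n where n: "1 / real (Suc n) < x - t" using nat_approx_posE by blast
      obtain m where m: "x - t - 2 \<le> real m" using real_arch_simple by blast
      have "1 / real (Suc (max n m)) \<le> 1 / real (Suc n)" by (intro divide_left_mono) auto
      then have "x \<in> {t + 1 / real (Suc (max n m))..t + 2 + real (max n m)}" using n m by auto
      then show "x \<in> (\<Union>n. {t + 1 / real (Suc n)..t + 2 + real n})" by blast
    next
      fix x assume "x \<in> (\<Union>n. {t + 1 / real (Suc n)..t + 2 + real n})"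
      then obtain n where "t + 1 / real (Suc n) \<le> x" by auto
      moreover have "0 < 1 / real (Suc n)" by simp
      ultimately show "x \<in> {t<..}" unfolding greaterThan_iff by linarith
    qed
    moreover have "incseq (\<lambda>n. {t + 1 / real (Suc n)..t + 2 + real n})"
      by (intro incseq_SucI) (auto simp: field_simps)
    moreover have "t + 1 / real (Suc n) < t + 2 + real n" for n
      by (simp add: field_simps) (smt (verit) of_nat_0_le_iff mult_nonneg_nonneg)
    ultimately show ?thesis using le_UN[of "\<lambda>n. t + 1 / real (Suc n)" "\<lambda>n. t + 2 + real n"] by simp
  qed
  have le_Iic: "emeasure ?M {..t} \<le> emeasure ?N {..t}" for t
  proof -
    have "{..t} = (\<Union>n. {t - 1 - real n..t})"
    proof (intro equalityI subsetI)
      fix x assume "x \<in> {..t}"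
      moreover obtain m where "t - 1 - x \<le> real m" using real_arch_simple by blast
      ultimately have "x \<in> {t - 1 - real m..t}" by auto
      then show "x \<in> (\<Union>n. {t - 1 - real n..t})" by blast
    qed auto
    moreover have "incseq (\<lambda>n. {t - 1 - real n..t})" by (intro incseq_SucI) auto
    ultimately show ?thesis using le_UN[of "\<lambda>n. t - 1 - real n" "\<lambda>n. t"] by simp
  qed
  have split: "emeasure K UNIV = emeasure K {..t} + emeasure K {t<..}" if "sets K = sets borel" for K and t :: real
  proof -
    have "{..t} \<inter> {t<..} = {}" "{..t} \<union> {t<..} = UNIV" by auto
    then show ?thesis using plus_emeasure[of "{..t}" K "{t<..}"] that by simp
  qed
  have eq: "emeasure ?M {t<..} = emeasure ?N {t<..}" for t
  proof (rule antisym[OF le_Ioi])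
    have fin: "emeasure ?N {..t} < \<infinity>"
      using split[OF sets_N, of t] N_UNIV by (metis ennreal_add_less_top ennreal_less_top infinity_ennreal_def)
    have "emeasure ?N {..t} + emeasure ?N {t<..} = emeasure ?M {..t} + emeasure ?M {t<..}"
      using split[OF sets_N, of t] split[OF sets_vector_measure, of g t] N_UNIV vector_measure_UNIV[OF g] by simp
    also have "\<dots> \<le> emeasure ?N {..t} + emeasure ?M {t<..}" by (intro add_right_mono le_Iic)
    finally show "emeasure ?N {t<..} \<le> emeasure ?M {t<..}"
      using fin by (auto simp: ennreal_add_left_cancel_le)
  qed
  show ?thesis
  proof (rule measure_eqI_lessThan[OF sets_vector_measure sets_N _ eq])
    fix t
    have "emeasure ?M {t<..} \<le> emeasure ?M UNIV" by (rule emeasure_mono) auto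
    then show "emeasure ?M {t<..} < \<infinity>"
      using vector_measure_UNIV[OF g] by (metis ennreal_less_top infinity_ennreal_def order_le_less_trans)
  qed
qed

end


section \<open>The inverse of \<open>A A\<^sup>*\<close> for a multiplier \<open>A\<close>\<close>

text \<open>
  As \<open>m\<close> is real and bounded, \<open>A\<close> is self-adjoint and \<open>A A\<^sup>*\<close> multiplies by \<open>m\<^sup>2\<close>. Both graphs therefore
  consist of the pairs with \<open>V g = m\<^sup>2 V f\<close>.
\<close>

lemma (in multiplication_operator) inverse_AAstar_graph_eq:
  fixes m :: "real \<Rightarrow> real"
  assumes A_L2: "\<And>f. f \<in> L2 \<Longrightarrow> A f \<in> L2"
    and A_eq: "\<And>f. f \<in> L2 \<Longrightarrow> A f \<approx>\<^sub>2 U (\<lambda>x. complex_of_real (m x) * V f x)"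
    and [measurable]: "m \<in> borel_measurable borel" and bound: "\<And>x. \<bar>m x\<bar> \<le> c"
    and m_nz: "\<And>x. m x \<noteq> 0" and w_eq: "\<And>x. w x = 1 / (m x)\<^sup>2"
  shows "inverse_AAstar_graph A = graph"
proof -
  have mL2: "(\<lambda>x. complex_of_real (m x) * V f x) \<in> L2" if "f \<in> L2" for f
    by (rule L2_bounded_mult[OF V_L2[OF that], where c = c]) (simp_all add: bound)
  define D where "D f = U (\<lambda>x. complex_of_real (m x) * V f x)" for f
  have D_L2: "D f \<in> L2" if "f \<in> L2" for f unfolding D_def by (rule U_L2[OF mL2[OF that]])
  have VD: "V (D f) \<approx>\<^sub>2 (\<lambda>x. complex_of_real (m x) * V f x)" if "f \<in> L2" for f
    unfolding D_def by (rule VU[OF mL2[OF that]])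
  have VA: "V (A f) \<approx>\<^sub>2 (\<lambda>x. complex_of_real (m x) * V f x)" if f: "f \<in> L2" for f
    using V_cong[OF A_L2[OF f] D_L2[OF f]] A_eq[OF f] VD[OF f] unfolding D_def[symmetric]
    by (auto elim: eventually_elim2)
  have VAD: "V (A (D f)) \<approx>\<^sub>2 (\<lambda>x. complex_of_real ((m x)\<^sup>2) * V f x)" if f: "f \<in> L2" for f
    using VA[OF D_L2[OF f]] VD[OF f] by eventually_elim (simp add: power2_eq_square)
  have adj: "l2_inner (A u) f = l2_inner u (D f)" if u: "u \<in> L2" and f: "f \<in> L2" for u f
  proof -
    have "l2_inner (A u) f = l2_inner (D u) f"
      using l2_inner_cong[OF A_eq[OF u], of f f] A_L2[OF u] f D_L2[OF u] by (simp add: D_def)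
    also have "\<dots> = l2_inner (\<lambda>x. complex_of_real (m x) * V u x) (V f)"
      unfolding D_def by (rule U_adjoint[OF mL2[OF u] f])
    also have "\<dots> = l2_inner (V u) (\<lambda>x. complex_of_real (m x) * V f x)"
      by (simp add: l2_inner_def mult_ac)
    also have "\<dots> = l2_inner u (D f)"
      unfolding D_def by (rule V_adjoint[OF u mL2[OF f]])
    finally show ?thesis .
  qed
  have "(g, f) \<in> inverse_AAstar_graph A \<longleftrightarrow> (g, f) \<in> graph" for g f
  proof
    assume "(g, f) \<in> inverse_AAstar_graph A"
    then obtain h where g: "g \<in> L2" and f: "f \<in> L2" and h: "h \<in> L2" and Ah: "A h \<approx>\<^sub>2 g"
      and test: "\<And>u. u \<in> L2 \<Longrightarrow> l2_inner (A u) f = l2_inner u h"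
      by (auto simp: inverse_AAstar_graph_def adjoint_graph_def)
    have "h \<approx>\<^sub>2 D f"
    proof (rule l2_eq_by_testing[OF h D_L2[OF f]])
      fix u assume "u \<in> L2"
      then have "l2_inner u h = l2_inner u (D f)" using test adj f by metis
      then show "l2_inner h u = l2_inner (D f) u" by (metis l2_inner_commute)
    qed
    then have "V h \<approx>\<^sub>2 V (D f)" by (rule V_cong[OF h D_L2[OF f]])
    moreover have "V (A h) \<approx>\<^sub>2 V g" by (rule V_cong[OF A_L2[OF h] g Ah])
    ultimately have "V f \<approx>\<^sub>2 (\<lambda>x. complex_of_real (w x) * V g x)"
      using VA[OF h] VD[OF f]
    proof eventually_elim
      case (elim x)
      have "V g x = complex_of_real (m x) * (complex_of_real (m x) * V f x)" using elim by simp
      then show ?case using m_nz[of x] by (simp add: w_eq power2_eq_square)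
    qed
    then show "(g, f) \<in> graph" using g f by (simp add: graph_def)
  next
    assume gf: "(g, f) \<in> graph"
    note g = graphD(1)[OF gf] and f = graphD(2)[OF gf]
    have "V (A (D f)) \<approx>\<^sub>2 V g"
      using VAD[OF f] graphD(3)[OF gf]
    proof eventually_elim
      case (elim x)
      then show ?case using m_nz[of x] by (simp add: w_eq)
    qed
    then have "A (D f) \<approx>\<^sub>2 g" by (rule V_injective'[OF A_L2[OF D_L2[OF f]] g])
    then show "(g, f) \<in> inverse_AAstar_graph A"
      using g f D_L2[OF f] adj[OF _ f] by (auto simp: inverse_AAstar_graph_def adjoint_graph_def)
  qed
  then show ?thesis by auto
qed


section \<open>Taylor polynomials of the exponential function\<close>

lemma taylor_exp_Suc: "taylor_exp (Suc k) s = taylor_exp k s + s ^ Suc k / fact (Suc k)"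
  by (simp add: taylor_exp_def)

lemma DERIV_taylor_exp_Suc: "(taylor_exp (Suc k) has_real_derivative taylor_exp k s) (at s)"
proof (induction k)
  case 0
  have "taylor_exp (Suc 0) = (\<lambda>s. 1 + s)" "taylor_exp 0 s = 1" by (simp_all add: taylor_exp_def fun_eq_iff)
  then show ?case by (auto intro!: derivative_eq_intros)
next
  case (Suc k)
  have "((\<lambda>s. s ^ Suc (Suc k) / fact (Suc (Suc k))) has_real_derivative s ^ Suc k / fact (Suc k)) (at s)"
    by (rule derivative_eq_intros refl | simp)+
  from DERIV_add[OF Suc this] show ?case by (simp only: taylor_exp_Suc[abs_def])
qed

lemma taylor_exp_mono: "0 \<le> s \<Longrightarrow> s \<le> t \<Longrightarrow> taylor_exp k s \<le> taylor_exp k t"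
  unfolding taylor_exp_def by (intro sum_mono divide_right_mono power_mono) auto

lemma taylor_exp_0: "taylor_exp k 0 = 1"
  by (induction k) (simp_all add: taylor_exp_Suc, simp add: taylor_exp_def)

lemma taylor_exp_ge_1: assumes "0 \<le> s" shows "1 \<le> taylor_exp k s"
proof -
  have "taylor_exp k 0 \<le> taylor_exp k s" by (rule taylor_exp_mono) (use assms in auto)
  then show ?thesis by (simp add: taylor_exp_0)
qed

lemma taylor_exp_ge_linear:
  assumes "k \<ge> 1" "0 \<le> s" shows "1 + s \<le> taylor_exp k s"
  using assms(1)
proof (induction k rule: dec_induct)
  case base
  show ?case by (simp add: taylor_exp_def)
next
  case (step n)
  have "0 \<le> s ^ Suc n / fact (Suc n)" using assms(2) by simp
  then show ?case using step.IH unfolding taylor_exp_Suc by linarith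
qed

lemma taylor_exp_strict_mono:
  assumes k: "k \<ge> 1" and s: "0 \<le> s" "s < t" shows "taylor_exp k s < taylor_exp k t"
  using k
proof (induction k rule: dec_induct)
  case base
  show ?case using s by (simp add: taylor_exp_def)
next
  case (step n)
  have "s ^ Suc n / fact (Suc n) \<le> t ^ Suc n / fact (Suc n)"
    using s by (intro divide_right_mono power_mono) auto
  then show ?case using step.IH unfolding taylor_exp_Suc by linarith
qed

lemma continuous_on_taylor_exp: "continuous_on S (taylor_exp k)"
  unfolding taylor_exp_def[abs_def] by (intro continuous_intros) auto

lemma taylor_exp_measurable [measurable]: "taylor_exp k \<in> borel_measurable borel"
  by (intro borel_measurable_continuous_onI continuous_on_taylor_exp)

lemma taylor_exp_inj_on:
  assumes "k \<ge> 1" shows "inj_on (taylor_exp k) {0..}"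
proof (rule linorder_inj_onI)
  fix x y :: real assume "x < y" "x \<in> {0..}" "y \<in> {0..}"
  then show "taylor_exp k x \<noteq> taylor_exp k y" using taylor_exp_strict_mono[OF assms, of x y] by auto
qed auto

lemma taylor_exp_inv_taylor_exp: "k \<ge> 1 \<Longrightarrow> 0 \<le> s \<Longrightarrow> taylor_exp_inv k (taylor_exp k s) = s"
  unfolding taylor_exp_inv_def by (rule the_inv_into_f_f[OF taylor_exp_inj_on]) auto

lemma taylor_exp_surj:
  assumes "k \<ge> 1" "1 \<le> y" shows "\<exists>s\<ge>0. taylor_exp k s = y"
proof -
  have "\<exists>s. 0 \<le> s \<and> s \<le> y \<and> taylor_exp k s = y"
    using assms taylor_exp_ge_linear[OF assms(1), of y] taylor_exp_0[of k]
    by (intro IVT' continuous_on_taylor_exp) auto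
  then show ?thesis by blast
qed

lemma psi_mono_on: "k \<ge> 1 \<Longrightarrow> mono_on {1..} (psi k)"
proof (rule mono_onI)
  fix x y :: real assume k: "k \<ge> 1" and xy: "x \<in> {1..}" "y \<in> {1..}" "x \<le> y"
  obtain s where s: "s \<ge> 0" "taylor_exp k s = sqrt x" using taylor_exp_surj[OF k, of "sqrt x"] xy by auto
  obtain t where t: "t \<ge> 0" "taylor_exp k t = sqrt y" using taylor_exp_surj[OF k, of "sqrt y"] xy by auto
  have "\<not> t < s" using taylor_exp_strict_mono[OF k t(1), of s] s t xy by auto
  moreover have "taylor_exp_inv k (sqrt x) = s" "taylor_exp_inv k (sqrt y) = t"
    using taylor_exp_inv_taylor_exp[OF k] s t by metis+
  ultimately show "psi k x \<le> psi k y" by (simp add: psi_def)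
qed

text \<open>
  On \<open>[1, \<infinity>)\<close> the function \<open>\<psi>\<close> is monotone, because \<open>t\<^sub>k\<close> maps \<open>[0, \<infinity>)\<close> increasingly onto \<open>[1, \<infinity>)\<close>;
  outside, \<open>t\<^sub>k\<^sup>-\<^sup>1\<close> is an arbitrary value, hence the indicator.
\<close>

lemma psi_measurable:
  assumes "k \<ge> 1"
  shows "(\<lambda>s. ennreal (psi k s) * indicator {1..} s) \<in> borel_measurable borel"
proof -
  have "psi k \<in> borel_measurable (restrict_space borel {1..})"
    by (rule borel_measurable_mono_on_fnc[OF psi_mono_on[OF assms]])
  then have [measurable]: "(\<lambda>s. indicator {1..} s *\<^sub>R psi k s) \<in> borel_measurable borel"
    by (subst (asm) borel_measurable_restrict_space_iff) auto
  have "(\<lambda>s. ennreal (indicator {1..} s *\<^sub>R psi k s)) \<in> borel_measurable borel" by measurable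
  also have "(\<lambda>s. ennreal (indicator {1..} s *\<^sub>R psi k s)) = (\<lambda>s. ennreal (psi k s) * indicator {1..} s)"
    by (auto simp: indicator_def fun_eq_iff)
  finally show ?thesis .
qed

text \<open>The derivative of \<open>t\<^sub>k\<close> is \<open>t\<^bsub>k-1\<^esub> \<le> t\<^sub>k\<close>.\<close>

lemma taylor_exp_exp_antimono:
  assumes "0 \<le> s" "s \<le> t" shows "taylor_exp k t * exp (- t) \<le> taylor_exp k s * exp (- s)"
proof (rule DERIV_nonpos_imp_nonincreasing[OF assms(2)])
  fix x assume x: "s \<le> x" "x \<le> t"
  show "\<exists>y. ((\<lambda>x. taylor_exp k x * exp (- x)) has_real_derivative y) (at x) \<and> y \<le> 0"
  proof (cases k)
    case 0
    have "((\<lambda>x. exp (- x)) has_real_derivative - exp (- x)) (at x)"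
      by (auto intro!: derivative_eq_intros)
    then show ?thesis unfolding 0 by (intro exI[of _ "- exp (- x)"]) (simp add: taylor_exp_def)
  next
    case (Suc n)
    have "((\<lambda>x. taylor_exp k x * exp (- x)) has_real_derivative
        taylor_exp n x * exp (- x) - taylor_exp k x * exp (- x)) (at x)"
      unfolding Suc by (auto intro!: derivative_eq_intros DERIV_taylor_exp_Suc)
    moreover have "taylor_exp n x \<le> taylor_exp k x"
      using x assms by (simp add: Suc taylor_exp_Suc)
    then have "taylor_exp n x * exp (- x) - taylor_exp k x * exp (- x) \<le> 0" by simp
    ultimately show ?thesis by blast
  qed
qed

lemma taylor_exp_le_power:
  assumes "1 \<le> s" shows "taylor_exp k s \<le> exp 1 * s ^ k"
proof -
  have "taylor_exp k s \<le> (\<Sum>j\<le>k. 1 ^ j / fact j * s ^ k)"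
    unfolding taylor_exp_def using assms
    by (intro sum_mono) (auto intro!: divide_right_mono power_increasing)
  also have "\<dots> = (\<Sum>j\<le>k. 1 ^ j /\<^sub>R fact j) * s ^ k"
    by (simp add: sum_distrib_right divide_inverse)
  also have "(\<Sum>j\<le>k. (1::real) ^ j /\<^sub>R fact j) \<le> exp 1"
    unfolding exp_def using sum_le_suminf[OF summable_exp_generic[of "1::real"], of "{..k}"] by simp
  finally show ?thesis using assms by (simp add: mult_right_mono)
qed


section \<open>The enhancement operator and Gaussian spectra as multipliers\<close>

interpretation fourier: unitary_pair fourier_adj fourier
  by unfold_locales
    (auto intro: fourier_adj_L2 fourier_limit fourier_adj_adjoint fourier_adj_fourier fourier_fourier_adj)

lemma integral_cis_even:
  fixes m :: "real \<Rightarrow> real"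
  assumes m: "integrable lborel m" and even: "\<And>w. m (- w) = m w"
  shows "(LINT w|lborel. cis (w * t) * complex_of_real (m w)) = of_real (2 * (LINT w:{0..}|lborel. m w * cos (w * t)))"
proof -
  have [measurable]: "m \<in> borel_measurable borel" using borel_measurable_integrable[OF m] by simp
  have c: "integrable lborel (\<lambda>w. m w * cos (w * t))"
    by (rule Bochner_Integration.integrable_bound[OF m]) (auto simp: abs_mult intro!: mult_left_le)
  have s: "integrable lborel (\<lambda>w. m w * sin (w * t))"
    by (rule Bochner_Integration.integrable_bound[OF m]) (auto simp: abs_mult intro!: mult_left_le)
  have reflect: "(LINT w|lborel. h w) = (LINT w|lborel. h (- w))" for h :: "real \<Rightarrow> real"
    using lborel_integral_real_affine[of "-1" h 0] by simp
  have "(LINT w|lborel. m w * sin (w * t)) = - (LINT w|lborel. m w * sin (w * t))"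
    by (subst reflect) (simp add: even)
  then have sin: "(LINT w|lborel. m w * sin (w * t)) = 0" by simp
  have ci: "integrable lborel (\<lambda>w. indicator S w * (m w * cos (w * t)))" if "S \<in> sets borel" for S
    using integrable_mult_indicator[of S lborel, OF _ c] that by simp
  have "(LINT w|lborel. m w * cos (w * t))
      = (LINT w|lborel. indicator {0..} w * (m w * cos (w * t)) + indicator {..<0} w * (m w * cos (w * t)))"
    by (rule Bochner_Integration.integral_cong) (auto simp: indicator_def)
  also have "\<dots> = (LINT w|lborel. indicator {0..} w * (m w * cos (w * t))) + (LINT w|lborel. indicator {..<0} w * (m w * cos (w * t)))"
    by (rule Bochner_Integration.integral_add) (auto intro: ci)
  also have "(LINT w|lborel. indicator {..<0} w * (m w * cos (w * t))) = (LINT w|lborel. indicator {0..} w * (m w * cos (w * t)))"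
  proof (subst reflect, rule integral_cong_AE)
    show "AE w in lborel. indicator {..<0} (- w) * (m (- w) * cos (- w * t)) = indicator {0..} w * (m w * cos (w * t))"
      using AE_lborel_singleton[of 0] by eventually_elim (auto simp: indicator_def even)
  qed measurable
  finally have cos: "(LINT w|lborel. m w * cos (w * t)) = 2 * (LINT w:{0..}|lborel. m w * cos (w * t))"
    by (simp add: set_lebesgue_integral_def)
  have "(LINT w|lborel. cis (w * t) * complex_of_real (m w))
      = (LINT w|lborel. complex_of_real (m w * cos (w * t)) + \<i> * complex_of_real (m w * sin (w * t)))"
    by (rule Bochner_Integration.integral_cong) (auto simp: complex_eq_iff)
  also have "\<dots> = (LINT w|lborel. complex_of_real (m w * cos (w * t))) + (LINT w|lborel. \<i> * complex_of_real (m w * sin (w * t)))"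
    using c s by (intro Bochner_Integration.integral_add integrable_mult_right integrable_of_real)
  also have "\<dots> = of_real (LINT w|lborel. m w * cos (w * t)) + \<i> * of_real (LINT w|lborel. m w * sin (w * t))"
    by (simp only: integral_mult_right_zero integral_complex_of_real)
  finally show ?thesis by (simp add: sin cos)
qed

definition eddington_multiplier :: "nat \<Rightarrow> real \<Rightarrow> real" where
  "eddington_multiplier k w = 1 / taylor_exp k (w\<^sup>2 / 2)"

lemma eddington_multiplier_measurable [measurable]: "eddington_multiplier k \<in> borel_measurable borel"
  unfolding eddington_multiplier_def[abs_def] by measurable

lemma eddington_multiplier_pos: "0 < eddington_multiplier k w"
  and eddington_multiplier_le_1: "eddington_multiplier k w \<le> 1"
  using taylor_exp_ge_1[of "w\<^sup>2 / 2" k] by (auto simp: eddington_multiplier_def)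

lemma eddington_multiplier_integrable:
  assumes "k \<ge> 1" shows "integrable lborel (eddington_multiplier k)"
proof -
  have "integrable lborel (\<lambda>w::real. inverse (1 + w\<^sup>2))"
    using integrable_inverse_1_plus_square by (simp add: set_integrable_def einterval_def)
  then have "integrable lborel (\<lambda>w::real. 2 * inverse (1 + w\<^sup>2))" by simp
  then show ?thesis
  proof (rule Bochner_Integration.integrable_bound)
    show "AE w in lborel. norm (eddington_multiplier k w) \<le> norm (2 * inverse (1 + w\<^sup>2))"
    proof (rule AE_I2)
      fix w :: real
      have "(1 + w\<^sup>2) / 2 \<le> taylor_exp k (w\<^sup>2 / 2)"
        using taylor_exp_ge_linear[OF assms, of "w\<^sup>2 / 2"] by simp
      moreover have "0 < 1 + w\<^sup>2" using zero_le_power2[of w] by linarith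
      ultimately have "1 / taylor_exp k (w\<^sup>2 / 2) \<le> 1 / ((1 + w\<^sup>2) / 2)"
        by (intro divide_left_mono mult_pos_pos) auto
      then show "norm (eddington_multiplier k w) \<le> norm (2 * inverse (1 + w\<^sup>2))"
        using eddington_multiplier_pos[of k w] \<open>0 < 1 + w\<^sup>2\<close>
        by (simp add: eddington_multiplier_def inverse_eq_divide)
    qed
  qed simp
qed

lemma eddington_kernel_eq:
  assumes "k \<ge> 1"
  shows "complex_of_real (eddington_kernel k x y)
    = (LINT w|lborel. cis (w * (x - y)) * complex_of_real (eddington_multiplier k w)) / (2 * pi)"
proof -
  have "inverse (\<Sum>j\<le>k. w ^ (2 * j) / (2 ^ j * fact j)) = eddington_multiplier k w" for w :: real
    by (simp add: eddington_multiplier_def taylor_exp_def power_divide power_mult inverse_eq_divide)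
  then show ?thesis
    using integral_cis_even[OF eddington_multiplier_integrable[OF assms], of "x - y"]
    by (simp add: eddington_kernel_def eddington_multiplier_def)
qed

lemma eddington_L2: "k \<ge> 1 \<Longrightarrow> f \<in> L2 \<Longrightarrow> eddington k f \<in> L2"
  and eddington_eq_multiplier: "k \<ge> 1 \<Longrightarrow> f \<in> L2 \<Longrightarrow>
      eddington k f \<approx>\<^sub>2 fourier_adj (\<lambda>w. complex_of_real (eddington_multiplier k w) * fourier f w)"
proof -
  assume k: "k \<ge> 1" and f: "f \<in> L2"
  have "\<bar>eddington_multiplier k w\<bar> \<le> 1" for w
    using eddington_multiplier_pos[of k w] eddington_multiplier_le_1[of k w] by simp
  note * = convolution_eq_multiplier[OF eddington_multiplier_measurable eddington_multiplier_integrable[OF k] this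
      eddington_kernel_eq[OF k] f]
  show "eddington k f \<in> L2"
    "eddington k f \<approx>\<^sub>2 fourier_adj (\<lambda>w. complex_of_real (eddington_multiplier k w) * fourier f w)"
    unfolding eddington_def[abs_def] by (rule *)+
qed

lemma gaussian_convolution_eq_multiplier:
  assumes u: "u \<in> L2"
  shows "(\<lambda>x. LINT y|lborel. complex_of_real (1 / sqrt (2 * pi) * exp (- ((x - y)\<^sup>2 / 2))) * u y)
    \<approx>\<^sub>2 fourier_adj (\<lambda>w. complex_of_real (exp (- (w\<^sup>2) / 2)) * fourier u w)"
proof -
  have kernel: "complex_of_real (1 / sqrt (2 * pi) * exp (- ((x - y)\<^sup>2 / 2)))
      = (LINT w|lborel. cis (w * (x - y)) * complex_of_real (exp (- (w\<^sup>2) / 2))) / (2 * pi)" for x y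
  proof -
    have int: "(LINT w|lborel. cis (w * (x - y)) * complex_of_real (exp (- (w\<^sup>2) / 2)))
        = of_real (sqrt (2 * pi) * exp (- ((x - y)\<^sup>2) / 2))"
      using integral_cis_gaussian[of "x - y"] by (simp only: mult.commute)
    have "sqrt (2 * pi) * E / (2 * pi) = 1 / sqrt (2 * pi) * E" for E
    proof -
      have "2 * pi = sqrt (2 * pi) * sqrt (2 * pi)" by simp
      then show ?thesis by (simp add: field_simps)
    qed
    then have eq: "sqrt (2 * pi) * exp (- ((x - y)\<^sup>2) / 2) / (2 * pi) = 1 / sqrt (2 * pi) * exp (- ((x - y)\<^sup>2 / 2))"
      by simp
    have "complex_of_real r / (2 * pi) = of_real (r / (2 * pi))" for r by simp
    then show ?thesis unfolding int by (simp only: eq)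
  qed
  show ?thesis
    by (rule convolution_eq_multiplier(2)[OF _ integrable_gaussian _ kernel u, where c = 1]) simp_all
qed

text \<open>
  In the Fourier domain \<open>(B B\<^sup>*)\<^sup>-\<^sup>1\<close> multiplies by \<open>t\<^sub>k(w\<^sup>2/2)\<^sup>2\<close>, and \<open>\<psi>(t\<^sub>k(w\<^sup>2/2)\<^sup>2) = e\<^bsup>w\<^sup>2\<^esup>\<close>. The
  chosen spectral measure is a genuine one because a spectral measure exists, and its vector measures
  are the explicit ones by uniqueness.
\<close>

theorem spectral_form_eddington:
  assumes k: "k \<ge> 1" and g: "g \<in> L2"
  shows "spectral_form (inverse_AAstar_graph (eddington k)) (psi k) g
    = (\<integral>\<^sup>+w. ennreal ((cmod (fourier g w))\<^sup>2) * ennreal (exp (w\<^sup>2)) \<partial>lborel)"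
proof -
  define w where "w x = 1 / (eddington_multiplier k x)\<^sup>2" for x
  have w_eq: "w x = (taylor_exp k (x\<^sup>2 / 2))\<^sup>2" for x
    by (simp add: w_def eddington_multiplier_def power_divide)
  interpret W: multiplication_operator fourier_adj fourier w
    by unfold_locales (simp add: w_def[abs_def])
  let ?T = "inverse_AAstar_graph (eddington k)"
  have T: "?T = W.graph"
  proof (rule W.inverse_AAstar_graph_eq)
    show "eddington k h \<in> L2" if "h \<in> L2" for h using k that by (rule eddington_L2)
    show "eddington k h \<approx>\<^sub>2 fourier_adj (\<lambda>x. complex_of_real (eddington_multiplier k x) * fourier h x)"
      if "h \<in> L2" for h using k that by (rule eddington_eq_multiplier)
    show "\<bar>eddington_multiplier k x\<bar> \<le> 1" for x
      using eddington_multiplier_pos[of k x] eddington_multiplier_le_1[of k x] by simp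
    show "eddington_multiplier k x \<noteq> 0" for x using eddington_multiplier_pos[of k x] by simp
  qed (simp_all add: w_def)
  have "is_spectral_measure ?T (spectral_measure ?T)"
    unfolding spectral_measure_def
    by (rule someI[where P = "is_spectral_measure ?T", OF W.is_spectral_measure_multiplier_projection[folded T]])
  then interpret W: spectral_multiplication fourier_adj fourier w "spectral_measure ?T"
    by unfold_locales (simp_all add: T is_spectral_measure_def)
  have "spectral_form ?T (psi k) g = (\<integral>\<^sup>+s. ennreal (psi k s) * indicator {1..} s \<partial>W.spectral_density g)"
    unfolding spectral_form_def W.vector_measure_unique[OF g] ..
  also have "\<dots> = (\<integral>\<^sup>+x. ennreal ((cmod (fourier g x))\<^sup>2) * (ennreal (psi k (w x)) * indicator {1..} (w x)) \<partial>lborel)"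
    by (rule W.nn_integral_spectral_density[OF g psi_measurable[OF k]])
  also have "\<dots> = (\<integral>\<^sup>+x. ennreal ((cmod (fourier g x))\<^sup>2) * ennreal (exp (x\<^sup>2)) \<partial>lborel)"
  proof (rule nn_integral_cong)
    fix x :: real
    have t: "1 \<le> taylor_exp k (x\<^sup>2 / 2)" by (rule taylor_exp_ge_1) simp
    then have "1 \<le> w x" by (simp add: w_eq one_le_power)
    moreover have "psi k (w x) = exp (x\<^sup>2)"
      using t taylor_exp_inv_taylor_exp[OF k, of "x\<^sup>2 / 2"] by (simp add: psi_def w_eq)
    ultimately show "ennreal ((cmod (fourier g x))\<^sup>2) * (ennreal (psi k (w x)) * indicator {1..} (w x))
        = ennreal ((cmod (fourier g x))\<^sup>2) * ennreal (exp (x\<^sup>2))" by simp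
  qed
  finally show ?thesis .
qed


section \<open>The error estimate\<close>

text \<open>
  Below the cut-off \<open>L\<close> monotonicity of \<open>t\<^sub>k\<close> gives the first summand, above it monotonicity of
  \<open>t\<^sub>k(s) e\<^bsup>-s\<^esup>\<close> gives the second.
\<close>

lemma taylor_exp_interpolation:
  assumes "0 \<le> s" "0 \<le> L"
  shows "(taylor_exp k s)\<^sup>2 \<le> (taylor_exp k L)\<^sup>2 * (1 + (exp (- L))\<^sup>2 * exp (2 * s))"
proof (cases "s \<le> L")
  case True
  have "(taylor_exp k s)\<^sup>2 \<le> (taylor_exp k L)\<^sup>2 * 1"
    using taylor_exp_mono[OF assms(1) True] taylor_exp_ge_1[OF assms(1), of k] by (simp add: power_mono)
  also have "\<dots> \<le> (taylor_exp k L)\<^sup>2 * (1 + (exp (- L))\<^sup>2 * exp (2 * s))"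
    by (intro mult_left_mono) auto
  finally show ?thesis .
next
  case False
  have "taylor_exp k s = taylor_exp k s * exp (- s) * exp s" by (simp add: exp_minus)
  also have "\<dots> \<le> taylor_exp k L * exp (- L) * exp s"
    using taylor_exp_exp_antimono[of L s k] assms False by (intro mult_right_mono) auto
  finally have "(taylor_exp k s)\<^sup>2 \<le> (taylor_exp k L * exp (- L) * exp s)\<^sup>2"
    using taylor_exp_ge_1[OF assms(1), of k] by (intro power_mono) auto
  also have "\<dots> = (taylor_exp k L)\<^sup>2 * ((exp (- L))\<^sup>2 * exp (2 * s))"
    by (simp add: power_mult_distrib exp_double)
  also have "\<dots> \<le> (taylor_exp k L)\<^sup>2 * (1 + (exp (- L))\<^sup>2 * exp (2 * s))"
    by (intro mult_left_mono) auto
  finally show ?thesis .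
qed

lemma fourier_eddington:
  assumes "k \<ge> 1" "f \<in> L2"
  shows "fourier (eddington k f) \<approx>\<^sub>2 (\<lambda>w. complex_of_real (eddington_multiplier k w) * fourier f w)"
proof -
  let ?q = "\<lambda>w. complex_of_real (eddington_multiplier k w) * fourier f w"
  have q: "?q \<in> L2"
  proof (rule L2_bounded_mult[OF fourier_limit(1)[OF assms(2)], where c = 1])
    show "cmod (complex_of_real (eddington_multiplier k w)) \<le> 1" for w
      using eddington_multiplier_pos[of k w] eddington_multiplier_le_1[of k w] by simp
  qed simp
  have "fourier (eddington k f) \<approx>\<^sub>2 fourier (fourier_adj ?q)"
    using assms q by (intro fourier_cong eddington_L2 eddington_eq_multiplier fourier_adj_L2)
  then show ?thesis using fourier_fourier_adj[OF q] by eventually_elim simp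
qed

lemma fourier_gaussian_spectrum:
  assumes "gaussian_spectrum g"
  shows "\<exists>u\<in>L2. fourier g \<approx>\<^sub>2 (\<lambda>w. complex_of_real (exp (- (w\<^sup>2) / 2)) * fourier u w)"
proof -
  obtain u where g: "g \<in> L2" and u: "u \<in> L2" and eq: "g \<approx>\<^sub>2
      (\<lambda>x. LINT y|lborel. complex_of_real (1 / sqrt (2 * pi) * exp (- ((x - y)\<^sup>2 / 2))) * u y)"
    using assms by (auto simp: gaussian_spectrum_def)
  let ?q = "\<lambda>w. complex_of_real (exp (- (w\<^sup>2) / 2)) * fourier u w"
  have q: "?q \<in> L2"
    by (rule L2_bounded_mult[OF fourier_limit(1)[OF u], where c = 1]) simp_all
  have "g \<approx>\<^sub>2 fourier_adj ?q"
    using eq gaussian_convolution_eq_multiplier[OF u] by eventually_elim simp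
  then have "fourier g \<approx>\<^sub>2 fourier (fourier_adj ?q)"
    by (intro fourier_cong g fourier_adj_L2 q)
  then have "fourier g \<approx>\<^sub>2 ?q" using fourier_fourier_adj[OF q] by eventually_elim simp
  then show ?thesis using u by blast
qed

theorem proposition1:
  fixes k :: nat and M :: real and f g :: "real \<Rightarrow> complex"
  assumes "k \<ge> 1"
    and "gaussian_spectrum g"
    and "f \<in> L2"
    and "eddington k f \<approx>\<^sub>2 g"
    and "M \<ge> 0"
  shows "\<exists>C>0. \<forall>\<epsilon>. 0 < \<epsilon> \<and> \<epsilon> \<le> 1 / exp 1 \<longrightarrow>
           (\<forall>f\<^sub>\<alpha>\<in>L2.
              eddington k f\<^sub>\<alpha> \<in> H_psi k \<and>
              psi_norm k (eddington k f\<^sub>\<alpha>) \<le> M \<and>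
              l2_norm (\<lambda>x. eddington k f\<^sub>\<alpha> x - g x) = \<epsilon> \<longrightarrow>
              l2_norm (\<lambda>x. f x - f\<^sub>\<alpha> x) \<le> C * \<epsilon> * \<bar>ln \<epsilon>\<bar> ^ k)"
proof -
  note k = assms(1) and f = assms(3)
  have g: "g \<in> L2" using assms(2) by (simp add: gaussian_spectrum_def)
  obtain u where u: "u \<in> L2" and Fg: "fourier g \<approx>\<^sub>2 (\<lambda>w. complex_of_real (exp (- (w\<^sup>2) / 2)) * fourier u w)"
    using fourier_gaussian_spectrum[OF assms(2)] by blast
  let ?m = "eddington_multiplier k"
  define K where "K = 2 * M\<^sup>2 + 2 * (l2_norm u)\<^sup>2"
  have K: "0 \<le> K" by (simp add: K_def)
  have Fg': "fourier g \<approx>\<^sub>2 (\<lambda>w. complex_of_real (?m w) * fourier f w)"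
    using fourier_cong[OF eddington_L2[OF k f] g assms(4)] fourier_eddington[OF k f]
    by eventually_elim simp
  have main: "l2_norm (\<lambda>x. f x - f' x) \<le> sqrt (1 + K) * exp 1 * \<epsilon> * \<bar>ln \<epsilon>\<bar> ^ k"
    if \<epsilon>: "0 < \<epsilon>" "\<epsilon> \<le> 1 / exp 1" and f': "f' \<in> L2" and H: "eddington k f' \<in> H_psi k"
      and stable: "psi_norm k (eddington k f') \<le> M"
      and consistent: "l2_norm (\<lambda>x. eddington k f' x - g x) = \<epsilon>" for \<epsilon> f'
  proof -
    \<comment> \<open>the cut-off frequency \<open>w\<^sup>2/2 = L\<close> is the one with \<open>e\<^bsup>-L\<^esup> = \<epsilon>\<close>\<close>
    define L where "L = \<bar>ln \<epsilon>\<bar>"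
    have "ln \<epsilon> \<le> ln (1 / exp 1)" using \<epsilon> by (intro ln_mono) auto
    then have ln: "ln \<epsilon> \<le> - 1" by (simp add: ln_div)
    then have "- L = ln \<epsilon>" by (simp add: L_def)
    then have L: "1 \<le> L" "exp (- L) = \<epsilon>" using \<epsilon> ln by simp_all
    have Bf': "eddington k f' \<in> L2" by (rule eddington_L2[OF k f'])
    define q where "q w = complex_of_real (?m w) * (fourier f' w - fourier f w)" for w
    have d: "(\<lambda>x. eddington k f' x - g x) \<in> L2" by (intro L2_diff Bf' g)
    \<comment> \<open>\<open>q\<close> is the transform of the misfit \<open>B f' - g\<close>\<close>
    have Fd: "fourier (\<lambda>x. eddington k f' x - g x) \<approx>\<^sub>2 q"
      using fourier.V_linear[OF Bf' g, of "-1"] fourier_eddington[OF k f'] Fg'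
      by eventually_elim (simp add: q_def algebra_simps)
    have [measurable]: "fourier f \<in> borel_measurable borel" "fourier f' \<in> borel_measurable borel"
      "fourier u \<in> borel_measurable borel" "fourier (eddington k f') \<in> borel_measurable borel"
      by (intro L2_measurable fourier_limit f f' u Bf')+
    have [measurable]: "q \<in> borel_measurable borel" unfolding q_def[abs_def] by measurable
    have small: "(\<integral>\<^sup>+w. ennreal ((cmod (q w))\<^sup>2) \<partial>lborel) = ennreal (\<epsilon>\<^sup>2)"
    proof -
      have "(\<integral>\<^sup>+w. ennreal ((cmod (q w))\<^sup>2) \<partial>lborel)
          = (\<integral>\<^sup>+w. ennreal ((cmod (fourier (\<lambda>x. eddington k f' x - g x) w))\<^sup>2) \<partial>lborel)"
        using Fd by (intro nn_integral_cong_AE) auto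
      also have "\<dots> = ennreal (\<epsilon>\<^sup>2)"
        using nn_integral_L2[OF fourier_limit(1)[OF d]] fourier.V_norm[OF d] consistent by simp
      finally show ?thesis .
    qed
    have stable': "(\<integral>\<^sup>+w. ennreal ((cmod (fourier (eddington k f') w))\<^sup>2) * ennreal (exp (w\<^sup>2)) \<partial>lborel) \<le> ennreal (M\<^sup>2)"
    proof -
      let ?I = "spectral_form (inverse_AAstar_graph (eddington k)) (psi k) (eddington k f')"
      have fin: "?I < \<infinity>" using H by (simp add: H_psi_def)
      have "sqrt (enn2real ?I) \<le> M" using stable by (simp add: psi_norm_def)
      then have "enn2real ?I \<le> M\<^sup>2" by (rule sqrt_le_D)
      then have "?I \<le> ennreal (M\<^sup>2)"
        using fin by (metis ennreal_enn2real ennreal_leI infinity_ennreal_def)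
      then show ?thesis unfolding spectral_form_eddington[OF k Bf'] .
    qed
    \<comment> \<open>the transforms of \<open>B f'\<close> (by stability) and of \<open>g\<close> (a Gaussian spectrum) stay square-integrable
      with the weight \<open>e\<^bsup>w\<^sup>2\<^esup>\<close>\<close>
    have weighted: "(\<integral>\<^sup>+w. ennreal (exp (w\<^sup>2)) * ennreal ((cmod (q w))\<^sup>2) \<partial>lborel) \<le> ennreal K"
    proof -
      have "(\<integral>\<^sup>+w. ennreal (exp (w\<^sup>2)) * ennreal ((cmod (q w))\<^sup>2) \<partial>lborel)
          \<le> (\<integral>\<^sup>+w. 2 * (ennreal ((cmod (fourier (eddington k f') w))\<^sup>2) * ennreal (exp (w\<^sup>2)))
              + 2 * ennreal ((cmod (fourier u w))\<^sup>2) \<partial>lborel)"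
      proof (rule nn_integral_mono_AE, use fourier_eddington[OF k f'] Fg Fg' in eventually_elim)
        case (elim w)
        have q: "q w = fourier (eddington k f') w - of_real (exp (- (w\<^sup>2) / 2)) * fourier u w"
          using elim by (simp add: q_def algebra_simps)
        \<comment> \<open>the weight cancels the decay of the Gaussian exactly\<close>
        have e: "exp (w\<^sup>2) * (exp (- (w\<^sup>2) / 2))\<^sup>2 = 1"
          by (simp flip: exp_double exp_add)
        have "(cmod (q w))\<^sup>2 \<le> (cmod (fourier (eddington k f') w) + exp (- (w\<^sup>2) / 2) * cmod (fourier u w))\<^sup>2"
          unfolding q using norm_triangle_ineq4[of "fourier (eddington k f') w" "of_real (exp (- (w\<^sup>2) / 2)) * fourier u w"]
          by (intro power_mono) (simp_all add: norm_mult)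
        also have "\<dots> \<le> 2 * (cmod (fourier (eddington k f') w))\<^sup>2 + 2 * (exp (- (w\<^sup>2) / 2) * cmod (fourier u w))\<^sup>2"
          using sum_squares_bound[of "cmod (fourier (eddington k f') w)" "exp (- (w\<^sup>2) / 2) * cmod (fourier u w)"]
          by (simp add: power2_sum)
        finally have "exp (w\<^sup>2) * (cmod (q w))\<^sup>2
            \<le> exp (w\<^sup>2) * (2 * (cmod (fourier (eddington k f') w))\<^sup>2 + 2 * (exp (- (w\<^sup>2) / 2) * cmod (fourier u w))\<^sup>2)"
          by (rule mult_left_mono) simp
        also have "\<dots> = 2 * ((cmod (fourier (eddington k f') w))\<^sup>2 * exp (w\<^sup>2))
            + 2 * ((exp (w\<^sup>2) * (exp (- (w\<^sup>2) / 2))\<^sup>2) * (cmod (fourier u w))\<^sup>2)"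
          by (simp only: power_mult_distrib distrib_left mult_ac)
        finally have "exp (w\<^sup>2) * (cmod (q w))\<^sup>2
            \<le> 2 * ((cmod (fourier (eddington k f') w))\<^sup>2 * exp (w\<^sup>2)) + 2 * (cmod (fourier u w))\<^sup>2"
          unfolding e by simp
        then have "ennreal (exp (w\<^sup>2) * (cmod (q w))\<^sup>2)
            \<le> ennreal (2 * ((cmod (fourier (eddington k f') w))\<^sup>2 * exp (w\<^sup>2)) + 2 * (cmod (fourier u w))\<^sup>2)"
          by (rule ennreal_leI)
        then show ?case by (simp add: ennreal_mult ennreal_plus)
      qed
      also have "\<dots> = 2 * (\<integral>\<^sup>+w. ennreal ((cmod (fourier (eddington k f') w))\<^sup>2) * ennreal (exp (w\<^sup>2)) \<partial>lborel)
          + 2 * (\<integral>\<^sup>+w. ennreal ((cmod (fourier u w))\<^sup>2) \<partial>lborel)"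
        by (simp add: nn_integral_add nn_integral_cmult)
      also have "\<dots> \<le> 2 * ennreal (M\<^sup>2) + 2 * ennreal ((l2_norm u)\<^sup>2)"
        using nn_integral_L2[OF fourier_limit(1)[OF u]] fourier.V_norm[OF u]
        by (intro add_mono mult_left_mono stable') auto
      also have "\<dots> = ennreal K" by (simp add: K_def ennreal_mult ennreal_plus)
      finally show ?thesis .
    qed
    let ?c = "(taylor_exp k L)\<^sup>2"
    have diff: "(\<lambda>x. f x - f' x) \<in> L2" by (intro L2_diff f f')
    have "ennreal ((l2_norm (\<lambda>x. f x - f' x))\<^sup>2) = (\<integral>\<^sup>+w. ennreal ((cmod (fourier (\<lambda>x. f x - f' x) w))\<^sup>2) \<partial>lborel)"
      using nn_integral_L2[OF fourier_limit(1)[OF diff]] fourier.V_norm[OF diff] by simp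
    also have "\<dots> \<le> (\<integral>\<^sup>+w. ennreal ?c * (ennreal ((cmod (q w))\<^sup>2)
        + ennreal (\<epsilon>\<^sup>2) * (ennreal (exp (w\<^sup>2)) * ennreal ((cmod (q w))\<^sup>2))) \<partial>lborel)"
    proof (rule nn_integral_mono_AE, use fourier.V_linear[OF f f', of "-1"] in eventually_elim)
      case (elim w)
      let ?t = "taylor_exp k (w\<^sup>2 / 2)"
      have t: "1 \<le> ?t" by (rule taylor_exp_ge_1) simp
      have "cmod (fourier (\<lambda>x. f x - f' x) w) = cmod (fourier f' w - fourier f w)"
        using elim by (simp add: norm_minus_commute)
      also have "\<dots> = ?t * cmod (q w)"
        using t by (simp add: q_def norm_mult eddington_multiplier_def norm_divide)
      finally have "(cmod (fourier (\<lambda>x. f x - f' x) w))\<^sup>2 = ?t\<^sup>2 * (cmod (q w))\<^sup>2"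
        by (simp add: power_mult_distrib)
      also have "\<dots> \<le> (?c * (1 + \<epsilon>\<^sup>2 * exp (w\<^sup>2))) * (cmod (q w))\<^sup>2"
        using taylor_exp_interpolation[of "w\<^sup>2 / 2" L k] L by (intro mult_right_mono) auto
      also have "\<dots> = ?c * ((cmod (q w))\<^sup>2 + \<epsilon>\<^sup>2 * (exp (w\<^sup>2) * (cmod (q w))\<^sup>2))"
        by (simp add: algebra_simps)
      finally have "ennreal ((cmod (fourier (\<lambda>x. f x - f' x) w))\<^sup>2)
          \<le> ennreal (?c * ((cmod (q w))\<^sup>2 + \<epsilon>\<^sup>2 * (exp (w\<^sup>2) * (cmod (q w))\<^sup>2)))"
        by (rule ennreal_leI)
      then show ?case by (simp add: ennreal_mult ennreal_plus)
    qed
    also have "\<dots> = ennreal ?c * ((\<integral>\<^sup>+w. ennreal ((cmod (q w))\<^sup>2) \<partial>lborel)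
        + ennreal (\<epsilon>\<^sup>2) * (\<integral>\<^sup>+w. ennreal (exp (w\<^sup>2)) * ennreal ((cmod (q w))\<^sup>2) \<partial>lborel))"
      by (simp add: nn_integral_cmult nn_integral_add)
    also have "\<dots> \<le> ennreal ?c * (ennreal (\<epsilon>\<^sup>2) + ennreal (\<epsilon>\<^sup>2) * ennreal K)"
      unfolding small by (intro mult_left_mono add_mono weighted order_refl) auto
    also have "\<dots> = ennreal (?c * (\<epsilon>\<^sup>2 + \<epsilon>\<^sup>2 * K))"
      using K by (simp add: ennreal_mult ennreal_plus)
    finally have "(l2_norm (\<lambda>x. f x - f' x))\<^sup>2 \<le> ?c * (\<epsilon>\<^sup>2 + \<epsilon>\<^sup>2 * K)"
      using K by (subst (asm) ennreal_le_iff) auto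
    also have "\<dots> = (sqrt (1 + K) * taylor_exp k L * \<epsilon>)\<^sup>2"
    proof -
      have "(sqrt (1 + K))\<^sup>2 = 1 + K" using K by simp
      then show ?thesis unfolding power_mult_distrib by (simp add: algebra_simps)
    qed
    finally have "l2_norm (\<lambda>x. f x - f' x) \<le> sqrt (1 + K) * taylor_exp k L * \<epsilon>"
    proof (rule power2_le_imp_le)
      have "0 \<le> taylor_exp k L" using taylor_exp_ge_1[of L k] L by linarith
      then show "0 \<le> sqrt (1 + K) * taylor_exp k L * \<epsilon>" using K \<epsilon> by (intro mult_nonneg_nonneg) auto
    qed
    also have "\<dots> \<le> sqrt (1 + K) * (exp 1 * L ^ k) * \<epsilon>"
      using K \<epsilon> taylor_exp_le_power[OF L(1), of k] by (intro mult_right_mono mult_left_mono) auto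
    finally show ?thesis by (simp add: L_def mult_ac)
  qed
  show ?thesis
  proof (intro exI[of _ "sqrt (1 + K) * exp 1"] conjI allI impI ballI)
    show "0 < sqrt (1 + K) * exp 1" using K by (intro mult_pos_pos) auto
  qed (use main in blast)
qed

end
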